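(* Let $\mathcal{C}^{Gauss}=\mathcal{C}(\mathcal{P}^{Gauss},m^{Gauss},n)$ and $\mathcal{F}^{Gauss}=\mathcal{F}(\mathcal{P}^{Gauss},m^{Gauss},c)$ be the Gaussian conditional independence testing problem and the Gaussian poly-forest learning problem on $d$ nodes, and let $\psi^{Gauss}=\mathbf{1}\{\widehat m^{Gauss}(X,Y\mid Z)\ge c/2\}$ be the test thresholding the sample partial correlation. Then $\psi^{Gauss}$ is optimal for $\mathcal{C}^{Gauss}$, with optimal testing radius $r_n\asymp n^{-1/2}$, and the optimal sample complexity of learning $\mathcal{F}^{Gauss}$ is $n\asymp \log d/c^{2}$, which is achieved by the PC-tree algorithm with $\psi^{Gauss}$.
   Context: Graphs. A poly-forest is a DAG whose skeleton is a forest (any two nodes connected by at most one path); $\mathcal{T}_d$ is the set of poly-forests on $[d]$. A $v$-structure is $k\to\ell\leftarrow j$ with $j,k$ non-adjacent. $\overline{G}$ is the CPDAG representing the Markov equivalence class of $G$. $p$ is Markov to $G$ if $p(X)=\prod_k p(X_k\mid X_{\mathrm{pa}(k)})$. Gaussian model. $\mathcal{P}^{Gauss}$ is the set of laws $\mathcal{N}(\mathbf{0}_3,\Sigma)$ of $(X,Y,Z)$ with $\Sigma$ a $3\times3$ positive definite matrix. Dependence is measured by the absolute partial correlation $$m^{Gauss}(X,Y\mid Z)=\frac{|\mathrm{cov}(X,Y\mid Z)|}{\sqrt{\mathrm{var}(X\mid Z)\,\mathrm{var}(Y\mid Z)}}$$ (absolute correlation when $Z=\emptyset$). With $\widehat\Sigma$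 the sample covariance matrix ($\frac1n\sum_i$ of outer products of the observation vectors), $$\widehat m^{Gauss}(X,Y\mid Z)=\frac{|\widehat\Sigma_{XY}-\widehat\Sigma_{XZ}\widehat\Sigma_{ZZ}^{-1}\widehat\Sigma_{ZY}|}{\sqrt{(\widehat\Sigma_{XX}-\widehat\Sigma_{XZ}\widehat\Sigma_{ZZ}^{-1}\widehat\Sigma_{ZX})(\widehat\Sigma_{YY}-\widehat\Sigma_{YZ}\widehat\Sigma_{ZZ}^{-1}\widehat\Sigma_{ZY})}}.$$ $c$-strong tree-faithfulness. $p$ is $c$-strong tree-faithful to a poly-forest $G=(V,E)$ with respect to $m$ if (1) for every pair of adjacent nodes $j-k$, $m(X_k;X_j\mid X_\ell)\ge c$ for all $\ell\in(V\cup\{\emptyset\})\setminus\{k,j\}$ ($\ell=\emptyset$ means no conditioning); and (2) for every $v$-structure $k\to\ell\leftarrow j$, $m(X_k;X_j\mid X_\ell)\ge c$. CI testing problem $\mathcal{C}(\mathcal{P},m,n)$. From $n$ i.i.d. samples of $(X,Y,Z)\sim p\in\mathcal{P}$, distinguish $\mathcal{H}_0=\{p\in\mathcal{P}:X\perp\!\!\!\perp Y\mid Z\}$ from $\mathcal{H}_1=\{p\in\mathcal{P}:m(X;Y\mid Z)\ge r\}$ (in $\psi^{Gauss}$ the threshold parameter $c$ is identified with $r$). A test is a $\{0,1\}$-valued function of the sample ($0$ selects $\mathcal{H}_0$). The minimax optimal testing radius $r_n$ is the infimum (in terms of $n$, up to constants) of $r>0$ such that $\inf_\psi\{\sup_{\mathcal{H}_0}\mathbb{E}_p[\psi]+\sup_{\mathcal{H}_1}\mathbb{E}_p[1-\psi]\}\le1/10$;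 a test is optimal if it attains this error control at a radius of order $r_n$. Poly-forest learning problem $\mathcal{F}(\mathcal{P},m,c)$. The set of pairs $(p,G)$ with $G\in\mathcal{T}_d$, $p$ Markov and $c$-strong tree-faithful to $G$ with respect to $m$, and the law of $(X_j,X_k,X_\ell)$ in $\mathcal{P}$ for all $j,k,\ell\in[d]$; $\mathcal{F}^{Gauss}$ consists of the laws $\mathcal{N}(\mathbf{0}_d,\Sigma)$ with $\Sigma$ positive definite that are Markov and $c$-strong tree-faithful to some $G\in\mathcal{T}_d$. Its optimal sample complexity (in terms of $d$ and $c$, up to constants) is $\inf\{n:\exists\,\widehat G\text{ based on }n\text{ i.i.d. samples with }\sup_{(p,G)\in\mathcal{F}}\mathbb{P}(\widehat G\ne\overline{G})\le1/10\}$. An estimator achieves it if it has this guarantee for some $n$ of that order. The constant $1/10$ may be replaced by any fixed small constant. PC-tree with a CI test $\psi$. For each pair $j<k$ in $[d]$ and each $\ell\in([d]\cup\{\emptyset\})\setminus\{j,k\}$, test $X_j\perp\!\!\!\perp X_k\mid X_\ell$ with $\psi$. If all tests reject, put $j-k$ in the skeleton; otherwise let $S(j,k)$ be the set of those $\ell$ for which the test accepts. Then for each pair of non-adjacent $j,k$ with common neighbour $\ell$, if $\ell\notin S(j,k)$ orient $j\to\ell\leftarrow k$; finally orient further edges by the standard Meek rules and output the resulting graph. Convention: $a\asymp b$ means equality up to positive multiplicative constants.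
   Formalization: The learning claims (order log d/c² and its achievement by PC-tree) are stated for 0 < c ≤ c0 with constants depending on c0, for every fixed c0 < 1; constants uniform as c tends to 1 are impossible, since for fixed d two samples then suffice. *)

theory Defs
  imports "HOL-Probability.Probability"
begin

definition order_equiv_on :: "'a set \<Rightarrow> ('a \<Rightarrow> real) \<Rightarrow> ('a \<Rightarrow> real) \<Rightarrow> bool" where
  "order_equiv_on S f g \<longleftrightarrow>
     (\<exists>C1>0. \<exists>C2>0. \<forall>x\<in>S. C1 * g x \<le> f x \<and> f x \<le> C2 * g x)"

text \<open>
  The index set of a random vector \<open>X\<close> in \<open>d\<close> dimensions is \<open>{..<d}\<close>; the dimension has to be a
  natural number rather than a type because constants must be uniform in it.  A law lives on
  \<open>vec_space d\<close>, and \<open>X j\<close> is the coordinate \<open>\<lambda>x. x j\<close>.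
\<close>

definition vec_space :: "nat \<Rightarrow> (nat \<Rightarrow> real) measure" where
  "vec_space d = (\<Pi>\<^sub>M i\<in>{..<d}. borel)"

definition pos_def :: "nat \<Rightarrow> (nat \<Rightarrow> nat \<Rightarrow> real) \<Rightarrow> bool" where
  "pos_def d \<Sigma> \<longleftrightarrow>
     (\<forall>i<d. \<forall>j<d. \<Sigma> i j = \<Sigma> j i) \<and>
     (\<forall>v :: nat \<Rightarrow> real. (\<exists>i<d. v i \<noteq> 0) \<longrightarrow> (\<Sum>i<d. \<Sum>j<d. v i * \<Sigma> i j * v j) > 0)"

definition std_normal_vec :: "nat \<Rightarrow> (nat \<Rightarrow> real) measure" where
  "std_normal_vec d = (\<Pi>\<^sub>M i\<in>{..<d}. density lborel (\<lambda>x. ennreal (std_normal_density x)))"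

text \<open>\<open>M\<close> is \<open>N(0, \<Sigma>)\<close>: the law of \<open>A W\<close> for standard normal \<open>W\<close> and a square matrix \<open>A\<close> with
  \<open>A A\<^sup>T = \<Sigma>\<close>; the law does not depend on the choice of \<open>A\<close>.\<close>

definition is_normal_law :: "nat \<Rightarrow> (nat \<Rightarrow> nat \<Rightarrow> real) \<Rightarrow> (nat \<Rightarrow> real) measure \<Rightarrow> bool" where
  "is_normal_law d \<Sigma> M \<longleftrightarrow>
     (\<exists>A :: nat \<Rightarrow> nat \<Rightarrow> real.
        (\<forall>i<d. \<forall>j<d. \<Sigma> i j = (\<Sum>k<d. A i k * A j k)) \<and>
        M = distr (std_normal_vec d) (vec_space d) (\<lambda>w. \<lambda>i\<in>{..<d}. \<Sum>k<d. A i k * w k))"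

definition gaussian_laws :: "nat \<Rightarrow> (nat \<Rightarrow> real) measure set" where
  "gaussian_laws d = {M. \<exists>\<Sigma>. pos_def d \<Sigma> \<and> is_normal_law d \<Sigma> M}"

definition iid_samples :: "nat \<Rightarrow> (nat \<Rightarrow> real) measure \<Rightarrow> (nat \<Rightarrow> nat \<Rightarrow> real) measure" where
  "iid_samples n p = (\<Pi>\<^sub>M i\<in>{..<n}. p)"

definition generated_alg :: "'a measure \<Rightarrow> ('a \<Rightarrow> real) \<Rightarrow> 'a measure" where
  "generated_alg M Z = vimage_algebra (space M) Z borel"

definition cond_indep :: "'a measure \<Rightarrow> ('a \<Rightarrow> real) \<Rightarrow> ('a \<Rightarrow> real) \<Rightarrow> ('a \<Rightarrow> real) \<Rightarrow> bool" where
  "cond_indep M X Y Z \<longleftrightarrow>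
     (\<forall>A\<in>sets borel. \<forall>B\<in>sets borel.
        AE \<omega> in M.
          real_cond_exp M (generated_alg M Z) (\<lambda>\<omega>. indicator A (X \<omega>) * indicator B (Y \<omega>)) \<omega>
          = real_cond_exp M (generated_alg M Z) (\<lambda>\<omega>. indicator A (X \<omega>)) \<omega>
            * real_cond_exp M (generated_alg M Z) (\<lambda>\<omega>. indicator B (Y \<omega>)) \<omega>)"

definition cov :: "'a measure \<Rightarrow> ('a \<Rightarrow> real) \<Rightarrow> ('a \<Rightarrow> real) \<Rightarrow> real" where
  "cov M X Y = (\<integral>\<omega>. X \<omega> * Y \<omega> \<partial>M) - (\<integral>\<omega>. X \<omega> \<partial>M) * (\<integral>\<omega>. Y \<omega> \<partial>M)"

definition cond_cov ::
    "'a measure \<Rightarrow> ('a \<Rightarrow> real) \<Rightarrow> ('a \<Rightarrow> real) \<Rightarrow> ('a \<Rightarrow> real) \<Rightarrow> 'a \<Rightarrow> real" where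
  "cond_cov M X Y Z \<omega> =
     real_cond_exp M (generated_alg M Z) (\<lambda>\<omega>. X \<omega> * Y \<omega>) \<omega>
     - real_cond_exp M (generated_alg M Z) X \<omega> * real_cond_exp M (generated_alg M Z) Y \<omega>"

text \<open>The conditioning variable is \<open>Some l\<close>, or \<open>None\<close> for no conditioning.  Conditional covariances
  are random variables, but for a normal law they are almost surely constant, so that the partial
  correlation is the almost sure value of the quotient.\<close>

fun m_gauss :: "(nat \<Rightarrow> real) measure \<Rightarrow> nat \<Rightarrow> nat \<Rightarrow> nat option \<Rightarrow> real" where
  "m_gauss M j k None =
     \<bar>cov M (\<lambda>x. x j) (\<lambda>x. x k)\<bar>
       / sqrt (cov M (\<lambda>x. x j) (\<lambda>x. x j) * cov M (\<lambda>x. x k) (\<lambda>x. x k))"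
| "m_gauss M j k (Some l) =
     (THE v. AE x in M.
        \<bar>cond_cov M (\<lambda>x. x j) (\<lambda>x. x k) (\<lambda>x. x l) x\<bar>
          / sqrt (cond_cov M (\<lambda>x. x j) (\<lambda>x. x j) (\<lambda>x. x l) x
                  * cond_cov M (\<lambda>x. x k) (\<lambda>x. x k) (\<lambda>x. x l) x) = v)"

text \<open>\<open>s i j\<close> is the coordinate \<open>j\<close> of the observation \<open>i\<close>.  Where the sample partial correlation is
  undefined (a vanishing denominator) it has the value 0, by the convention for division.\<close>

definition sample_cov :: "nat \<Rightarrow> (nat \<Rightarrow> nat \<Rightarrow> real) \<Rightarrow> nat \<Rightarrow> nat \<Rightarrow> real" where
  "sample_cov n s j k = (1 / real n) * (\<Sum>i<n. s i j * s i k)"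

definition sample_cond_cov :: "nat \<Rightarrow> (nat \<Rightarrow> nat \<Rightarrow> real) \<Rightarrow> nat \<Rightarrow> nat \<Rightarrow> nat \<Rightarrow> real" where
  "sample_cond_cov n s l j k =
     sample_cov n s j k - sample_cov n s j l * inverse (sample_cov n s l l) * sample_cov n s l k"

fun m_hat :: "nat \<Rightarrow> (nat \<Rightarrow> nat \<Rightarrow> real) \<Rightarrow> nat \<Rightarrow> nat \<Rightarrow> nat option \<Rightarrow> real" where
  "m_hat n s j k None =
     \<bar>sample_cov n s j k\<bar> / sqrt (sample_cov n s j j * sample_cov n s k k)"
| "m_hat n s j k (Some l) =
     \<bar>sample_cond_cov n s l j k\<bar>
       / sqrt (sample_cond_cov n s l j j * sample_cond_cov n s l k k)"

definition psi_gauss ::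
    "nat \<Rightarrow> real \<Rightarrow> nat \<Rightarrow> nat \<Rightarrow> nat option \<Rightarrow> (nat \<Rightarrow> nat \<Rightarrow> real) \<Rightarrow> real" where
  "psi_gauss n c j k l s = (if m_hat n s j k l \<ge> c / 2 then 1 else 0)"

text \<open>The triple \<open>(X, Y, Z)\<close> is a vector in three dimensions with coordinates 0, 1, 2.\<close>

type_synonym dependence = "(nat \<Rightarrow> real) measure \<Rightarrow> nat \<Rightarrow> nat \<Rightarrow> nat option \<Rightarrow> real"

definition ci_null :: "(nat \<Rightarrow> real) measure set \<Rightarrow> (nat \<Rightarrow> real) measure set" where
  "ci_null P = {p\<in>P. cond_indep p (\<lambda>x. x 0) (\<lambda>x. x 1) (\<lambda>x. x 2)}"

definition ci_alt ::
    "(nat \<Rightarrow> real) measure set \<Rightarrow> dependence \<Rightarrow> real \<Rightarrow> (nat \<Rightarrow> real) measure set" where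
  "ci_alt P m r = {p\<in>P. m p 0 1 (Some 2) \<ge> r}"

definition ci_tests :: "nat \<Rightarrow> ((nat \<Rightarrow> nat \<Rightarrow> real) \<Rightarrow> real) set" where
  "ci_tests n = {\<psi> \<in> borel_measurable (iid_samples n (vec_space 3)). \<forall>s. \<psi> s \<in> {0, 1}}"

text \<open>Suprema and infima are taken in \<^typ>\<open>ennreal\<close>, where the supremum over an empty hypothesis
  is 0.\<close>

definition test_risk ::
    "(nat \<Rightarrow> real) measure set \<Rightarrow> dependence \<Rightarrow> nat \<Rightarrow> real \<Rightarrow>
     ((nat \<Rightarrow> nat \<Rightarrow> real) \<Rightarrow> real) \<Rightarrow> ennreal" where
  "test_risk P m n r \<psi> =
     (SUP p\<in>ci_null P. \<integral>\<^sup>+ s. ennreal (\<psi> s) \<partial>iid_samples n p)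
     + (SUP p\<in>ci_alt P m r. \<integral>\<^sup>+ s. ennreal (1 - \<psi> s) \<partial>iid_samples n p)"

definition optimal_radius :: "(nat \<Rightarrow> real) measure set \<Rightarrow> dependence \<Rightarrow> nat \<Rightarrow> real" where
  "optimal_radius P m n =
     Inf {r. r > 0 \<and> (INF \<psi>\<in>ci_tests n. test_risk P m n r \<psi>) \<le> ennreal (1 / 10)}"

text \<open>\<open>\<psi> n r\<close> is the test for \<open>n\<close> samples with threshold parameter \<open>r\<close>.\<close>

definition optimal_test ::
    "(nat \<Rightarrow> real) measure set \<Rightarrow> dependence \<Rightarrow>
     (nat \<Rightarrow> real \<Rightarrow> (nat \<Rightarrow> nat \<Rightarrow> real) \<Rightarrow> real) \<Rightarrow> bool" where
  "optimal_test P m \<psi> \<longleftrightarrow>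
     (\<exists>r :: nat \<Rightarrow> real.
        order_equiv_on {1..} r (optimal_radius P m) \<and>
        (\<forall>n\<ge>1. r n > 0 \<and> \<psi> n (r n) \<in> ci_tests n \<and>
               test_risk P m n (r n) (\<psi> n (r n)) \<le> ennreal (1 / 10)))"

text \<open>A graph on \<open>{..<d}\<close> is its set of arcs.  In a partially directed graph an undirected edge
  between \<open>a\<close> and \<open>b\<close> is represented by the two arcs \<open>(a, b)\<close> and \<open>(b, a)\<close>.\<close>

type_synonym graph = "(nat \<times> nat) set"

definition adj :: "graph \<Rightarrow> nat \<Rightarrow> nat \<Rightarrow> bool" where
  "adj E a b \<longleftrightarrow> (a, b) \<in> E \<or> (b, a) \<in> E"

definition arrow :: "graph \<Rightarrow> nat \<Rightarrow> nat \<Rightarrow> bool" where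
  "arrow E a b \<longleftrightarrow> (a, b) \<in> E \<and> (b, a) \<notin> E"

definition undirected :: "graph \<Rightarrow> nat \<Rightarrow> nat \<Rightarrow> bool" where
  "undirected E a b \<longleftrightarrow> (a, b) \<in> E \<and> (b, a) \<in> E"

definition parents :: "graph \<Rightarrow> nat \<Rightarrow> nat set" where
  "parents E k = {j. (j, k) \<in> E}"

definition dag :: "nat \<Rightarrow> graph \<Rightarrow> bool" where
  "dag d E \<longleftrightarrow> E \<subseteq> {..<d} \<times> {..<d} \<and> acyclic E"

definition path_between :: "graph \<Rightarrow> nat \<Rightarrow> nat \<Rightarrow> nat list \<Rightarrow> bool" where
  "path_between E a b p \<longleftrightarrow>
     p \<noteq> [] \<and> hd p = a \<and> last p = b \<and> distinct p \<and> successively (adj E) p"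

definition poly_forests :: "nat \<Rightarrow> graph set" where
  "poly_forests d =
     {E. dag d E \<and> (\<forall>a b p q. path_between E a b p \<longrightarrow> path_between E a b q \<longrightarrow> p = q)}"

definition v_structure :: "graph \<Rightarrow> nat \<Rightarrow> nat \<Rightarrow> nat \<Rightarrow> bool" where
  "v_structure E k l j \<longleftrightarrow> (k, l) \<in> E \<and> (j, l) \<in> E \<and> k \<noteq> j \<and> \<not> adj E k j"

text \<open>Two DAGs are Markov equivalent if they have the same d-separations.  Separation of sets of
  nodes is separation of all pairs, so pairs of nodes suffice.\<close>

definition collider :: "graph \<Rightarrow> nat list \<Rightarrow> nat \<Rightarrow> bool" where
  "collider E p i \<longleftrightarrow> (p ! (i - 1), p ! i) \<in> E \<and> (p ! (i + 1), p ! i) \<in> E"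

definition blocked :: "graph \<Rightarrow> nat set \<Rightarrow> nat list \<Rightarrow> bool" where
  "blocked E S p \<longleftrightarrow>
     (\<exists>i. 0 < i \<and> i + 1 < length p \<and>
        (if collider E p i then \<forall>v. (p ! i, v) \<in> E\<^sup>* \<longrightarrow> v \<notin> S else p ! i \<in> S))"

definition d_separated :: "graph \<Rightarrow> nat \<Rightarrow> nat \<Rightarrow> nat set \<Rightarrow> bool" where
  "d_separated E a b S \<longleftrightarrow> (\<forall>p. path_between E a b p \<longrightarrow> blocked E S p)"

definition markov_equivalent :: "nat \<Rightarrow> graph \<Rightarrow> graph \<Rightarrow> bool" where
  "markov_equivalent d E F \<longleftrightarrow>
     (\<forall>a<d. \<forall>b<d. a \<noteq> b \<longrightarrow>
        (\<forall>S \<subseteq> {..<d} - {a, b}. d_separated E a b S \<longleftrightarrow> d_separated F a b S))"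

text \<open>The union of the arcs of all DAGs in the equivalence class: an edge is directed in it iff all
  members of the class agree on its direction.\<close>

definition cpdag :: "nat \<Rightarrow> graph \<Rightarrow> graph" where
  "cpdag d E = \<Union> {F. dag d F \<and> markov_equivalent d E F}"

text \<open>\<open>f S\<close> is the density of the marginal law of the coordinates in \<open>S\<close>, and the conditional density
  of the coordinate \<open>k\<close> given its parents is the quotient of two marginal densities.\<close>

definition markov_to :: "nat \<Rightarrow> (nat \<Rightarrow> real) measure \<Rightarrow> graph \<Rightarrow> bool" where
  "markov_to d p E \<longleftrightarrow>
     (\<exists>f :: nat set \<Rightarrow> (nat \<Rightarrow> real) \<Rightarrow> ennreal.
        (\<forall>S\<subseteq>{..<d}.
           f S \<in> borel_measurable (\<Pi>\<^sub>M i\<in>S. lborel) \<and>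
           distr p (\<Pi>\<^sub>M i\<in>S. lborel) (\<lambda>x. restrict x S) = density (\<Pi>\<^sub>M i\<in>S. lborel) (f S)) \<and>
        (AE x in (\<Pi>\<^sub>M i\<in>{..<d}. lborel).
           f {..<d} x =
             (\<Prod>k<d. f (insert k (parents E k)) (restrict x (insert k (parents E k)))
                      / f (parents E k) (restrict x (parents E k)))))"

definition cond_choices :: "nat \<Rightarrow> nat \<Rightarrow> nat \<Rightarrow> nat option set" where
  "cond_choices d j k = insert None (Some ` ({..<d} - {j, k}))"

definition strong_tree_faithful ::
    "nat \<Rightarrow> dependence \<Rightarrow> real \<Rightarrow> (nat \<Rightarrow> real) measure \<Rightarrow> graph \<Rightarrow> bool" where
  "strong_tree_faithful d m c p E \<longleftrightarrow>
     (\<forall>j k. adj E j k \<longrightarrow> (\<forall>l\<in>cond_choices d j k. m p k j l \<ge> c)) \<and>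
     (\<forall>k l j. v_structure E k l j \<longrightarrow> m p k j (Some l) \<ge> c)"

text \<open>\<open>Q\<close> is the class of joint laws.  For the Gaussian problem it is \<^term>\<open>gaussian_laws d\<close>, for which
  all three-dimensional marginals are Gaussian as well.\<close>

definition learning_problem ::
    "nat \<Rightarrow> (nat \<Rightarrow> real) measure set \<Rightarrow> dependence \<Rightarrow> real \<Rightarrow>
     ((nat \<Rightarrow> real) measure \<times> graph) set" where
  "learning_problem d Q m c =
     {(p, E). p \<in> Q \<and> E \<in> poly_forests d \<and> markov_to d p E \<and> strong_tree_faithful d m c p E}"

definition estimators :: "nat \<Rightarrow> nat \<Rightarrow> ((nat \<Rightarrow> nat \<Rightarrow> real) \<Rightarrow> graph) set" where
  "estimators d n =
     iid_samples n (vec_space d) \<rightarrow>\<^sub>M count_space (Pow ({..<d} \<times> {..<d}))"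

definition learns ::
    "nat \<Rightarrow> nat \<Rightarrow> ((nat \<Rightarrow> real) measure \<times> graph) set \<Rightarrow>
     ((nat \<Rightarrow> nat \<Rightarrow> real) \<Rightarrow> graph) \<Rightarrow> bool" where
  "learns d n \<F> G_hat \<longleftrightarrow>
     G_hat \<in> estimators d n \<and>
     (SUP (p, E)\<in>\<F>. emeasure (iid_samples n p)
        {s \<in> space (iid_samples n p). G_hat s \<noteq> cpdag d E}) \<le> ennreal (1 / 10)"

definition sample_complexity :: "nat \<Rightarrow> ((nat \<Rightarrow> real) measure \<times> graph) set \<Rightarrow> nat" where
  "sample_complexity d \<F> = Inf {n. \<exists>G_hat. learns d n \<F> G_hat}"

text \<open>The argument \<open>T\<close> gives the outcomes of all tests, and is consulted only for \<open>j < k\<close>.\<close>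

type_synonym outcomes = "nat \<Rightarrow> nat \<Rightarrow> nat option \<Rightarrow> real"

definition pc_skeleton :: "nat \<Rightarrow> outcomes \<Rightarrow> graph" where
  "pc_skeleton d T =
     {(j, k). j < d \<and> k < d \<and> j \<noteq> k \<and> (\<forall>l\<in>cond_choices d j k. T (min j k) (max j k) l = 1)}"

definition pc_sep :: "nat \<Rightarrow> outcomes \<Rightarrow> nat \<Rightarrow> nat \<Rightarrow> nat option set" where
  "pc_sep d T j k = {l \<in> cond_choices d j k. T (min j k) (max j k) l = 0}"

definition pc_arrows :: "nat \<Rightarrow> outcomes \<Rightarrow> graph" where
  "pc_arrows d T =
     {(j, l). \<exists>k<d. k \<noteq> j \<and> (j, l) \<in> pc_skeleton d T \<and> (k, l) \<in> pc_skeleton d T \<and>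
        (j, k) \<notin> pc_skeleton d T \<and> Some l \<notin> pc_sep d T j k}"

text \<open>Test errors may lead to contradictory requests for the orientation of an edge, which then stays
  undirected.\<close>

definition pc_pattern :: "nat \<Rightarrow> outcomes \<Rightarrow> graph" where
  "pc_pattern d T =
     {(a, b) \<in> pc_skeleton d T. \<not> ((b, a) \<in> pc_arrows d T \<and> (a, b) \<notin> pc_arrows d T)}"

definition meek_applies :: "graph \<Rightarrow> nat \<Rightarrow> nat \<Rightarrow> bool" where
  "meek_applies H a b \<longleftrightarrow> undirected H a b \<and>
     ((\<exists>c. arrow H c a \<and> \<not> adj H c b) \<or>
      (\<exists>c. arrow H a c \<and> arrow H c b) \<or>
      (\<exists>c e. c \<noteq> e \<and> undirected H a c \<and> undirected H a e \<and>
             arrow H c b \<and> arrow H e b \<and> \<not> adj H c e) \<or>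
      (\<exists>c e. undirected H a c \<and> arrow H c e \<and> arrow H e b \<and> adj H a e \<and> \<not> adj H c b))"

definition meek_step :: "graph \<Rightarrow> graph \<Rightarrow> bool" where
  "meek_step H H' \<longleftrightarrow> (\<exists>a b. meek_applies H a b \<and> H' = H - {(b, a)})"

text \<open>Rules are applied one at a time, in some order, until none applies.\<close>

definition meek_closure :: "graph \<Rightarrow> graph" where
  "meek_closure H = (SOME H'. meek_step\<^sup>*\<^sup>* H H' \<and> (\<forall>H''. \<not> meek_step H' H''))"

definition pc_tree :: "nat \<Rightarrow> outcomes \<Rightarrow> graph" where
  "pc_tree d T = meek_closure (pc_pattern d T)"

definition pc_tree_gauss :: "nat \<Rightarrow> nat \<Rightarrow> real \<Rightarrow> (nat \<Rightarrow> nat \<Rightarrow> real) \<Rightarrow> graph" where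
  "pc_tree_gauss d n c s = pc_tree d (\<lambda>j k l. psi_gauss n c j k l s)"

end

theory Submission
  imports Defs
begin

text \<open>
  Testing: by Kac's criterion the residual of \<open>X\<close> after regression on \<open>Z\<close> is independent of \<open>Z\<close>, so
  the conditional covariances of a normal law are the constants given by the Schur complement, and
  conditional independence forces the partial covariance to vanish.  The sample partial correlation
  does not change if \<open>X\<close> and \<open>Y\<close> are replaced by their normalized residuals, after which it is a
  quotient of averages of products of standard normal variables; a Chernoff bound for the squares and
  polarization show that the test errs with probability at most \<open>24 exp (- n c\<^sup>2 / 6400)\<close>.

  Learning: a Markov law satisfies linear structural equations.  In a poly-forest these imply that two
  correlated nodes have a common ancestor, and that the covariances multiply along an unshielded
  non-collider, so that the population tests have exactly the outcomes for which PC-tree recovers the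
  skeleton and the \<open>v\<close>-structures.  Only the first Meek rule can fire in a forest; its closure is the
  CPDAG because an undirected tree component can be re-rooted anywhere by reversing edges out of a
  source one at a time.  A union bound over \<open>O(d\<^sup>3)\<close> tests gives the sample size.

  Both lower bounds compare the standard normal law with the uniform mixture of the laws in which
  only coordinates \<open>0\<close> and \<open>k\<close> are correlated, by the second moment of the likelihood ratio
  (\<open>1 / (1 - c\<^sup>2)\<close> per observation on the diagonal, \<open>1\<close> off the diagonal).
\<close>


subsection \<open>Poly-forests and Markov equivalence\<close>

text \<open>The Markov hypothesis is a factorization into quotients of marginal densities. These are
  fixed only almost everywhere and may vanish, so nothing can be read off by algebra on a precision
  matrix. The factorization enters at a single point: integrated over ancestral sets it says that
  the conditional law of a node given its non-descendants depends on the parents alone. For a normal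
  law this becomes a set of linear identities between covariances, and what remains concerns a
  matrix and a forest. The forest contributes that every skeleton edge is a bridge, which is why
  reachability with one edge deleted occurs in the graphical as well as in the covariance arguments.
  A normal law is only ever inspected through one linear functional at a time. This makes
  characteristic functions the tool for independence, and forces products to be written as
  differences of squares. Population values strictly between 0 and \<open>c\<close> are left
  undecided by the assumptions. Correctness of PC-tree therefore rests on just those tests whose
  population value is known to be 0 or at least \<open>c\<close>.\<close>

lemma rtrancl_distinct_path:
  assumes "(a, b) \<in> {(x, y). R x y}\<^sup>*"
  shows "\<exists>p. p \<noteq> [] \<and> hd p = a \<and> last p = b \<and> distinct p \<and> successively R p"
  using assms
proof (induction rule: rtrancl_induct)
  case base
  show ?case by (rule exI[of _ "[a]"]) simp
next
  case (step b c)
  then obtain p where p: "p \<noteq> []" "hd p = a" "last p = b" "distinct p" "successively R p" by blast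
  \<comment> \<open>Loop erasure: if the new endpoint has been visited before, the path is cut back
    to that visit.\<close>
  show ?case
  proof (cases "c \<in> set p")
    case True
    then obtain p1 p2 where p12: "p = p1 @ c # p2" by (meson split_list)
    then show ?thesis using p
      by (intro exI[of _ "p1 @ [c]"]) (auto simp: successively_append_iff hd_append)
  next
    case False
    then show ?thesis using p step.hyps
      by (intro exI[of _ "p @ [c]"]) (auto simp: successively_append_iff)
  qed
qed

text \<open>The skeleton with the edge \<open>u - v\<close> deleted. In a forest no edge can be
  bypassed in this relation. Working with reflexive-transitive closures lets later arguments glue
  directed and undirected connections without building lists of distinct nodes.\<close>

definition detour :: "graph \<Rightarrow> nat \<Rightarrow> nat \<Rightarrow> (nat \<times> nat) set" where
  "detour E u v = {(x, y). adj E x y \<and> {x, y} \<noteq> {u, v}}"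

lemma adj_sym: "adj E a b \<longleftrightarrow> adj E b a"
  by (auto simp: adj_def)

lemma sym_detour: "sym (detour E u v)"
  by (auto simp: sym_def detour_def adj_sym insert_commute)

lemma dag_irrefl: "dag d E \<Longrightarrow> (a, b) \<in> E \<Longrightarrow> a \<noteq> b"
  by (auto simp: dag_def acyclic_def)

lemma dag_antisym: "dag d E \<Longrightarrow> (a, b) \<in> E \<Longrightarrow> (b, a) \<notin> E"
  unfolding dag_def acyclic_def by (meson trancl.r_into_trancl trancl.trancl_into_trancl)

lemma dag_adj_neq: "dag d E \<Longrightarrow> adj E a b \<Longrightarrow> a \<noteq> b"
  by (auto simp: adj_def dest: dag_irrefl)

lemma dag_adj_less: "dag d E \<Longrightarrow> adj E a b \<Longrightarrow> a < d \<and> b < d"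
  by (auto simp: adj_def dag_def)

lemma dag_no_cycle: "dag d E \<Longrightarrow> (a, b) \<in> E \<Longrightarrow> (b, a) \<notin> E\<^sup>*"
  unfolding dag_def acyclic_def by (meson rtrancl_into_trancl2)

lemma poly_forest_dag: "E \<in> poly_forests d \<Longrightarrow> dag d E"
  by (simp add: poly_forests_def)

lemma poly_forest_path_unique:
  "E \<in> poly_forests d \<Longrightarrow> path_between E a b p \<Longrightarrow> path_between E a b q \<Longrightarrow> p = q"
  by (auto simp: poly_forests_def)

text \<open>Every edge of a forest is a bridge: loop erasure turns a connection that avoids the edge
  into a second path between its ends, besides \<open>[u, v]\<close> itself.\<close>

lemma poly_forest_no_detour:
  assumes E: "E \<in> poly_forests d" and uv: "adj E u v"
  shows "(u, v) \<notin> (detour E u v)\<^sup>*"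
proof
  assume "(u, v) \<in> (detour E u v)\<^sup>*"
  then obtain p where p: "p \<noteq> []" "hd p = u" "last p = v" "distinct p"
    and s: "successively (\<lambda>x y. adj E x y \<and> {x, y} \<noteq> {u, v}) p"
    unfolding detour_def by (auto dest!: rtrancl_distinct_path)
  have "path_between E u v p"
    using p successively_mono[OF s, of "adj E"] by (simp add: path_between_def)
  moreover have "path_between E u v [u, v]"
    using uv dag_adj_neq[OF poly_forest_dag[OF E] uv] by (simp add: path_between_def)
  ultimately have "p = [u, v]"
    using poly_forest_path_unique[OF E] by blast
  then show False using s by simp
qed

text \<open>Two sides of a triangle would bypass the third. Hence all triples are unshielded, and
  v-structures are just pairs of arcs with a common head.\<close>

lemma poly_forest_no_triangle:
  assumes E: "E \<in> poly_forests d" and "adj E a b" "adj E b c"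
  shows "\<not> adj E a c"
proof
  assume ac: "adj E a c"
  note neq = dag_adj_neq[OF poly_forest_dag[OF E]]
  have "(a, b) \<in> detour E a c" "(b, c) \<in> detour E a c"
    using assms(2,3) neq[OF assms(2)] neq[OF assms(3)] neq[OF ac]
    by (auto simp: detour_def doubleton_eq_iff)
  then have "(a, c) \<in> (detour E a c)\<^sup>*" by auto
  then show False using poly_forest_no_detour[OF E ac] by blast
qed

lemma poly_forests_mono:
  assumes E: "E \<in> poly_forests d" and F: "dag d F" and sub: "\<And>a b. adj F a b \<Longrightarrow> adj E a b"
  shows "F \<in> poly_forests d"
proof -
  have "path_between F a b p \<Longrightarrow> path_between E a b p" for a b p
    using sub successively_mono[of "adj F" p "adj E"] by (simp add: path_between_def)
  then show ?thesis using F poly_forest_path_unique[OF E] unfolding poly_forests_def by blast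
qed

lemma v_structure_commute: "v_structure E k l j \<longleftrightarrow> v_structure E j l k"
  by (auto simp: v_structure_def adj_sym)

lemma poly_forest_v_structure_iff:
  assumes "E \<in> poly_forests d"
  shows "v_structure E k l j \<longleftrightarrow> (k, l) \<in> E \<and> (j, l) \<in> E \<and> k \<noteq> j"
  using poly_forest_no_triangle[OF assms, of k l j] by (auto simp: v_structure_def adj_def)

section \<open>d-separation and Markov equivalence in forests\<close>

lemma d_separated_iff_blocked:
  assumes "E \<in> poly_forests d" "path_between E a b p"
  shows "d_separated E a b S \<longleftrightarrow> blocked E S p"
  using poly_forest_path_unique[OF assms(1)] assms(2) by (auto simp: d_separated_def)

lemma adj_not_d_separated:
  assumes "dag d E" "adj E a b"
  shows "\<not> d_separated E a b S"
proof -
  have "path_between E a b [a, b]"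
    using assms dag_adj_neq by (auto simp: path_between_def)
  moreover have "\<not> blocked E S [a, b]" by (auto simp: blocked_def)
  ultimately show ?thesis by (auto simp: d_separated_def)
qed

text \<open>At most one node is needed to separate. The second node \<open>y\<close> of the unique
  path either is a collider, so that the empty set blocks the path, or blocks the path when
  conditioned on.\<close>

lemma non_adj_d_separated:
  assumes E: "E \<in> poly_forests d" and ab: "a \<noteq> b" and nadj: "\<not> adj E a b"
  shows "\<exists>S \<subseteq> {..<d} - {a, b}. d_separated E a b S"
proof (cases "\<exists>p. path_between E a b p")
  case False
  then show ?thesis by (auto simp: d_separated_def)
next
  case True
  then obtain p where p: "path_between E a b p" by blast
  obtain x y z q where xyz: "p = x # y # z # q"
  proof (cases p)
    case (Cons x p')
    then show ?thesis using that p ab nadj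
      by (cases p'; cases "tl p'") (auto simp: path_between_def)
  qed (use p in \<open>simp add: path_between_def\<close>)
  have ya: "adj E a y" "y \<noteq> a" "y \<noteq> b" using p xyz by (auto simp: path_between_def split: if_splits)
  then have "y < d" using dag_adj_less[OF poly_forest_dag[OF E]] by blast
  have "blocked E (if collider E p 1 then {} else {y}) p"
    unfolding blocked_def using xyz by (intro exI[of _ 1]) auto
  then show ?thesis
    using d_separated_iff_blocked[OF E p] \<open>y < d\<close> ya
    by (intro exI[of _ "if collider E p 1 then {} else {y}"]) auto
qed

text \<open>The criterion of Verma and Pearl for Markov equivalence: equal skeletons and equal
  v-structures.\<close>

definition same_pattern :: "graph \<Rightarrow> graph \<Rightarrow> bool" where
  "same_pattern E F \<longleftrightarrow> (\<forall>a b. adj E a b = adj F a b) \<and>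
     (\<forall>k l j. v_structure E k l j = v_structure F k l j)"

lemma same_pattern_sym: "same_pattern E F \<Longrightarrow> same_pattern F E"
  by (simp add: same_pattern_def)

lemma markov_equivalent_sym: "markov_equivalent d E F \<Longrightarrow> markov_equivalent d F E"
  by (simp add: markov_equivalent_def)

lemma markov_equivalent_adjD:
  assumes "E \<in> poly_forests d" "dag d F" "markov_equivalent d E F" "adj F a b"
  shows "adj E a b"
proof (rule ccontr)
  assume "\<not> adj E a b"
  moreover have "a \<noteq> b" using assms dag_adj_neq by blast
  ultimately obtain S where "S \<subseteq> {..<d} - {a, b}" "d_separated E a b S"
    using non_adj_d_separated[OF assms(1)] by blast
  moreover have "a < d" "b < d" using dag_adj_less[OF assms(2,4)] by auto
  ultimately have "d_separated F a b S"
    using assms(3) \<open>a \<noteq> b\<close> by (auto simp: markov_equivalent_def)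
  then show False using adj_not_d_separated assms(2,4) by blast
qed

lemma v_structure_path:
  assumes "dag d E" "v_structure E k l j" "\<And>a b. adj E a b = adj F a b"
  shows "path_between F k j [k, l, j]"
  using assms(2) dag_irrefl[OF assms(1)] assms(3)[of k l] assms(3)[of l j]
  by (auto simp: path_between_def v_structure_def adj_def)

text \<open>On the only path \<open>k, l, j\<close> the empty set blocks exactly when
  \<open>l\<close> is a collider, so marginal separation of the outer nodes reveals the
  v-structure.\<close>

lemma markov_equivalent_v_structureD:
  assumes E: "E \<in> poly_forests d" and F: "F \<in> poly_forests d"
    and eq: "markov_equivalent d E F" and adj: "\<And>a b. adj E a b = adj F a b"
    and v: "v_structure E k l j"
  shows "v_structure F k l j"
proof -
  have "blocked E {} [k, l, j]"
    unfolding blocked_def using v by (intro exI[of _ 1]) (auto simp: collider_def v_structure_def)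
  then have "d_separated E k j {}"
    using d_separated_iff_blocked[OF E v_structure_path[OF poly_forest_dag[OF E] v]] by simp
  moreover have "k < d" "j < d" "k \<noteq> j"
    using v poly_forest_dag[OF E] by (auto simp: v_structure_def dag_def)
  ultimately have "d_separated F k j {}" using eq by (simp add: markov_equivalent_def)
  then have "blocked F {} [k, l, j]"
    using d_separated_iff_blocked[OF F v_structure_path[OF poly_forest_dag[OF E] v adj]] by simp
  then have "(k, l) \<in> F \<and> (j, l) \<in> F"
    by (auto simp: blocked_def collider_def less_Suc_eq split: if_splits)
  then show ?thesis using v adj by (auto simp: v_structure_def)
qed

text \<open>Arcs below a v-structure are compelled. The induction carries along an arc
  \<open>y -> x\<close> shared by both graphs: if \<open>F\<close> reversed the next arc
  \<open>x -> z\<close>, then \<open>y -> x <- z\<close> would be a v-structure of \<open>F\<close>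
  but not of \<open>E\<close>.\<close>

lemma v_structure_descendants:
  assumes E: "E \<in> poly_forests d" and F: "F \<in> poly_forests d" and sp: "same_pattern E F"
    and v: "v_structure E k l j" and reach: "(l, x) \<in> E\<^sup>*"
  shows "(l, x) \<in> F\<^sup>*"
proof -
  have "(l, x) \<in> F\<^sup>* \<and> (\<exists>y. (y, x) \<in> E \<and> (y, x) \<in> F)"
    using reach
  proof (induction rule: rtrancl_induct)
    case base
    have "v_structure F k l j" using sp v by (simp add: same_pattern_def)
    then show ?case using v by (auto simp: v_structure_def)
  next
    case (step x z)
    then obtain y where y: "(y, x) \<in> E" "(y, x) \<in> F" and lx: "(l, x) \<in> F\<^sup>*" by blast
    have yz: "y \<noteq> z" using dag_antisym[OF poly_forest_dag[OF E]] y step.hyps(2) by blast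
    have "adj F x z" using sp step.hyps(2) by (auto simp: same_pattern_def adj_def)
    moreover have "(z, x) \<notin> F"
    proof
      assume "(z, x) \<in> F"
      then have "v_structure F y x z"
        using y yz poly_forest_v_structure_iff[OF F] by blast
      then have "v_structure E y x z" using sp by (simp add: same_pattern_def)
      then show False
        using dag_antisym[OF poly_forest_dag[OF E]] step.hyps(2) by (auto simp: v_structure_def)
    qed
    ultimately have "(x, z) \<in> F" by (auto simp: adj_def)
    then show ?case using lx step.hyps(2) by (meson rtrancl.rtrancl_into_rtrancl)
  qed
  then show ?thesis by blast
qed

lemma path_collider_v_structure:
  assumes E: "E \<in> poly_forests d" and p: "path_between E a b p" and i: "0 < i" "i + 1 < length p"
  shows "collider E p i \<longleftrightarrow> v_structure E (p ! (i - 1)) (p ! i) (p ! (i + 1))"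
proof -
  have "p ! (i - 1) \<noteq> p ! (i + 1)"
    using p i by (subst nth_eq_iff_index_eq) (auto simp: path_between_def)
  then show ?thesis
    using poly_forest_v_structure_iff[OF E] by (auto simp: collider_def)
qed

lemma path_between_cong:
  assumes "\<And>a b. adj E a b = adj F a b"
  shows "path_between E a b p = path_between F a b p"
proof -
  have "adj E = adj F" using assms by blast
  then show ?thesis by (simp add: path_between_def)
qed

text \<open>Colliders on a path of a forest are v-structures, hence shared by both graphs. Blocking
  at a collider also speaks of its descendants, and these agree because everything below a
  v-structure is compelled.\<close>

lemma same_pattern_blocked:
  assumes E: "E \<in> poly_forests d" and F: "F \<in> poly_forests d" and sp: "same_pattern E F"
    and p: "path_between E a b p" and bl: "blocked E S p"
  shows "blocked F S p"
proof -
  obtain i where i: "0 < i" "i + 1 < length p"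
    and bi: "if collider E p i then \<forall>v. (p ! i, v) \<in> E\<^sup>* \<longrightarrow> v \<notin> S else p ! i \<in> S"
    using bl by (auto simp: blocked_def)
  have pF: "path_between F a b p"
    using p path_between_cong[of E F] sp by (simp add: same_pattern_def)
  have col: "collider E p i \<longleftrightarrow> collider F p i"
    using path_collider_v_structure[OF E p i] path_collider_v_structure[OF F pF i] sp
    by (simp add: same_pattern_def)
  have "(p ! i, v) \<in> E\<^sup>*" if "collider E p i" "(p ! i, v) \<in> F\<^sup>*" for v
    using v_structure_descendants[OF F E same_pattern_sym[OF sp]] that col
      path_collider_v_structure[OF F pF i] by blast
  then show ?thesis unfolding blocked_def using i bi col by (intro exI[of _ i]) auto
qed

text \<open>\<open>F\<close> is only known to be a DAG. Either side of the equivalence forces its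
  skeleton into that of \<open>E\<close>, so \<open>F\<close> is a poly-forest as well and unique
  paths can be compared.\<close>

lemma markov_equivalent_iff_same_pattern:
  assumes E: "E \<in> poly_forests d" and F: "dag d F"
  shows "markov_equivalent d E F \<longleftrightarrow> same_pattern E F"
proof
  assume eq: "markov_equivalent d E F"
  have "F \<in> poly_forests d"
    using poly_forests_mono[OF E F] markov_equivalent_adjD[OF E F eq] by blast
  moreover have "adj E a b = adj F a b" for a b
    using markov_equivalent_adjD[OF E F eq] poly_forest_dag[OF E]
      markov_equivalent_adjD[OF \<open>F \<in> poly_forests d\<close> _ markov_equivalent_sym[OF eq]] by blast
  ultimately show "same_pattern E F"
    using markov_equivalent_v_structureD[OF E _ eq]
      markov_equivalent_v_structureD[OF _ E markov_equivalent_sym[OF eq]]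
    unfolding same_pattern_def by metis
next
  assume sp: "same_pattern E F"
  have F': "F \<in> poly_forests d"
    using poly_forests_mono[OF E F] sp by (simp add: same_pattern_def)
  have pb: "path_between E a b p = path_between F a b p" for a b p
    using path_between_cong[of E F] sp by (simp add: same_pattern_def)
  show "markov_equivalent d E F"
    unfolding markov_equivalent_def d_separated_def
    using same_pattern_blocked[OF E F' sp] same_pattern_blocked[OF F' E same_pattern_sym[OF sp]] pb
    by blast
qed

section \<open>The CPDAG and the Meek rules\<close>

lemma cpdag_eq:
  assumes "E \<in> poly_forests d"
  shows "cpdag d E = \<Union> {F. dag d F \<and> same_pattern E F}"
  using markov_equivalent_iff_same_pattern[OF assms] by (auto simp: cpdag_def)

lemma self_in_class: "E \<in> poly_forests d \<Longrightarrow> dag d E \<and> same_pattern E E"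
  by (simp add: poly_forest_dag same_pattern_def)

text \<open>The skeleton in which exactly the arcs of v-structures are directed:
  \<open>(a, b)\<close> is missing only when \<open>b -> a\<close> is part of a v-structure. PC-tree
  has reached this graph after its collider step if the tests are right.\<close>

definition v_pattern :: "graph \<Rightarrow> graph" where
  "v_pattern E = {(a, b). adj E a b \<and> \<not> (\<exists>k. v_structure E b a k)}"

text \<open>Invariant of the Meek rules. The lower bound says that no direction occurring in some
  member of the equivalence class is ever lost; the upper bound keeps the v-structures
  oriented.\<close>

definition between_class_and_pattern :: "nat \<Rightarrow> graph \<Rightarrow> graph \<Rightarrow> bool" where
  "between_class_and_pattern d E H \<longleftrightarrow>
     (\<forall>F. dag d F \<longrightarrow> same_pattern E F \<longrightarrow> F \<subseteq> H) \<and> H \<subseteq> v_pattern E"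

lemma v_pattern_invariant: "between_class_and_pattern d E (v_pattern E)"
proof -
  have "(a, b) \<in> v_pattern E" if F: "dag d F" "same_pattern E F" and ab: "(a, b) \<in> F" for F a b
  proof -
    have "adj E a b" using F(2) ab by (simp add: same_pattern_def adj_def)
    moreover have "\<not> v_structure F b a k" for k
      using dag_antisym[OF F(1) ab] by (simp add: v_structure_def)
    ultimately show ?thesis using F(2) by (simp add: v_pattern_def same_pattern_def)
  qed
  then show ?thesis by (auto simp: between_class_and_pattern_def)
qed

lemma between_adj:
  assumes "E \<in> poly_forests d" "between_class_and_pattern d E H"
  shows "adj H a b = adj E a b"
proof -
  have "E \<subseteq> H" "H \<subseteq> v_pattern E"
    using assms self_in_class by (auto simp: between_class_and_pattern_def)
  then show ?thesis by (auto simp: adj_def v_pattern_def)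
qed

text \<open>The second, third and fourth rule each require a triangle in the skeleton, which leaves
  the first: \<open>c -> a - b\<close> with \<open>c\<close> and \<open>b\<close> non-adjacent. A
  class member with \<open>b -> a\<close> would have a v-structure at \<open>a\<close> involving
  \<open>b\<close>, but then the pattern would not contain \<open>(a, b)\<close>.\<close>

lemma meek_applies_sound:
  assumes E: "E \<in> poly_forests d" and inv: "between_class_and_pattern d E H"
    and m: "meek_applies H a b" and F: "dag d F" "same_pattern E F"
  shows "(b, a) \<notin> F"
proof
  assume ba: "(b, a) \<in> F"
  note adjH = between_adj[OF E inv]
  have und: "(a, b) \<in> H" "(b, a) \<in> H" using m by (auto simp: meek_applies_def undirected_def)
  have FH: "F \<subseteq> H" and HV: "H \<subseteq> v_pattern E"
    using inv F by (auto simp: between_class_and_pattern_def)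
  have aE: "adj E a b" using und adjH by (auto simp: adj_def)
  have "\<not> (adj E a c \<and> adj E c b)" for c
    using poly_forest_no_triangle[OF E] aE by blast
  moreover have "\<not> (adj E a c \<and> adj E c e \<and> adj E a e)" for c e
    using poly_forest_no_triangle[OF E] by blast
  ultimately obtain c where c: "arrow H c a" "\<not> adj H c b"
    using m adjH unfolding meek_applies_def arrow_def undirected_def adj_def by blast
  have "adj F c a" using c(1) adjH F(2) by (auto simp: arrow_def adj_def same_pattern_def)
  then have "(c, a) \<in> F" using c(1) FH by (auto simp: arrow_def adj_def)
  moreover have "c \<noteq> b" using c(1) und by (auto simp: arrow_def)
  moreover have "\<not> adj F c b" using c(2) adjH F(2) by (auto simp: same_pattern_def)
  ultimately have "v_structure F c a b" using ba by (simp add: v_structure_def)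
  then have "v_structure E b a c" using F(2) v_structure_commute by (auto simp: same_pattern_def)
  then show False using und(1) HV by (auto simp: v_pattern_def)
qed

lemma meek_steps_invariant:
  assumes "E \<in> poly_forests d" "meek_step\<^sup>*\<^sup>* H H'" "between_class_and_pattern d E H"
  shows "between_class_and_pattern d E H'"
  using assms(2,3)
proof (induction rule: rtranclp_induct)
  case (step H' H'')
  then obtain a b where "meek_applies H' a b" "H'' = H' - {(b, a)}" by (auto simp: meek_step_def)
  then show ?case
    using meek_applies_sound[OF assms(1), of H' a b] step.IH[OF step.prems]
    unfolding between_class_and_pattern_def by blast
qed

lemma meek_normal_form_exists:
  assumes "finite H"
  shows "\<exists>H'. meek_step\<^sup>*\<^sup>* H H' \<and> (\<forall>H''. \<not> meek_step H' H'')"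
  using assms
proof (induction "card H" arbitrary: H rule: less_induct)
  case less
  show ?case
  proof (cases "\<exists>H1. meek_step H H1")
    case True
    then obtain H1 where H1: "meek_step H H1" by blast
    then obtain a b where "H1 = H - {(b, a)}" "(b, a) \<in> H"
      by (auto simp: meek_step_def meek_applies_def undirected_def)
    then have "card H1 < card H" "finite H1"
      using less.prems card_Diff1_less by (metis, metis finite_Diff)
    then obtain H' where "meek_step\<^sup>*\<^sup>* H1 H'" "\<forall>H''. \<not> meek_step H' H''" using less.hyps by blast
    then show ?thesis using H1 by (meson converse_rtranclp_into_rtranclp)
  qed auto
qed

lemma meek_closure:
  assumes "finite H"
  shows "meek_step\<^sup>*\<^sup>* H (meek_closure H)" "\<not> meek_step (meek_closure H) H''"
  using someI_ex[OF meek_normal_form_exists[OF assms]] by (auto simp: meek_closure_def)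

lemma meek_closure_subset:
  assumes "finite H"
  shows "meek_closure H \<subseteq> H"
  using meek_closure(1)[OF assms]
  by (induction rule: rtranclp_induct) (auto simp: meek_step_def)

text \<open>The edge is covered in the sense of Chickering: the target has no parent besides the source.\<close>

lemma reverse_source_edge:
  assumes E: "E \<in> poly_forests d" and F: "dag d F" "same_pattern E F"
    and src: "parents F b = {}" and ba: "(b, a) \<in> F" and nv: "(a, b) \<in> v_pattern E"
  shows "\<exists>F'. dag d F' \<and> same_pattern E F' \<and> parents F' a = {}"
proof -
  define F' where "F' = insert (a, b) (F - {(b, a)})"
  have F0: "F \<in> poly_forests d"
    using poly_forests_mono[OF E F(1)] F(2) by (simp add: same_pattern_def)
  have "a \<noteq> b" using dag_irrefl[OF F(1) ba] by simp
  have pa: "z = b" if "(z, a) \<in> F" for z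
  proof (rule ccontr)
    assume "z \<noteq> b"
    then have "v_structure F b a z" using poly_forest_v_structure_iff[OF F0] that ba by blast
    then show False using nv F(2) by (auto simp: v_pattern_def same_pattern_def)
  qed
  have pb: "(z, b) \<notin> F" for z using src by (auto simp: parents_def)
  have "(b, a) \<notin> (F - {(b, a)})\<^sup>*"
  proof
    assume "(b, a) \<in> (F - {(b, a)})\<^sup>*"
    then show False using \<open>a \<noteq> b\<close> pa by (cases rule: rtranclE) auto
  qed
  moreover have "acyclic (F - {(b, a)})"
    using F(1) by (auto simp: dag_def intro: acyclic_subset)
  ultimately have "dag d F'"
    using F(1) ba by (auto simp: F'_def acyclic_insert dag_def)
  moreover have adj': "adj F' x y = adj F x y" for x y
    using ba by (auto simp: F'_def adj_def)
  moreover have "v_structure F' x y z = v_structure F x y z" for x y z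
    unfolding v_structure_def adj' using pa pb \<open>a \<noteq> b\<close> by (auto simp: F'_def)
  moreover have "parents F' a = {}" using pa \<open>a \<noteq> b\<close> by (auto simp: F'_def parents_def)
  ultimately show ?thesis using F(2) by (auto simp: same_pattern_def)
qed

text \<open>Induction upwards along \<open>E\<close>. If the undirected edge \<open>b - a\<close>
  hangs below an arc \<open>y -> b\<close>, then the edge \<open>y - b\<close> is undirected in
  \<open>H\<close> too, since otherwise the first Meek rule would orient \<open>b - a\<close>. By
  induction \<open>b\<close> can be made a source, and one more reversal makes \<open>a\<close> a
  source.\<close>

lemma reroot_class:
  assumes E: "E \<in> poly_forests d" and inv: "between_class_and_pattern d E H"
    and nf: "\<And>H'. \<not> meek_step H H'"
    and ba: "(b, a) \<in> E" "(a, b) \<in> H"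
  shows "\<exists>F. dag d F \<and> same_pattern E F \<and> parents F a = {}"
proof -
  note dagE = poly_forest_dag[OF E]
  have EH: "E \<subseteq> H" and HV: "H \<subseteq> v_pattern E"
    using inv self_in_class[OF E] by (auto simp: between_class_and_pattern_def)
  have "wf E" using dagE by (auto simp: dag_def intro!: finite_acyclic_wf intro: finite_subset)
  then show ?thesis using ba
  proof (induction b arbitrary: a rule: wf_induct_rule)
    case (less b)
    show ?case
    proof (cases "parents E b = {}")
      case True
      then show ?thesis
        using reverse_source_edge[OF E] self_in_class[OF E] less.prems HV by blast
    next
      case False
      then obtain y where y: "(y, b) \<in> E" by (auto simp: parents_def)
      have "(b, y) \<in> H"
      proof (rule ccontr)
        assume "(b, y) \<notin> H"
        then have "arrow H y b" using y EH by (auto simp: arrow_def)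
        moreover have "undirected H b a" using less.prems EH by (auto simp: undirected_def)
        moreover have "\<not> adj H y a"
          using poly_forest_no_triangle[OF E, of y b a] y less.prems(1) between_adj[OF E inv]
          by (auto simp: adj_def)
        ultimately have "meek_applies H b a" by (auto simp: meek_applies_def)
        then show False using nf by (auto simp: meek_step_def)
      qed
      then obtain F where F: "dag d F" "same_pattern E F" "parents F b = {}"
        using less.IH[OF y y] by blast
      have "adj F a b" using F(2) less.prems(1) by (auto simp: same_pattern_def adj_def)
      then have "(b, a) \<in> F" using F(3) by (auto simp: parents_def adj_def)
      then show ?thesis using reverse_source_edge[OF E F] less.prems HV by blast
    qed
  qed
qed

text \<open>The choice made inside \<open>meek_closure\<close> does not matter: any graph that
  satisfies the invariant and admits no rule is the union of the class, since each of its arcs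
  either belongs to \<open>E\<close> or leaves a source of a suitable class member.\<close>

lemma meek_closure_v_pattern:
  assumes E: "E \<in> poly_forests d"
  shows "meek_closure (v_pattern E) = cpdag d E"
proof -
  define H where "H = meek_closure (v_pattern E)"
  have "v_pattern E \<subseteq> {..<d} \<times> {..<d}"
    using dag_adj_less[OF poly_forest_dag[OF E]] by (auto simp: v_pattern_def)
  then have fin: "finite (v_pattern E)" by (rule finite_subset) simp
  have inv: "between_class_and_pattern d E H"
    using meek_steps_invariant[OF E] meek_closure(1)[OF fin] v_pattern_invariant H_def by blast
  have nf: "\<not> meek_step H H'" for H' using meek_closure(2)[OF fin] H_def by blast
  have "\<exists>F. dag d F \<and> same_pattern E F \<and> (a, b) \<in> F" if ab: "(a, b) \<in> H" for a b
  proof (cases "(a, b) \<in> E")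
    case True
    then show ?thesis using self_in_class[OF E] by blast
  next
    case False
    have "adj E a b" using ab inv by (auto simp: between_class_and_pattern_def v_pattern_def)
    then have "(b, a) \<in> E" using False by (simp add: adj_def)
    then obtain F where F: "dag d F" "same_pattern E F" "parents F a = {}"
      using reroot_class[OF E inv nf _ ab] by blast
    have "adj F a b" using \<open>adj E a b\<close> F(2) by (simp add: same_pattern_def)
    then show ?thesis using F by (auto simp: adj_def parents_def)
  qed
  then have "H \<subseteq> \<Union> {F. dag d F \<and> same_pattern E F}" by (intro subrelI) blast
  moreover have "\<Union> {F. dag d F \<and> same_pattern E F} \<subseteq> H"
    using inv by (auto simp: between_class_and_pattern_def)
  ultimately show ?thesis unfolding cpdag_eq[OF E] H_def by blast
qed

text \<open>The hypotheses name the outcomes that decide the result: all tests of an edge, one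
  acceptance per non-edge, and for two neighbours of a node the test given that node. The remaining
  outcomes may be arbitrary. Contradictory orientations cannot arise because all requested arrows
  are arcs of the DAG \<open>E\<close>.\<close>

lemma pc_tree_correct:
  assumes E: "E \<in> poly_forests d"
    and adj: "\<And>j k. adj E j k \<Longrightarrow> \<forall>l\<in>cond_choices d j k. T (min j k) (max j k) l = 1"
    and sep: "\<And>j k. j < d \<Longrightarrow> k < d \<Longrightarrow> j \<noteq> k \<Longrightarrow> \<not> adj E j k \<Longrightarrow>
      \<exists>l\<in>cond_choices d j k. T (min j k) (max j k) l = 0"
    and v: "\<And>j k l. v_structure E j l k \<Longrightarrow> T (min j k) (max j k) (Some l) = 1"
    and nv: "\<And>j k l. adj E j l \<Longrightarrow> adj E k l \<Longrightarrow> j \<noteq> k \<Longrightarrow> \<not> v_structure E j l k \<Longrightarrow>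
      T (min j k) (max j k) (Some l) = 0"
  shows "pc_tree d T = cpdag d E"
proof -
  note less = dag_adj_less[OF poly_forest_dag[OF E]] and neq = dag_adj_neq[OF poly_forest_dag[OF E]]
  have sk: "(j, k) \<in> pc_skeleton d T \<longleftrightarrow> adj E j k" for j k
    unfolding pc_skeleton_def using adj[of j k] sep[of j k] less[of j k] neq[of j k] by force
  have ar: "(j, l) \<in> pc_arrows d T \<longleftrightarrow> (\<exists>k. v_structure E j l k)" for j l
  proof
    assume "(j, l) \<in> pc_arrows d T"
    then obtain k where k: "k \<noteq> j" "adj E j l" "adj E k l" "\<not> adj E j k" "Some l \<notin> pc_sep d T j k"
      by (auto simp: pc_arrows_def sk)
    then have "T (min j k) (max j k) (Some l) \<noteq> 0"
      using less[of j l] neq by (auto simp: pc_sep_def cond_choices_def)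
    then show "\<exists>k. v_structure E j l k" using nv k by metis
  next
    assume "\<exists>k. v_structure E j l k"
    then obtain k where k: "v_structure E j l k" by blast
    then have "adj E j l" "adj E k l" "\<not> adj E j k" "k \<noteq> j" by (auto simp: v_structure_def adj_def)
    then show "(j, l) \<in> pc_arrows d T"
      using v[OF k] less by (auto simp: pc_arrows_def sk pc_sep_def intro!: exI[of _ k])
  qed
  have "pc_pattern d T = v_pattern E"
    unfolding pc_pattern_def v_pattern_def
    using dag_antisym[OF poly_forest_dag[OF E]] by (auto simp: sk ar v_structure_def)
  then show ?thesis using meek_closure_v_pattern[OF E] by (simp add: pc_tree_def)
qed

subsection \<open>Independence from characteristic functions\<close>

lemma (in prob_space) integrable_mult_iexp:
  fixes g :: "'a \<Rightarrow> complex"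
  assumes "integrable M g" and [measurable]: "X \<in> borel_measurable M"
  shows "integrable M (\<lambda>x. g x * iexp (t * X x))"
  by (rule Bochner_Integration.integrable_bound[OF assms(1)])
    (use assms(1) in \<open>auto simp: norm_mult intro!: borel_measurable_times\<close>)

text \<open>The positive and the negative part of \<open>g\<close> have the same mass (take
  \<open>t = 0\<close>). Normalized, they are densities with respect to \<open>M\<close> under which
  \<open>X\<close> has the same characteristic function, so Levy's uniqueness theorem
  applies.\<close>

lemma (in prob_space) fourier_unique_real:
  fixes g :: "'a \<Rightarrow> real"
  assumes g: "integrable M g" and X[measurable]: "X \<in> borel_measurable M"
    and zero: "\<And>t. (CLINT x|M. g x * iexp (t * X x)) = 0" and A[measurable]: "A \<in> sets borel"
  shows "(LINT x|M. g x * indicator A (X x)) = 0"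
proof -
  have g_meas[measurable]: "g \<in> borel_measurable M" using g by auto
  define gp where "gp = (\<lambda>x. max (g x) 0)"
  define gm where "gm = (\<lambda>x. max (- g x) 0)"
  have [measurable]: "gp \<in> borel_measurable M" "gm \<in> borel_measurable M"
    by (simp_all add: gp_def gm_def)
  have gpm: "g x = gp x - gm x" for x by (simp add: gp_def gm_def)
  have nn: "gp x \<ge> 0" "gm x \<ge> 0" for x by (simp_all add: gp_def gm_def)
  have int: "integrable M gp" "integrable M gm" using g by (auto simp: gp_def gm_def)
  have intc: "integrable M (\<lambda>x. complex_of_real (gp x) * iexp (t * X x))"
    "integrable M (\<lambda>x. complex_of_real (gm x) * iexp (t * X x))" for t
    using int by (intro integrable_mult_iexp; simp)+
  have eq: "(CLINT x|M. gp x * iexp (t * X x)) = (CLINT x|M. gm x * iexp (t * X x))" for t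
    using zero[of t] intc by (simp add: gpm left_diff_distrib)
  have intA: "integrable M (\<lambda>x. h x * indicator A (X x))" if "integrable M h" for h :: "'a \<Rightarrow> real"
    using that by (rule Bochner_Integration.integrable_bound) (use that in \<open>auto simp: indicator_def\<close>)
  define c where "c = (LINT x|M. gp x)"
  have c': "c = (LINT x|M. gm x)"
    using eq[of 0] by (simp add: c_def)
  have "c \<ge> 0" by (simp add: c_def nn)
  \<comment> \<open>Mass \<open>c = 0\<close> cannot be normalized, but then both parts vanish
    almost surely.\<close>
  have main: "(LINT x|M. gp x * indicator A (X x)) = (LINT x|M. gm x * indicator A (X x))"
  proof (cases "c = 0")
    case True
    then have "(LINT x|M. gp x) = 0" "(LINT x|M. gm x) = 0" using c' by (simp_all add: c_def)
    then have "AE x in M. gp x = 0" "AE x in M. gm x = 0"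
      using int nn by (simp_all add: integral_nonneg_eq_0_iff_AE)
    then have "AE x in M. gp x * indicator A (X x) = 0" "AE x in M. gm x * indicator A (X x) = 0"
      by auto
    then show ?thesis by (simp add: integral_eq_zero_AE)
  next
    case False
    then have "c > 0" using \<open>c \<ge> 0\<close> by simp
    define N where "N h = density M (\<lambda>x. ennreal (h x / c))" for h :: "'a \<Rightarrow> real"
    have prob: "prob_space (N h)"
      if "integrable M h" "\<And>x. h x \<ge> 0" "c = (LINT x|M. h x)" for h
    proof
      have "emeasure (N h) (space (N h)) = (\<integral>\<^sup>+ x. ennreal (h x / c) \<partial>M)"
        using that by (simp add: N_def emeasure_density)
      also have "\<dots> = ennreal (LINT x|M. h x / c)"
        using that \<open>c > 0\<close> by (intro nn_integral_eq_integral) auto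
      finally show "emeasure (N h) (space (N h)) = 1" using that \<open>c > 0\<close> by simp
    qed
    have ch: "char (distr (N h) borel X) t = (CLINT x|M. h x * iexp (t * X x)) / c"
      if [measurable]: "h \<in> borel_measurable M" and "\<And>x. h x \<ge> 0" for h t
    proof -
      have "char (distr (N h) borel X) t = (CLINT x|N h. iexp (t * X x))"
        unfolding char_def by (subst integral_distr) (auto simp: N_def)
      also have "\<dots> = (CLINT x|M. (h x / c) *\<^sub>R iexp (t * X x))"
        unfolding N_def using that \<open>c > 0\<close> by (subst integral_density) auto
      also have "\<dots> = (CLINT x|M. h x * iexp (t * X x) / c)"
        by (simp add: scaleR_conv_of_real field_simps)
      finally show ?thesis by simp
    qed
    have "distr (N gp) borel X = distr (N gm) borel X"
    proof (rule Levy_uniqueness)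
      have XN: "X \<in> borel_measurable (N h)" for h by (simp add: N_def)
      show "real_distribution (distr (N gp) borel X)" "real_distribution (distr (N gm) borel X)"
        using prob[OF int(1) nn(1) c_def] prob[OF int(2) nn(2) c'] XN
        by (auto simp: real_distribution_def real_distribution_axioms_def intro: prob_space.prob_space_distr)
      show "char (distr (N gp) borel X) = char (distr (N gm) borel X)"
      proof (rule ext)
        fix t
        show "char (distr (N gp) borel X) t = char (distr (N gm) borel X) t"
          using ch[of gp t] ch[of gm t] eq[of t] nn by simp
      qed
    qed
    moreover have "emeasure (distr (N h) borel X) A = ennreal (LINT x|M. h x / c * indicator A (X x))"
      if "integrable M h" "\<And>x. h x \<ge> 0" for h
    proof -
      have [measurable]: "h \<in> borel_measurable M" using that by auto
      have "emeasure (distr (N h) borel X) A = emeasure (N h) (X -` A \<inter> space M)"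
        by (subst emeasure_distr) (auto simp: N_def)
      also have "\<dots> = (\<integral>\<^sup>+ x. ennreal (h x / c) * indicator (X -` A \<inter> space M) x \<partial>M)"
        by (simp add: N_def emeasure_density)
      also have "\<dots> = (\<integral>\<^sup>+ x. ennreal (h x / c * indicator A (X x)) \<partial>M)"
        by (intro nn_integral_cong) (auto simp: indicator_def)
      also have "\<dots> = ennreal (LINT x|M. h x / c * indicator A (X x))"
        using that \<open>c > 0\<close> integrable_divide[OF intA[OF that(1)], of c]
        by (intro nn_integral_eq_integral) auto
      finally show ?thesis .
    qed
    ultimately have "ennreal (LINT x|M. gp x / c * indicator A (X x)) = ennreal (LINT x|M. gm x / c * indicator A (X x))"
      using int nn by metis
    then have "(LINT x|M. gp x / c * indicator A (X x)) = (LINT x|M. gm x / c * indicator A (X x))"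
      using nn \<open>c > 0\<close> by (subst (asm) ennreal_inj) (auto intro!: integral_nonneg)
    then show ?thesis using \<open>c > 0\<close> by simp
  qed
  then show ?thesis using intA[OF int(1)] intA[OF int(2)] by (simp add: gpm left_diff_distrib)
qed

text \<open>Conjugating the hypothesis at \<open>- t\<close> gives the hypothesis for the conjugate
  of \<open>g\<close> at \<open>t\<close>, so the real and the imaginary part of \<open>g\<close>
  satisfy it separately.\<close>

lemma (in prob_space) fourier_unique:
  fixes g :: "'a \<Rightarrow> complex"
  assumes g: "integrable M g" and X[measurable]: "X \<in> borel_measurable M"
    and zero: "\<And>t. (CLINT x|M. g x * iexp (t * X x)) = 0" and A[measurable]: "A \<in> sets borel"
  shows "(CLINT x|M. g x * indicator A (X x)) = 0"
proof -
  have g_meas[measurable]: "g \<in> borel_measurable M" using g by auto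
  have cnj0: "(CLINT x|M. cnj (g x) * iexp (t * X x)) = 0" for t
  proof -
    have "(CLINT x|M. cnj (g x) * iexp (t * X x)) = cnj (CLINT x|M. g x * iexp (- t * X x))"
      unfolding Bochner_Integration.integral_cnj[symmetric] by (simp add: exp_cnj)
    then show ?thesis using zero[of "- t"] by simp
  qed
  have intI: "integrable M (\<lambda>x. cnj (g x))" using g by simp
  have re: "(CLINT x|M. complex_of_real (Re (g x)) * iexp (t * X x)) = 0" for t
  proof -
    have "(CLINT x|M. complex_of_real (Re (g x)) * iexp (t * X x)) =
      (CLINT x|M. (g x * iexp (t * X x) + cnj (g x) * iexp (t * X x)) / 2)"
      by (intro Bochner_Integration.integral_cong refl)
        (simp add: complex_eq_iff algebra_simps)
    also have "\<dots> = 0"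
      using zero cnj0 integrable_mult_iexp[OF g X] integrable_mult_iexp[OF intI X] by simp
    finally show ?thesis .
  qed
  have im: "(CLINT x|M. complex_of_real (Im (g x)) * iexp (t * X x)) = 0" for t
  proof -
    have "(CLINT x|M. complex_of_real (Im (g x)) * iexp (t * X x)) =
      (CLINT x|M. (g x * iexp (t * X x) - cnj (g x) * iexp (t * X x)) / (2 * \<i>))"
      by (intro Bochner_Integration.integral_cong refl)
        (simp add: complex_eq_iff algebra_simps Re_divide Im_divide power2_eq_square)
    also have "\<dots> = 0"
      using zero cnj0 integrable_mult_iexp[OF g X] integrable_mult_iexp[OF intI X] by simp
    finally show ?thesis .
  qed
  have int: "integrable M (\<lambda>x. g x * indicator A (X x))"
    by (rule Bochner_Integration.integrable_bound[OF g]) (auto simp: indicator_def)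
  have ind: "g x * indicator A (X x) = Complex (Re (g x) * indicator A (X x)) (Im (g x) * indicator A (X x))" for x
    by (simp add: indicator_def complex_eq_iff)
  have "Re (CLINT x|M. g x * indicator A (X x)) = (LINT x|M. Re (g x) * indicator A (X x))"
    using integral_Re[OF int] by (simp add: ind)
  moreover have "Im (CLINT x|M. g x * indicator A (X x)) = (LINT x|M. Im (g x) * indicator A (X x))"
    using integral_Im[OF int] by (simp add: ind)
  ultimately show ?thesis
    using fourier_unique_real[OF _ X re A] fourier_unique_real[OF _ X im A] g
    by (simp add: complex_eq_iff integrable_Re integrable_Im)
qed

text \<open>Coordinates are treated one at a time. The indicator belonging to a treated coordinate
  is absorbed into \<open>g\<close>, while the remaining coordinates still enter through the
  exponential of a linear combination.\<close>

lemma (in prob_space) fourier_unique_finite: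
  fixes g :: "'a \<Rightarrow> complex" and X :: "'i \<Rightarrow> 'a \<Rightarrow> real"
  assumes "finite J" "integrable M g" "\<And>j. j \<in> J \<Longrightarrow> X j \<in> borel_measurable M"
    and "\<And>t. (CLINT x|M. g x * iexp (\<Sum>j\<in>J. t j * X j x)) = 0"
    and "\<And>j. j \<in> J \<Longrightarrow> B j \<in> sets borel"
  shows "(CLINT x|M. g x * (\<Prod>j\<in>J. indicator (B j) (X j x))) = 0"
  using assms
proof (induction J arbitrary: g rule: finite_induct)
  case empty
  then show ?case by simp
next
  case (insert j J)
  have Xm[measurable]: "X i \<in> borel_measurable M" if "i \<in> insert j J" for i using insert.prems that by blast
  have [measurable]: "X j \<in> borel_measurable M" "B j \<in> sets borel" using insert.prems by blast+
  have S[measurable]: "(\<lambda>x. \<Sum>j\<in>J. t j * X j x) \<in> borel_measurable M" for t :: "'i \<Rightarrow> real"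
    using Xm by (intro borel_measurable_sum borel_measurable_times) auto
  have [measurable]: "g \<in> borel_measurable M" using insert.prems by auto
  have int: "integrable M (\<lambda>x. g x * indicator (B j) (X j x))"
    by (rule Bochner_Integration.integrable_bound[OF insert.prems(1)]) (auto simp: indicator_def)
  have "(CLINT x|M. g x * indicator (B j) (X j x) * (\<Prod>j\<in>J. indicator (B j) (X j x))) = 0"
  proof (rule insert.IH[OF int])
    fix t :: "'i \<Rightarrow> real"
    have intJ: "integrable M (\<lambda>x. g x * iexp (\<Sum>j\<in>J. t j * X j x))"
      using integrable_mult_iexp[OF insert.prems(1) S, of 1 t] by simp
    have "(CLINT x|M. g x * iexp (\<Sum>j\<in>J. t j * X j x) * indicator (B j) (X j x)) = 0"
    proof (rule fourier_unique[OF intJ])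
      fix u :: real
      have "(\<Sum>i\<in>insert j J. (t(j := u)) i * X i x) = (\<Sum>j\<in>J. t j * X j x) + u * X j x" for x
        using insert.hyps by (auto simp: intro!: sum.cong)
      then show "(CLINT x|M. g x * iexp (\<Sum>j\<in>J. t j * X j x) * iexp (u * X j x)) = 0"
        using insert.prems(3)[of "t(j := u)"]
        by (simp only: of_real_add distrib_left exp_add mult.assoc)
    qed simp_all
    then show "(CLINT x|M. g x * indicator (B j) (X j x) * iexp (\<Sum>j\<in>J. t j * X j x)) = 0"
      by (simp add: mult_ac)
  qed (use insert.prems in auto)
  then show ?case using insert.hyps by (simp add: mult_ac)
qed

lemma Int_stable_vimage:
  assumes "Int_stable C"
  shows "Int_stable {f -` A \<inter> S | A. A \<in> C}"
proof (rule Int_stableI)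
  fix a b assume "a \<in> {f -` A \<inter> S | A. A \<in> C}" "b \<in> {f -` A \<inter> S | A. A \<in> C}"
  then obtain A B where "A \<in> C" "B \<in> C" "a = f -` A \<inter> S" "b = f -` B \<inter> S" by blast
  then show "a \<inter> b \<in> {f -` A \<inter> S | A. A \<in> C}"
    using assms by (intro CollectI exI[of _ "A \<inter> B"]) (auto simp: Int_stable_def)
qed

text \<open>Kac's criterion: independence can be read off the characteristic functions of linear combinations.\<close>

lemma (in prob_space) indep_set_iexp:
  fixes X :: "'i \<Rightarrow> 'a \<Rightarrow> real" and Y :: "'a \<Rightarrow> real"
  assumes J: "finite J" and Y[measurable]: "Y \<in> borel_measurable M"
    and X: "\<And>j. j \<in> J \<Longrightarrow> X j \<in> borel_measurable M"
    and mult: "\<And>s t. (CLINT x|M. iexp (s * Y x) * iexp (\<Sum>j\<in>J. t j * X j x)) =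
      (CLINT x|M. iexp (s * Y x)) * (CLINT x|M. iexp (\<Sum>j\<in>J. t j * X j x))"
  shows "indep_set {Y -` A \<inter> space M | A. A \<in> sets borel}
    {(\<lambda>x. \<lambda>j\<in>J. X j x) -` A \<inter> space M | A. A \<in> sets (\<Pi>\<^sub>M j\<in>J. borel)}"
proof -
  define Z where "Z = (\<lambda>x. \<lambda>j\<in>J. X j x)"
  have Z[measurable]: "Z \<in> measurable M (\<Pi>\<^sub>M j\<in>J. borel)"
    unfolding Z_def using X by (intro measurable_restrict) auto
  have box: "prob ((Y -` A \<inter> space M) \<inter> (Z -` (Pi\<^sub>E J B) \<inter> space M)) =
      prob (Y -` A \<inter> space M) * prob (Z -` (Pi\<^sub>E J B) \<inter> space M)"
    if A[measurable]: "A \<in> sets borel" and B: "\<And>j. j \<in> J \<Longrightarrow> B j \<in> sets borel" for A B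
  proof -
    have BP[measurable]: "Pi\<^sub>E J B \<in> sets (\<Pi>\<^sub>M j\<in>J. borel)" using J B by (intro sets_PiM_I_finite) auto
    define D where "D = (\<lambda>x. indicator (Pi\<^sub>E J B) (Z x) :: real)"
    have D[measurable]: "D \<in> borel_measurable M" by (simp add: D_def)
    have Dint: "integrable M D" unfolding D_def
      by (rule integrable_const_bound[of _ 1]) auto
    have Dprod: "complex_of_real (D x) = (\<Prod>j\<in>J. indicator (B j) (X j x))" for x
    proof (cases "\<forall>j\<in>J. X j x \<in> B j")
      case True then show ?thesis by (auto simp: D_def Z_def PiE_iff)
    next
      case False
      then have "(\<Prod>j\<in>J. indicator (B j) (X j x) :: complex) = 0" using J by (intro prod_zero) (auto simp: indicator_eq_0_iff)
      then show ?thesis using False by (auto simp: D_def Z_def PiE_iff)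
    qed
    have eY: "integrable M (\<lambda>x. iexp (s * Y x))" for s by (intro integrable_iexp) auto
    have S: "(\<lambda>x. \<Sum>j\<in>J. t j * X j x) \<in> borel_measurable M" for t :: "'i \<Rightarrow> real"
      using X by (intro borel_measurable_sum borel_measurable_times) auto
    \<comment> \<open>Uniqueness is applied twice. Here it is applied in the variables
      \<open>X j\<close> to the centred function \<open>iexp (s * Y x) - e\<close>, which replaces
      the exponential of the \<open>X j\<close> by the indicator of a box; below it is applied in
      \<open>Y\<close> to the centred indicator \<open>D\<close>.\<close>
    have "(CLINT x|M. iexp (s * Y x) * D x) = (CLINT x|M. iexp (s * Y x)) * (LINT x|M. D x)" for s
    proof -
      define e where "e = (CLINT x|M. iexp (s * Y x))"
      have "(CLINT x|M. (iexp (s * Y x) - e) * (\<Prod>j\<in>J. indicator (B j) (X j x))) = 0"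
      proof (rule fourier_unique_finite[OF J _ X _ B])
        fix t :: "'i \<Rightarrow> real"
        have "(CLINT x|M. iexp (s * Y x) * iexp (\<Sum>j\<in>J. t j * X j x)) -
            (CLINT x|M. e * iexp (\<Sum>j\<in>J. t j * X j x)) = 0"
          using mult[of s t] by (simp add: e_def)
        then show "(CLINT x|M. (iexp (s * Y x) - e) * iexp (\<Sum>j\<in>J. t j * X j x)) = 0"
          using integrable_mult_iexp[OF eY S, of s 1 t] integrable_mult_iexp[OF _ S, of "\<lambda>_. e" 1 t]
          by (simp add: left_diff_distrib)
      qed (use eY in auto)
      then have "(CLINT x|M. iexp (s * Y x) * D x - e * D x) = 0"
        by (simp add: Dprod left_diff_distrib)
      moreover have "integrable M (\<lambda>x. iexp (s * Y x) * D x)"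
        by (rule Bochner_Integration.integrable_bound[OF Dint]) (auto simp: norm_mult)
      moreover have "integrable M (\<lambda>x. e * complex_of_real (D x))" using Dint by auto
      ultimately have "(CLINT x|M. iexp (s * Y x) * D x) = (CLINT x|M. e * complex_of_real (D x))" by simp
      then show ?thesis by (simp add: e_def)
    qed
    note fac = this
    have "(LINT x|M. (D x - (LINT x|M. D x)) * indicator A (Y x)) = 0"
    proof (rule fourier_unique_real[OF _ Y _ A])
      show "integrable M (\<lambda>x. D x - (LINT x|M. D x))" using Dint by auto
      fix t
      have i1: "integrable M (\<lambda>x. complex_of_real (D x) * iexp (t * Y x))"
        using Dint by (intro integrable_mult_iexp) auto
      have i2: "integrable M (\<lambda>x. complex_of_real (LINT x|M. D x) * iexp (t * Y x))"
        by (intro integrable_mult_iexp) auto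
      show "(CLINT x|M. complex_of_real (D x - (LINT x|M. D x)) * iexp (t * Y x)) = 0"
        using fac[of t] i1 i2 by (simp add: left_diff_distrib mult.commute)
    qed
    then have "(LINT x|M. D x * indicator A (Y x) - (LINT x|M. D x) * indicator A (Y x)) = 0"
      by (simp add: left_diff_distrib)
    moreover have "integrable M (\<lambda>x. D x * indicator A (Y x))"
      by (rule Bochner_Integration.integrable_bound[OF Dint]) (auto simp: indicator_def)
    moreover have "integrable M (\<lambda>x. (LINT x|M. D x) * indicator A (Y x))"
      by (intro integrable_mult_right integrable_const_bound[of _ 1]) auto
    ultimately have "(LINT x|M. D x * indicator A (Y x)) = (LINT x|M. D x) * (LINT x|M. indicator A (Y x))"
      by simp
    moreover have "(LINT x|M. D x * indicator A (Y x)) =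
        (LINT x|M. indicator ((Y -` A \<inter> space M) \<inter> (Z -` (Pi\<^sub>E J B) \<inter> space M)) x)"
      by (intro Bochner_Integration.integral_cong) (auto simp: D_def indicator_def)
    moreover have "(LINT x|M. D x) = (LINT x|M. indicator (Z -` (Pi\<^sub>E J B) \<inter> space M) x)"
      by (intro Bochner_Integration.integral_cong) (auto simp: D_def indicator_def)
    moreover have "(LINT x|M. indicator A (Y x)) = (LINT x|M. indicator (Y -` A \<inter> space M) x :: real)"
      by (intro Bochner_Integration.integral_cong) (auto simp: indicator_def)
    ultimately show ?thesis by (simp add: mult.commute)
  qed
  define G1 where "G1 = {Y -` A \<inter> space M | A. A \<in> sets borel}"
  define G2 where "G2 = {Z -` A \<inter> space M | A. A \<in> prod_algebra J (\<lambda>_. borel :: real measure)}"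
  have G2_sigma: "{Z -` A \<inter> space M | A. A \<in> sets (\<Pi>\<^sub>M j\<in>J. borel)} = sigma_sets (space M) G2"
    unfolding G2_def sets_PiM
    by (rule sigma_sets_vimage_commute) (auto simp: Z_def)
  have "indep_set G1 G2"
  proof (rule indep_setI)
    show "G1 \<subseteq> events" "G2 \<subseteq> events"
      unfolding G1_def G2_def using prod_algebra_sets_into_space
      by (auto simp: sets_PiM intro!: measurable_sets[OF Z] sigma_sets.Basic)
    fix a b assume "a \<in> G1" "b \<in> G2"
    then show "prob (a \<inter> b) = prob a * prob b"
      using box by (auto simp: G1_def G2_def prod_algebra_eq_finite[OF J])
  qed
  moreover have "Int_stable G1" "Int_stable G2"
    unfolding G1_def G2_def by (intro Int_stable_vimage sets.Int_stable Int_stable_prod_algebra)+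
  ultimately have "indep_set (sigma_sets (space M) G1) (sigma_sets (space M) G2)"
    by (rule indep_set_sigma_sets)
  then have "indep_set G1 (sigma_sets (space M) G2)"
    unfolding indep_sets2_eq by (auto intro: sigma_sets.Basic)
  then show ?thesis unfolding G2_sigma[symmetric] by (simp add: G1_def Z_def)
qed

text \<open>Kac's criterion makes the joint law a product measure, so the formula holds for all
  nonnegative measurable functions without integrability conditions.\<close>

lemma (in prob_space) nn_integral_mult_iexp:
  fixes X :: "'i \<Rightarrow> 'a \<Rightarrow> real" and Y :: "'a \<Rightarrow> real"
  assumes J: "finite J" and Y[measurable]: "Y \<in> borel_measurable M"
    and X: "\<And>j. j \<in> J \<Longrightarrow> X j \<in> borel_measurable M"
    and mult: "\<And>s t. (CLINT x|M. iexp (s * Y x) * iexp (\<Sum>j\<in>J. t j * X j x)) =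
      (CLINT x|M. iexp (s * Y x)) * (CLINT x|M. iexp (\<Sum>j\<in>J. t j * X j x))"
    and [measurable]: "h \<in> borel_measurable borel" "k \<in> borel_measurable (\<Pi>\<^sub>M j\<in>J. borel)"
  shows "(\<integral>\<^sup>+ x. h (Y x) * k (\<lambda>j\<in>J. X j x) \<partial>M) =
    (\<integral>\<^sup>+ x. h (Y x) \<partial>M) * (\<integral>\<^sup>+ x. k (\<lambda>j\<in>J. X j x) \<partial>M)"
proof -
  define Z where "Z = (\<lambda>x. \<lambda>j\<in>J. X j x)"
  have Z[measurable]: "Z \<in> measurable M (\<Pi>\<^sub>M j\<in>J. borel)"
    unfolding Z_def using X by (intro measurable_restrict) auto
  let ?DY = "distr M borel Y" and ?DZ = "distr M (\<Pi>\<^sub>M j\<in>J. borel) Z"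
  interpret DY: prob_space ?DY by (rule prob_space_distr) simp
  interpret DZ: prob_space ?DZ by (rule prob_space_distr) simp
  have "?DY \<Otimes>\<^sub>M ?DZ = distr M (borel \<Otimes>\<^sub>M (\<Pi>\<^sub>M j\<in>J. borel)) (\<lambda>x. (Y x, Z x))"
  proof (rule pair_measure_eqI)
    fix A B assume "A \<in> sets ?DY" "B \<in> sets ?DZ"
    then have [measurable]: "A \<in> sets borel" "B \<in> sets (\<Pi>\<^sub>M j\<in>J. borel)" by simp_all
    have "prob ((Y -` A \<inter> space M) \<inter> (Z -` B \<inter> space M)) = prob (Y -` A \<inter> space M) * prob (Z -` B \<inter> space M)"
      by (rule indep_setD[OF indep_set_iexp[OF J Y X mult]]) (auto simp: Z_def)
    moreover have "(\<lambda>x. (Y x, Z x)) -` (A \<times> B) \<inter> space M = (Y -` A \<inter> space M) \<inter> (Z -` B \<inter> space M)" by auto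
    ultimately show "emeasure ?DY A * emeasure ?DZ B =
        emeasure (distr M (borel \<Otimes>\<^sub>M (\<Pi>\<^sub>M j\<in>J. borel)) (\<lambda>x. (Y x, Z x))) (A \<times> B)"
      by (simp add: emeasure_distr emeasure_eq_measure ennreal_mult)
  qed (auto intro!: sets_pair_measure_cong DY.sigma_finite_measure_axioms DZ.sigma_finite_measure_axioms)
  then have "(\<integral>\<^sup>+ x. h (Y x) * k (Z x) \<partial>M) = (\<integral>\<^sup>+ p. h (fst p) * k (snd p) \<partial>(?DY \<Otimes>\<^sub>M ?DZ))"
    by (simp add: nn_integral_distr)
  also have "\<dots> = (\<integral>\<^sup>+ y. (\<integral>\<^sup>+ z. h y * k z \<partial>?DZ) \<partial>?DY)"
    by (subst DZ.nn_integral_fst[symmetric]) simp_all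
  also have "\<dots> = (\<integral>\<^sup>+ y. h y \<partial>?DY) * (\<integral>\<^sup>+ z. k z \<partial>?DZ)"
    by (simp add: nn_integral_cmult nn_integral_multc)
  also have "\<dots> = (\<integral>\<^sup>+ x. h (Y x) \<partial>M) * (\<integral>\<^sup>+ x. k (Z x) \<partial>M)"
    by (simp add: nn_integral_distr)
  finally show ?thesis by (simp add: Z_def)
qed

subsection \<open>Normal laws\<close>

definition lin :: "nat \<Rightarrow> (nat \<Rightarrow> real) \<Rightarrow> (nat \<Rightarrow> real) \<Rightarrow> real" where
  "lin d v x = (\<Sum>i<d. v i * x i)"

definition bil :: "nat \<Rightarrow> (nat \<Rightarrow> nat \<Rightarrow> real) \<Rightarrow> (nat \<Rightarrow> real) \<Rightarrow> (nat \<Rightarrow> real) \<Rightarrow> real" where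
  "bil d \<Sigma> u v = (\<Sum>i<d. \<Sum>j<d. u i * \<Sigma> i j * v j)"

definition unit :: "nat \<Rightarrow> nat \<Rightarrow> real" where
  "unit k = (\<lambda>i. if i = k then 1 else 0)"

lemma lin_measurable [measurable]: "lin d v \<in> borel_measurable (vec_space d)"
  unfolding lin_def vec_space_def
  by (intro borel_measurable_sum borel_measurable_times borel_measurable_const measurable_component_singleton) auto

lemma lin_combine: "lin d (\<lambda>i. a * u i + b * v i) x = a * lin d u x + b * lin d v x"
  by (simp add: lin_def sum.distrib sum_distrib_left algebra_simps)

lemma lin_scale: "lin d (\<lambda>i. a * u i) x = a * lin d u x"
  using lin_combine[of d a u 0 u x] by simp

lemma lin_add: "lin d (\<lambda>i. u i + v i) x = lin d u x + lin d v x"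
  using lin_combine[of d 1 u 1 v x] by simp

lemma lin_diff: "lin d (\<lambda>i. u i - v i) x = lin d u x - lin d v x"
  using lin_combine[of d 1 u "-1" v x] by simp

lemma lin_unit: "k < d \<Longrightarrow> lin d (unit k) x = x k"
  by (simp add: lin_def unit_def if_distrib[of "\<lambda>a. a * _"] cong: if_cong)

lemma lin_sum:
  "lin d (\<lambda>i. \<Sum>k\<in>J. t k * u k i) x = (\<Sum>k\<in>J. t k * lin d (u k) x)"
proof -
  have "lin d (\<lambda>i. \<Sum>k\<in>J. t k * u k i) x = (\<Sum>i<d. \<Sum>k\<in>J. t k * (u k i * x i))"
    by (simp add: lin_def sum_distrib_right mult.assoc)
  also have "\<dots> = (\<Sum>k\<in>J. \<Sum>i<d. t k * (u k i * x i))" by (rule sum.swap)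
  finally show ?thesis by (simp add: lin_def sum_distrib_left)
qed

lemma bil_combine_left: "bil d \<Sigma> (\<lambda>i. a * u i + b * v i) w = a * bil d \<Sigma> u w + b * bil d \<Sigma> v w"
  by (simp add: bil_def sum.distrib sum_distrib_left algebra_simps)

lemma bil_combine_right: "bil d \<Sigma> w (\<lambda>i. a * u i + b * v i) = a * bil d \<Sigma> w u + b * bil d \<Sigma> w v"
  by (simp add: bil_def sum.distrib sum_distrib_left algebra_simps)

lemma bil_scale:
  "bil d \<Sigma> (\<lambda>i. a * u i) w = a * bil d \<Sigma> u w" "bil d \<Sigma> w (\<lambda>i. a * u i) = a * bil d \<Sigma> w u"
  using bil_combine_left[of d \<Sigma> a u 0 u w] bil_combine_right[of d \<Sigma> w a u 0 u] by simp_all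

lemma bil_add:
  "bil d \<Sigma> (\<lambda>i. u i + v i) w = bil d \<Sigma> u w + bil d \<Sigma> v w"
  "bil d \<Sigma> w (\<lambda>i. u i + v i) = bil d \<Sigma> w u + bil d \<Sigma> w v"
  using bil_combine_left[of d \<Sigma> 1 u 1 v w] bil_combine_right[of d \<Sigma> w 1 u 1 v] by simp_all

lemma bil_diff:
  "bil d \<Sigma> (\<lambda>i. u i - v i) w = bil d \<Sigma> u w - bil d \<Sigma> v w"
  "bil d \<Sigma> w (\<lambda>i. u i - v i) = bil d \<Sigma> w u - bil d \<Sigma> w v"
  using bil_combine_left[of d \<Sigma> 1 u "-1" v w] bil_combine_right[of d \<Sigma> w 1 u "-1" v] by simp_all

lemma bil_sum_right:
  "bil d \<Sigma> w (\<lambda>i. \<Sum>k\<in>J. t k * u k i) = (\<Sum>k\<in>J. t k * bil d \<Sigma> w (u k))"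
proof (induction J rule: infinite_finite_induct)
  case (insert k J)
  then show ?case using bil_combine_right[of d \<Sigma> w "t k" "u k" 1 "\<lambda>i. \<Sum>k\<in>J. t k * u k i"] by simp
qed (simp_all add: bil_def)

lemma bil_unit: "j < d \<Longrightarrow> k < d \<Longrightarrow> bil d \<Sigma> (unit j) (unit k) = \<Sigma> j k"
  by (simp add: bil_def unit_def if_distrib[of "\<lambda>a. a * _"] if_distrib[of "\<lambda>a. _ * a"] cong: if_cong)

lemma bil_sym:
  assumes "\<And>i j. i < d \<Longrightarrow> j < d \<Longrightarrow> \<Sigma> i j = \<Sigma> j i"
  shows "bil d \<Sigma> u v = bil d \<Sigma> v u"
  unfolding bil_def by (subst sum.swap) (auto intro!: sum.cong simp: assms mult_ac)

lemma prob_space_std_normal_vec: "prob_space (std_normal_vec d)"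
  unfolding std_normal_vec_def
  by (intro prob_space_PiM prob_space_normal_density) simp

lemma sets_std_normal_vec [measurable_cong]: "sets (std_normal_vec d) = sets (vec_space d)"
  unfolding std_normal_vec_def vec_space_def by (intro sets_PiM_cong) simp_all

lemma char_lin_std_normal_vec:
  "(CLINT w|std_normal_vec d. iexp (t * lin d a w)) = exp (- (t\<^sup>2 * (\<Sum>k<d. (a k)\<^sup>2)) / 2)"
proof -
  interpret product_sigma_finite "\<lambda>i::nat. std_normal_distribution"
    by (intro product_sigma_finite.intro prob_space_imp_sigma_finite prob_space_normal_density) simp
  have "(CLINT w|std_normal_vec d. iexp (t * lin d a w)) =
      (CLINT w|std_normal_vec d. (\<Prod>k<d. iexp (t * a k * w k)))"
    by (simp add: lin_def sum_distrib_left exp_sum mult.assoc)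
  also have "\<dots> = (\<Prod>k<d. CLINT x|std_normal_distribution. iexp (t * a k * x))"
    unfolding std_normal_vec_def
  proof (rule product_integral_prod)
    interpret N: prob_space std_normal_distribution by (rule prob_space_normal_density) simp
    show "complex_integrable std_normal_distribution (\<lambda>x. iexp (t * a k * x))" for k
      by (rule N.integrable_iexp) simp_all
  qed simp
  also have "\<dots> = (\<Prod>k<d. char std_normal_distribution (t * a k))" by (simp add: char_def)
  also have "\<dots> = exp (\<Sum>k<d. - ((t * a k)\<^sup>2) / 2)"
    by (simp add: char_std_normal_distribution exp_sum flip: of_real_exp)
  also have "(\<Sum>k<d. - ((t * a k)\<^sup>2) / 2) = - (t\<^sup>2 * (\<Sum>k<d. (a k)\<^sup>2)) / 2"
    by (simp add: sum_distrib_left power_mult_distrib sum_negf flip: sum_divide_distrib)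
  finally show ?thesis .
qed

text \<open>Written as the law of a scaled standard normal variable rather than by a density, so
  that the zero functional, whose law is a point mass, is included.\<close>

lemma distr_lin_std_normal_vec:
  "distr (std_normal_vec d) borel (lin d a) =
    distr std_normal_distribution borel (\<lambda>x. sqrt (\<Sum>k<d. (a k)\<^sup>2) * x)"
proof (rule Levy_uniqueness)
  interpret V: prob_space "std_normal_vec d" by (rule prob_space_std_normal_vec)
  interpret N: prob_space std_normal_distribution by (rule prob_space_normal_density) simp
  show "real_distribution (distr (std_normal_vec d) borel (lin d a))"
    by (intro V.real_distribution_distr) measurable
  show "real_distribution (distr std_normal_distribution borel (\<lambda>x. sqrt (\<Sum>k<d. (a k)\<^sup>2) * x))"
    by (intro N.real_distribution_distr) measurable
  show "char (distr (std_normal_vec d) borel (lin d a)) =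
      char (distr std_normal_distribution borel (\<lambda>x. sqrt (\<Sum>k<d. (a k)\<^sup>2) * x))"
  proof (rule ext)
    fix t
    have "char (distr std_normal_distribution borel (\<lambda>x. sqrt (\<Sum>k<d. (a k)\<^sup>2) * x)) t =
        char std_normal_distribution (t * sqrt (\<Sum>k<d. (a k)\<^sup>2))"
      unfolding char_def by (subst integral_distr) (simp_all add: mult.assoc)
    also have "\<dots> = exp (- (t\<^sup>2 * (\<Sum>k<d. (a k)\<^sup>2)) / 2)"
      by (simp add: char_std_normal_distribution power_mult_distrib sum_nonneg)
    finally show "char (distr (std_normal_vec d) borel (lin d a)) t =
        char (distr std_normal_distribution borel (\<lambda>x. sqrt (\<Sum>k<d. (a k)\<^sup>2) * x)) t"
      using char_lin_std_normal_vec[of d t a] by (subst (1) char_def) (simp add: integral_distr)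
  qed
qed

text \<open>A normal law enters all arguments only through the laws of its linear functionals.\<close>

locale gaussian_law = prob_space M for M :: "(nat \<Rightarrow> real) measure" +
  fixes d :: nat and \<Sigma> :: "nat \<Rightarrow> nat \<Rightarrow> real"
  assumes sets_M [measurable_cong]: "sets M = sets (vec_space d)"
    and pos_def: "pos_def d \<Sigma>"
    and distr_lin: "distr M borel (lin d v) =
      distr std_normal_distribution borel (\<lambda>x. sqrt (bil d \<Sigma> v v) * x)"

lemma gaussian_law_if_normal_law:
  assumes pd: "pos_def d \<Sigma>" and nl: "is_normal_law d \<Sigma> M"
  shows "gaussian_law M d \<Sigma>"
proof -
  obtain A where A: "\<And>i j. i < d \<Longrightarrow> j < d \<Longrightarrow> \<Sigma> i j = (\<Sum>k<d. A i k * A j k)"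
    and M: "M = distr (std_normal_vec d) (vec_space d) (\<lambda>w. \<lambda>i\<in>{..<d}. \<Sum>k<d. A i k * w k)"
    using nl by (auto simp: is_normal_law_def)
  have T[measurable]: "(\<lambda>w. \<lambda>i\<in>{..<d}. \<Sum>k<d. A i k * w k) \<in> measurable (std_normal_vec d) (vec_space d)"
    using lin_measurable[of d "A _"] unfolding lin_def[abs_def] vec_space_def
    by (intro measurable_restrict) (simp add: measurable_cong_sets[OF sets_std_normal_vec refl] vec_space_def)
  interpret V: prob_space "std_normal_vec d" by (rule prob_space_std_normal_vec)
  interpret M: prob_space M unfolding M by (rule V.prob_space_distr) measurable
  show ?thesis
  proof
    show "sets M = sets (vec_space d)" by (simp add: M)
    show "pos_def d \<Sigma>" by fact
    fix v
    define a where "a = (\<lambda>k. \<Sum>i<d. v i * A i k)"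
    have a: "lin d v (\<lambda>i\<in>{..<d}. \<Sum>k<d. A i k * w k) = lin d a w" for w
    proof -
      have "lin d v (\<lambda>i\<in>{..<d}. \<Sum>k<d. A i k * w k) = (\<Sum>i<d. \<Sum>k<d. v i * A i k * w k)"
        by (simp add: lin_def sum_distrib_left mult.assoc)
      also have "\<dots> = lin d a w"
        by (subst sum.swap) (simp add: lin_def a_def sum_distrib_right sum_distrib_left mult_ac)
      finally show ?thesis .
    qed
    have "bil d \<Sigma> v v = (\<Sum>i<d. \<Sum>j<d. \<Sum>k<d. (v i * A i k) * (v j * A j k))"
      unfolding bil_def by (intro sum.cong refl) (simp add: A sum_distrib_left sum_distrib_right mult_ac)
    also have "\<dots> = (\<Sum>i<d. \<Sum>k<d. \<Sum>j<d. (v i * A i k) * (v j * A j k))"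
      by (rule sum.cong[OF refl], rule sum.swap)
    also have "\<dots> = (\<Sum>k<d. \<Sum>i<d. \<Sum>j<d. (v i * A i k) * (v j * A j k))"
      by (rule sum.swap)
    also have "\<dots> = (\<Sum>k<d. (a k)\<^sup>2)"
      by (simp add: a_def power2_eq_square sum_product)
    finally have q: "bil d \<Sigma> v v = (\<Sum>k<d. (a k)\<^sup>2)" .
    have "distr M borel (lin d v) = distr (std_normal_vec d) borel (lin d a)"
      unfolding M by (subst distr_distr) (auto simp: comp_def a)
    then show "distr M borel (lin d v) =
        distr std_normal_distribution borel (\<lambda>x. sqrt (bil d \<Sigma> v v) * x)"
      by (simp add: distr_lin_std_normal_vec q)
  qed
qed

context gaussian_law
begin

lemma Sigma_sym: "i < d \<Longrightarrow> j < d \<Longrightarrow> \<Sigma> i j = \<Sigma> j i"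
  using pos_def by (simp add: pos_def_def)

lemma bil_commute: "bil d \<Sigma> u v = bil d \<Sigma> v u"
  by (rule bil_sym) (rule Sigma_sym)

lemma bil_pos: "i < d \<Longrightarrow> v i \<noteq> 0 \<Longrightarrow> bil d \<Sigma> v v > 0"
  using pos_def unfolding pos_def_def bil_def by blast

lemma bil_nonneg: "bil d \<Sigma> v v \<ge> 0"
proof (cases "\<exists>i<d. v i \<noteq> 0")
  case True then show ?thesis using bil_pos by (auto intro: less_imp_le)
qed (simp add: bil_def)

lemma lin_measurable_M [measurable]: "lin d v \<in> borel_measurable M"
  by measurable

lemma coord_eq: "k < d \<Longrightarrow> (\<lambda>x. x k) = lin d (unit k)"
  by (simp add: lin_unit fun_eq_iff)

lemma coord_measurable: "k < d \<Longrightarrow> (\<lambda>x. x k) \<in> borel_measurable M"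
  by (simp add: coord_eq)

lemma integral_lin:
  fixes h :: "real \<Rightarrow> 'b::{banach, second_countable_topology}"
  assumes [measurable]: "h \<in> borel_measurable borel"
  shows "(\<integral>x. h (lin d v x) \<partial>M) = (\<integral>x. h (sqrt (bil d \<Sigma> v v) * x) \<partial>std_normal_distribution)"
proof -
  have "(\<integral>x. h (lin d v x) \<partial>M) = (\<integral>x. h x \<partial>distr M borel (lin d v))"
    by (subst integral_distr) simp_all
  then show ?thesis unfolding distr_lin by (subst (asm) integral_distr) simp_all
qed

lemma integrable_lin:
  fixes h :: "real \<Rightarrow> 'b::{banach, second_countable_topology}"
  assumes [measurable]: "h \<in> borel_measurable borel"
  shows "integrable M (\<lambda>x. h (lin d v x)) \<longleftrightarrow>
    integrable std_normal_distribution (\<lambda>x. h (sqrt (bil d \<Sigma> v v) * x))"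
proof -
  have "integrable M (\<lambda>x. h (lin d v x)) \<longleftrightarrow> integrable (distr M borel (lin d v)) h"
    by (subst integrable_distr_eq) simp_all
  then show ?thesis unfolding distr_lin by (subst (asm) integrable_distr_eq) simp_all
qed

lemma nn_integral_lin:
  assumes [measurable]: "h \<in> borel_measurable borel"
  shows "(\<integral>\<^sup>+x. h (lin d v x) \<partial>M) = (\<integral>\<^sup>+x. h (sqrt (bil d \<Sigma> v v) * x) \<partial>std_normal_distribution)"
proof -
  have "(\<integral>\<^sup>+x. h (lin d v x) \<partial>M) = (\<integral>\<^sup>+x. h x \<partial>distr M borel (lin d v))"
    by (subst nn_integral_distr) simp_all
  then show ?thesis unfolding distr_lin by (subst (asm) nn_integral_distr) simp_all
qed

lemma char_lin: "(CLINT x|M. iexp (lin d v x)) = exp (- bil d \<Sigma> v v / 2)"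
proof -
  have "(CLINT x|M. iexp (lin d v x)) = char std_normal_distribution (sqrt (bil d \<Sigma> v v))"
    using integral_lin[of iexp v] by (simp add: char_def)
  then show ?thesis by (simp add: char_std_normal_distribution bil_nonneg)
qed

lemma integrable_lin_power: "integrable M (\<lambda>x. (lin d v x) ^ k)"
  using integrable_lin[of "\<lambda>x. x ^ k" v] integrable_std_normal_distribution_moment[of k]
  by (simp add: power_mult_distrib)

lemma integrable_lin_self: "integrable M (lin d v)"
  using integrable_lin_power[of v 1] by simp

lemma expectation_lin: "(\<integral>x. lin d v x \<partial>M) = 0"
  using integral_lin[of "\<lambda>x. x" v] integral_std_normal_distribution_moment_odd[of 1] by simp

lemma expectation_lin_square: "(\<integral>x. (lin d v x)\<^sup>2 \<partial>M) = bil d \<Sigma> v v"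
  using integral_lin[of "\<lambda>x. x\<^sup>2" v] std_normal_distribution_even_moments(1)[of 1]
  by (simp add: power_mult_distrib bil_nonneg)

text \<open>Only the law of a single functional is available, so mixed second moments are obtained
  from squares by polarization.\<close>

lemma lin_mult_polarize:
  "lin d u x * lin d v x = ((lin d (\<lambda>i. u i + v i) x)\<^sup>2 - (lin d (\<lambda>i. u i - v i) x)\<^sup>2) / 4"
  by (simp add: lin_add lin_diff power2_eq_square algebra_simps)

lemma bil_polarize:
  "bil d \<Sigma> u v = (bil d \<Sigma> (\<lambda>i. u i + v i) (\<lambda>i. u i + v i) - bil d \<Sigma> (\<lambda>i. u i - v i) (\<lambda>i. u i - v i)) / 4"
  by (simp add: bil_add bil_diff bil_commute[of v u])

lemma integrable_lin_mult: "integrable M (\<lambda>x. lin d u x * lin d v x)"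
  unfolding lin_mult_polarize using integrable_lin_power by simp

lemma expectation_lin_mult: "(\<integral>x. lin d u x * lin d v x \<partial>M) = bil d \<Sigma> u v"
  unfolding lin_mult_polarize bil_polarize[of u v] using integrable_lin_power
  by (simp add: expectation_lin_square)

text \<open>The characteristic function of a functional involves only the quadratic form of the
  covariance, and here the mixed term of this form vanishes. The result is the hypothesis of Kac's
  criterion.\<close>

lemma iexp_lin_indep:
  assumes "finite J" "J \<subseteq> {..<d}" "\<And>j. j \<in> J \<Longrightarrow> bil d \<Sigma> u (unit j) = 0"
  shows "(CLINT x|M. iexp (s * lin d u x) * iexp (\<Sum>j\<in>J. t j * x j)) =
    (CLINT x|M. iexp (s * lin d u x)) * (CLINT x|M. iexp (\<Sum>j\<in>J. t j * x j))"
proof -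
  define T where "T = (\<lambda>i. \<Sum>j\<in>J. t j * unit j i)"
  define S where "S = (\<lambda>i. s * u i)"
  have T: "(\<Sum>j\<in>J. t j * x j) = lin d T x" for x
    unfolding T_def lin_sum using assms(2) by (intro sum.cong refl) (auto simp: lin_unit)
  have S: "s * lin d u x = lin d S x" for x by (simp add: S_def lin_scale)
  have ST: "bil d \<Sigma> S T = 0"
    unfolding T_def S_def bil_sum_right bil_scale using assms(3) by simp
  have "(CLINT x|M. iexp (s * lin d u x) * iexp (\<Sum>j\<in>J. t j * x j)) =
      (CLINT x|M. iexp (lin d (\<lambda>i. S i + T i) x))"
    by (simp add: S T lin_add distrib_left exp_add)
  also have "\<dots> = exp (- bil d \<Sigma> S S / 2) * exp (- bil d \<Sigma> T T / 2)"
    unfolding char_lin by (simp add: bil_add bil_commute[of T S] ST add_divide_distrib flip: exp_add)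
  finally show ?thesis by (simp only: S T char_lin of_real_mult)
qed

lemma nn_integral_lin_indep:
  assumes J: "finite J" "J \<subseteq> {..<d}" "\<And>j. j \<in> J \<Longrightarrow> bil d \<Sigma> u (unit j) = 0"
    and [measurable]: "h \<in> borel_measurable borel" "k \<in> borel_measurable (\<Pi>\<^sub>M j\<in>J. borel)"
  shows "(\<integral>\<^sup>+ x. h (lin d u x) * k (restrict x J) \<partial>M) =
    (\<integral>\<^sup>+ x. h (lin d u x) \<partial>M) * (\<integral>\<^sup>+ x. k (restrict x J) \<partial>M)"
  by (rule nn_integral_mult_iexp[OF J(1) _ _ iexp_lin_indep[OF J]]) (use J(2) coord_measurable in auto)

end

section \<open>Conditional independence and conditional expectation\<close>

lemma emeasure_distr_nn_integral:
  assumes "T \<in> measurable M N" "B \<in> sets N"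
  shows "emeasure (distr M N T) B = (\<integral>\<^sup>+ x. indicator B (T x) \<partial>M)"
  using nn_integral_indicator[of B "distr M N T"] nn_integral_distr[OF assms(1), of "indicator B"] assms(2)
  by simp

lemma (in prob_space) indep_var_indicator:
  fixes Y Z :: "'a \<Rightarrow> real"
  assumes [measurable]: "Y \<in> borel_measurable M" "Z \<in> borel_measurable M"
    and indep: "\<And>A B. A \<in> sets borel \<Longrightarrow> B \<in> sets borel \<Longrightarrow>
      (\<integral>\<^sup>+ x. indicator A (Y x) * indicator B (Z x) \<partial>M) =
      (\<integral>\<^sup>+ x. indicator A (Y x) \<partial>M) * (\<integral>\<^sup>+ x. indicator B (Z x) \<partial>M)"
  shows "indep_var borel Y borel Z"
proof -
  interpret DY: prob_space "distr M borel Y" by (rule prob_space_distr) simp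
  interpret DZ: prob_space "distr M borel Z" by (rule prob_space_distr) simp
  have "distr M borel Y \<Otimes>\<^sub>M distr M borel Z = distr M (borel \<Otimes>\<^sub>M borel) (\<lambda>x. (Y x, Z x))"
  proof (rule pair_measure_eqI)
    fix A B assume "A \<in> sets (distr M borel Y)" "B \<in> sets (distr M borel Z)"
    then have AB[measurable]: "A \<in> sets borel" "B \<in> sets borel" by simp_all
    then show "emeasure (distr M borel Y) A * emeasure (distr M borel Z) B =
        emeasure (distr M (borel \<Otimes>\<^sub>M borel) (\<lambda>x. (Y x, Z x))) (A \<times> B)"
      using indep[OF AB] by (simp add: emeasure_distr_nn_integral indicator_times)
  qed (auto intro!: sets_pair_measure_cong DY.sigma_finite_measure_axioms DZ.sigma_finite_measure_axioms)
  then show ?thesis by (simp add: indep_var_distribution_eq)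
qed

lemma generated_subalgebra:
  assumes "Z \<in> borel_measurable M"
  shows "subalgebra M (generated_alg M Z)"
  unfolding subalgebra_def generated_alg_def
  using measurable_sets[OF assms] by (auto simp: sets_vimage_algebra2)

lemma sets_generated_alg:
  "A \<in> sets (generated_alg M Z) \<longleftrightarrow> (\<exists>B\<in>sets borel. A = Z -` B \<inter> space M)"
  unfolding generated_alg_def by (auto simp: sets_vimage_algebra2)

lemma measurable_generated_alg: "Z \<in> borel_measurable (generated_alg M Z)"
  unfolding generated_alg_def by (rule measurable_vimage_algebra1) simp

context prob_space
begin

lemma generated_sigma_finite:
  assumes "Z \<in> borel_measurable M"
  shows "sigma_finite_subalgebra M (generated_alg M Z)"
  by (intro finite_measure_subalgebra_is_sigma_finite finite_measure_subalgebra.intro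
      finite_measure_subalgebra_axioms.intro generated_subalgebra assms) (rule finite_measure_axioms)

lemma set_integral_vimage:
  "(LINT x:(Z -` B \<inter> space M)|M. f x) = (LINT x|M. f x * indicator B (Z x) :: real)"
  unfolding set_lebesgue_integral_def
  by (intro Bochner_Integration.integral_cong) (auto simp: indicator_def)

text \<open>Equality of the restricted integrals means that \<open>U\<close> and \<open>V\<close>
  have the same conditional expectation given \<open>Y\<close>. Pulling \<open>Y\<close> out of the
  conditional expectation then handles the unbounded factor \<open>Y\<close> without an
  approximation argument.\<close>

lemma integral_eq_if_restrictions_eq:
  fixes U V :: "'a \<Rightarrow> real"
  assumes [measurable]: "Y \<in> borel_measurable M" and U: "integrable M U" and V: "integrable M V"
    and eq: "\<And>B. B \<in> sets borel \<Longrightarrow> (LINT x|M. U x * indicator B (Y x)) = (LINT x|M. V x * indicator B (Y x))"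
    and YU: "integrable M (\<lambda>x. Y x * U x)" and YV: "integrable M (\<lambda>x. Y x * V x)"
  shows "(LINT x|M. Y x * U x) = (LINT x|M. Y x * V x)"
proof -
  let ?F = "generated_alg M Y"
  interpret F: sigma_finite_subalgebra M ?F by (rule generated_sigma_finite) simp
  have [measurable]: "U \<in> borel_measurable M" "V \<in> borel_measurable M" using U V by auto
  have "AE x in M. real_cond_exp M ?F U x = real_cond_exp M ?F V x"
  proof (rule F.real_cond_exp_charact)
    fix A assume A: "A \<in> sets ?F"
    then obtain B where "B \<in> sets borel" "A = Y -` B \<inter> space M" by (auto simp: sets_generated_alg)
    then have "(LINT x:A|M. U x) = (LINT x:A|M. V x)" using eq by (simp add: set_integral_vimage)
    then show "(LINT x:A|M. U x) = (LINT x:A|M. real_cond_exp M ?F V x)"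
      using F.real_cond_exp_intA[OF V A] by simp
  qed (use U V F.real_cond_exp_int in auto)
  then have "(LINT x|M. Y x * real_cond_exp M ?F U x) = (LINT x|M. Y x * real_cond_exp M ?F V x)"
    by (intro integral_cong_AE) auto
  then show ?thesis
    using F.real_cond_exp_intg(2)[OF YU measurable_generated_alg]
      F.real_cond_exp_intg(2)[OF YV measurable_generated_alg] by simp
qed

text \<open>Conditional independence is given for indicators only, and they are replaced by the
  variables one at a time. For a fixed event on \<open>X\<close>, its conditional probability
  \<open>e\<close> given \<open>Z\<close> is tested against \<open>Y\<close>; afterwards the event
  on \<open>X\<close> is replaced by \<open>X\<close> itself.\<close>

lemma cond_indep_expectation:
  assumes ci: "cond_indep M X Y Z"
    and [measurable]: "X \<in> borel_measurable M" "Y \<in> borel_measurable M" "Z \<in> borel_measurable M"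
    and Y: "integrable M Y" and XY: "integrable M (\<lambda>x. X x * Y x)"
    and G: "AE x in M. real_cond_exp M (generated_alg M Z) Y x = G x"
    and Gi: "integrable M G" "integrable M (\<lambda>x. X x * G x)"
  shows "(LINT x|M. X x * Y x) = (LINT x|M. X x * G x)"
proof (rule integral_eq_if_restrictions_eq[OF _ Y Gi(1) _ XY Gi(2)])
  let ?F = "generated_alg M Z"
  interpret F: sigma_finite_subalgebra M ?F by (rule generated_sigma_finite) simp
  have [measurable]: "G \<in> borel_measurable M" using Gi by auto
  fix A :: "real set" assume A[measurable]: "A \<in> sets borel"
  define e where "e = real_cond_exp M ?F (\<lambda>x. indicator A (X x))"
  have iA: "integrable M (\<lambda>x. indicator B (W x) :: real)"
    if [measurable]: "B \<in> sets borel" "W \<in> borel_measurable M" for B :: "real set" and W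
    by (intro integrable_const_bound[of _ 1]) auto
  have [measurable]: "e \<in> borel_measurable ?F" "e \<in> borel_measurable M" by (auto simp: e_def)
  have ei: "integrable M e" unfolding e_def by (intro F.real_cond_exp_int iA) auto
  have eb: "AE x in M. \<bar>e x\<bar> \<le> 1"
  proof -
    have "AE x in M. e x \<ge> 0" "AE x in M. e x \<le> 1"
      unfolding e_def by (intro F.real_cond_exp_ge_c F.real_cond_exp_le_c iA; simp add: indicator_def)+
    then show ?thesis by eventually_elim simp
  qed
  have "(LINT x|M. Y x * indicator A (X x)) = (LINT x|M. Y x * e x)"
  proof (rule integral_eq_if_restrictions_eq[OF _ _ ei])
    fix B :: "real set" assume B[measurable]: "B \<in> sets borel"
    have iB: "integrable M (\<lambda>x. e x * indicator B (Y x))"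
      by (rule Bochner_Integration.integrable_bound[OF ei]) (auto simp: indicator_def)
    have iAB: "integrable M (\<lambda>x. indicator A (X x) * indicator B (Y x) :: real)"
      by (intro integrable_const_bound[of _ 1]) (auto simp: indicator_def)
    have "(LINT x|M. indicator A (X x) * indicator B (Y x) :: real) =
        (LINT x|M. real_cond_exp M ?F (\<lambda>x. indicator A (X x) * indicator B (Y x)) x)"
      using F.real_cond_exp_int(2)[OF iAB] by simp
    also have "\<dots> = (LINT x|M. e x * real_cond_exp M ?F (\<lambda>x. indicator B (Y x)) x)"
      using ci A B unfolding cond_indep_def e_def by (intro integral_cong_AE) auto
    also have "\<dots> = (LINT x|M. e x * indicator B (Y x))"
      by (rule F.real_cond_exp_intg(2)[OF iB]) auto
    finally show "(LINT x|M. indicator A (X x) * indicator B (Y x)) = (LINT x|M. e x * indicator B (Y x))" .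
  next
    show "integrable M (\<lambda>x. Y x * indicator A (X x))"
      by (rule Bochner_Integration.integrable_bound[OF Y]) (auto simp: indicator_def)
    show "integrable M (\<lambda>x. Y x * e x)"
      using eb by (intro Bochner_Integration.integrable_bound[OF Y])
        (auto simp: abs_mult mult_left_le elim!: eventually_mono)
  qed (auto intro: iA)
  also have "\<dots> = (LINT x|M. e x * Y x)" by (simp add: mult.commute)
  also have "\<dots> = (LINT x|M. e x * real_cond_exp M ?F Y x)"
  proof (rule F.real_cond_exp_intg(2)[symmetric])
    show "integrable M (\<lambda>x. e x * Y x)"
      using eb by (intro Bochner_Integration.integrable_bound[OF Y])
        (auto simp: abs_mult mult_left_le_one_le elim!: eventually_mono)
  qed auto
  also have "\<dots> = (LINT x|M. real_cond_exp M ?F Y x * e x)" by (simp add: mult.commute)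
  also have "\<dots> = (LINT x|M. real_cond_exp M ?F Y x * indicator A (X x))"
    unfolding e_def
    by (intro F.real_cond_exp_intg(2) Bochner_Integration.integrable_bound[OF F.real_cond_exp_int(1)[OF Y]])
      (auto simp: indicator_def)
  also have "\<dots> = (LINT x|M. G x * indicator A (X x))"
    using G by (intro integral_cong_AE) auto
  finally show "(LINT x|M. Y x * indicator A (X x)) = (LINT x|M. G x * indicator A (X x))" .
qed simp

lemma real_cond_exp_generated:
  assumes Z[measurable]: "Z \<in> borel_measurable M" and [measurable]: "g \<in> borel_measurable borel"
    and f: "integrable M f" and g: "integrable M (\<lambda>x. g (Z x))"
    and eq: "\<And>B. B \<in> sets borel \<Longrightarrow>
      (LINT x|M. f x * indicator B (Z x)) = (LINT x|M. g (Z x) * indicator B (Z x))"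
  shows "AE x in M. real_cond_exp M (generated_alg M Z) f x = g (Z x)"
proof -
  let ?F = "generated_alg M Z"
  interpret F: sigma_finite_subalgebra M ?F by (rule generated_sigma_finite) simp
  show ?thesis
  proof (rule F.real_cond_exp_charact)
    show "(LINT x:A|M. f x) = (LINT x:A|M. g (Z x))" if A: "A \<in> sets ?F" for A
    proof -
      obtain B where "B \<in> sets borel" "A = Z -` B \<inter> space M" using A by (auto simp: sets_generated_alg)
      then show ?thesis using eq by (simp add: set_integral_vimage)
    qed
    show "(\<lambda>x. g (Z x)) \<in> borel_measurable ?F"
      using measurable_compose[OF measurable_generated_alg, of g borel] by simp
  qed (use f g in auto)
qed

end

section \<open>Conditional covariances of a normal law\<close>

context gaussian_law
begin

lemma indep_var_lin_coord:
  assumes l: "l < d" and uncorr: "bil d \<Sigma> u (unit l) = 0"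
  shows "indep_var borel (lin d u) borel (\<lambda>x. x l)"
proof -
  have [measurable]: "(\<lambda>x. x l) \<in> borel_measurable M" using l by (rule coord_measurable)
  show ?thesis
  proof (rule indep_var_indicator)
    fix A B :: "real set" assume [measurable]: "A \<in> sets borel" "B \<in> sets borel"
    have "(\<integral>\<^sup>+ x. indicator A (lin d u x) * indicator B (restrict x {l} l) \<partial>M) =
        (\<integral>\<^sup>+ x. indicator A (lin d u x) \<partial>M) * (\<integral>\<^sup>+ x. indicator B (restrict x {l} l) \<partial>M)"
      by (rule nn_integral_lin_indep[where k = "\<lambda>y. indicator B (y l)"]) (use l uncorr in auto)
    then show "(\<integral>\<^sup>+ x. indicator A (lin d u x) * indicator B (x l) \<partial>M) =
        (\<integral>\<^sup>+ x. indicator A (lin d u x) \<partial>M) * (\<integral>\<^sup>+ x. indicator B (x l) \<partial>M)" by simp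
  qed simp_all
qed

lemma integral_indep_mult:
  fixes h k :: "real \<Rightarrow> real"
  assumes "l < d" "bil d \<Sigma> u (unit l) = 0" "h \<in> borel_measurable borel" "k \<in> borel_measurable borel"
    "integrable M (\<lambda>x. h (lin d u x))" "integrable M (\<lambda>x. k (x l))"
  shows "(LINT x|M. h (lin d u x) * k (x l)) = (LINT x|M. h (lin d u x)) * (LINT x|M. k (x l))"
    "integrable M (\<lambda>x. h (lin d u x) * k (x l))"
  using indep_var_lebesgue_integral[OF _ assms(5,6)] indep_var_integrable[OF _ assms(5,6)]
    indep_var_compose[OF indep_var_lin_coord[OF assms(1,2)] assms(3,4)] by (simp_all add: comp_def)

text \<open>Coefficients of the residual of \<open>x j\<close> after linear regression on
  \<open>x l\<close>. As a functional it is uncorrelated with \<open>x l\<close>, hence independent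
  of it.\<close>

definition resid :: "nat \<Rightarrow> nat \<Rightarrow> nat \<Rightarrow> real" where
  "resid l j = (\<lambda>i. unit j i - \<Sigma> j l / \<Sigma> l l * unit l i)"

definition pcov :: "nat \<Rightarrow> nat \<Rightarrow> nat \<Rightarrow> real" where
  "pcov l j k = \<Sigma> j k - \<Sigma> j l * \<Sigma> k l / \<Sigma> l l"

lemma Sigma_diag_pos: "l < d \<Longrightarrow> \<Sigma> l l > 0"
  using bil_pos[of l "unit l"] bil_unit[of l d l \<Sigma>] by (simp add: unit_def)

lemma lin_resid: "j < d \<Longrightarrow> l < d \<Longrightarrow> lin d (resid l j) x = x j - \<Sigma> j l / \<Sigma> l l * x l"
  using lin_combine[of d 1 "unit j" "- (\<Sigma> j l / \<Sigma> l l)" "unit l" x] by (simp add: resid_def lin_unit)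

lemma bil_resid_right:
  "bil d \<Sigma> u (resid l j) = bil d \<Sigma> u (unit j) - \<Sigma> j l / \<Sigma> l l * bil d \<Sigma> u (unit l)"
  using bil_combine_right[of d \<Sigma> u 1 "unit j" "- (\<Sigma> j l / \<Sigma> l l)" "unit l"] by (simp add: resid_def)

lemma bil_resid_unit: "j < d \<Longrightarrow> l < d \<Longrightarrow> bil d \<Sigma> (resid l j) (unit l) = 0"
  using Sigma_diag_pos[of l] Sigma_sym[of j l] bil_commute[of "resid l j" "unit l"]
  by (simp add: bil_resid_right bil_unit)

lemma bil_resid_resid: "j < d \<Longrightarrow> k < d \<Longrightarrow> l < d \<Longrightarrow> bil d \<Sigma> (resid l j) (resid l k) = pcov l j k"
  using bil_resid_unit[of j l] bil_commute[of "resid l j" "unit k"] Sigma_sym[of j k]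
  by (subst bil_resid_right) (simp add: bil_resid_right[of "unit k"] bil_unit pcov_def)

lemma pcov_pos: "j < d \<Longrightarrow> l < d \<Longrightarrow> j \<noteq> l \<Longrightarrow> pcov l j j > 0"
  using bil_pos[of j "resid l j"] bil_resid_resid[of j j l] by (simp add: resid_def unit_def)

text \<open>\<open>x j\<close> is its residual plus a multiple of \<open>x l\<close>. The residual
  is centred and independent of \<open>x l\<close>, so it contributes nothing on events of
  \<open>x l\<close>.\<close>

lemma real_cond_exp_coord:
  assumes j: "j < d" and l: "l < d"
  shows "AE x in M. real_cond_exp M (generated_alg M (\<lambda>x. x l)) (\<lambda>x. x j) x = \<Sigma> j l / \<Sigma> l l * x l"
proof (rule real_cond_exp_generated[where g = "\<lambda>y. \<Sigma> j l / \<Sigma> l l * y"])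
  have [measurable]: "(\<lambda>x. x l) \<in> borel_measurable M" using l by (rule coord_measurable)
  have ij: "integrable M (\<lambda>x. x j)" and il: "integrable M (\<lambda>x. x l)"
    using integrable_lin_self j l by (simp_all add: coord_eq)
  show "integrable M (\<lambda>x. x j)" "integrable M (\<lambda>x. \<Sigma> j l / \<Sigma> l l * x l)" using ij il by auto
  fix B :: "real set" assume B[measurable]: "B \<in> sets borel"
  have iB: "integrable M (\<lambda>x. indicator B (x l) :: real)" by (intro integrable_const_bound[of _ 1]) auto
  have 0: "(LINT x|M. lin d (resid l j) x * indicator B (x l)) = 0"
    "integrable M (\<lambda>x. lin d (resid l j) x * indicator B (x l))"
    using integral_indep_mult[OF l bil_resid_unit[OF j l], of "\<lambda>x. x" "indicator B"] iB
    by (simp_all add: integrable_lin_self expectation_lin)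
  have "integrable M (\<lambda>x. \<Sigma> j l / \<Sigma> l l * x l * indicator B (x l))"
    by (rule Bochner_Integration.integrable_bound[of _ "\<lambda>x. \<Sigma> j l / \<Sigma> l l * x l"]) (use il in \<open>auto simp: indicator_def\<close>)
  moreover have "x j * indicator B (x l) = lin d (resid l j) x * indicator B (x l) +
      \<Sigma> j l / \<Sigma> l l * x l * indicator B (x l)" for x
    by (simp add: lin_resid j l algebra_simps)
  ultimately show "(LINT x|M. x j * indicator B (x l)) = (LINT x|M. \<Sigma> j l / \<Sigma> l l * x l * indicator B (x l))"
    using 0 by simp
qed (use l coord_measurable in auto)

text \<open>Independence from \<open>x l\<close> is available for a single functional only. The
  functionals orthogonal to \<open>unit l\<close> are closed under sums and differences, so
  polarization gives the product of two of them.\<close>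

lemma integral_resid_square_indicator:
  assumes l: "l < d" and u: "bil d \<Sigma> u (unit l) = 0" and v: "bil d \<Sigma> v (unit l) = 0"
    and [measurable]: "B \<in> sets borel"
  shows "(LINT x|M. (lin d u x * lin d v x) * indicator B (x l)) = bil d \<Sigma> u v * (LINT x|M. indicator B (x l))"
    "integrable M (\<lambda>x. (lin d u x * lin d v x) * indicator B (x l))"
proof -
  have [measurable]: "(\<lambda>x. x l) \<in> borel_measurable M" using l by (rule coord_measurable)
  have iB: "integrable M (\<lambda>x. indicator B (x l) :: real)" by (intro integrable_const_bound[of _ 1]) auto
  have *: "(LINT x|M. (lin d w x)\<^sup>2 * indicator B (x l)) = bil d \<Sigma> w w * (LINT x|M. indicator B (x l))"
    "integrable M (\<lambda>x. (lin d w x)\<^sup>2 * indicator B (x l))" if "bil d \<Sigma> w (unit l) = 0" for w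
    using integral_indep_mult[OF l that, of "\<lambda>x. x\<^sup>2" "indicator B"] iB
    by (simp_all add: integrable_lin_power expectation_lin_square)
  have uv: "bil d \<Sigma> (\<lambda>i. u i + v i) (unit l) = 0" "bil d \<Sigma> (\<lambda>i. u i - v i) (unit l) = 0"
    using u v by (simp_all add: bil_add bil_diff)
  have e: "(lin d u x * lin d v x) * indicator B (x l) = ((lin d (\<lambda>i. u i + v i) x)\<^sup>2 * indicator B (x l)
      - (lin d (\<lambda>i. u i - v i) x)\<^sup>2 * indicator B (x l)) / 4" for x
    by (simp add: lin_mult_polarize field_simps)
  show "integrable M (\<lambda>x. (lin d u x * lin d v x) * indicator B (x l))"
    unfolding e using *(2)[OF uv(1)] *(2)[OF uv(2)] by simp
  show "(LINT x|M. (lin d u x * lin d v x) * indicator B (x l)) = bil d \<Sigma> u v * (LINT x|M. indicator B (x l))"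
    unfolding e bil_polarize[of u v] using *[OF uv(1)] *[OF uv(2)] by (simp add: field_simps)
qed

text \<open>Splitting both coordinates into residual and regression term gives four products. The
  two mixed ones have mean zero on every event of \<open>x l\<close>, and the product of the
  residuals contributes the constant \<open>pcov l j k\<close>.\<close>

lemma real_cond_exp_coord_mult:
  assumes j: "j < d" and k: "k < d" and l: "l < d"
  shows "AE x in M. real_cond_exp M (generated_alg M (\<lambda>x. x l)) (\<lambda>x. x j * x k) x =
    pcov l j k + (\<Sigma> j l / \<Sigma> l l * x l) * (\<Sigma> k l / \<Sigma> l l * x l)"
proof (rule real_cond_exp_generated[where g = "\<lambda>y. pcov l j k + (\<Sigma> j l / \<Sigma> l l * y) * (\<Sigma> k l / \<Sigma> l l * y)"])
  have [measurable]: "(\<lambda>x. x l) \<in> borel_measurable M" using l by (rule coord_measurable)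
  let ?b = "\<lambda>j. \<Sigma> j l / \<Sigma> l l"
  show "integrable M (\<lambda>x. x j * x k)"
    using integrable_lin_mult[of "unit j" "unit k"] j k by (simp add: lin_unit)
  have il: "integrable M (\<lambda>x. x l)" and ill: "integrable M (\<lambda>x. x l * x l)"
    using integrable_lin_mult[of "unit l" "unit l"] integrable_lin_self[of "unit l"] l
    by (simp_all add: lin_unit coord_eq[symmetric])
  then have ill': "integrable M (\<lambda>x. (?b j * x l) * (?b k * x l))"
    using integrable_mult_right[OF ill, of "?b j * ?b k"] by (simp add: mult_ac)
  then show "integrable M (\<lambda>x. pcov l j k + (?b j * x l) * (?b k * x l))" by simp
  fix B :: "real set" assume B[measurable]: "B \<in> sets borel"
  have iB: "integrable M (\<lambda>x. indicator B (x l) :: real)" by (intro integrable_const_bound[of _ 1]) auto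
  have ilB: "integrable M (\<lambda>x. x l * indicator B (x l))"
    by (rule Bochner_Integration.integrable_bound[OF il]) (auto simp: indicator_def)
  have illB: "integrable M (\<lambda>x. (?b j * x l) * (?b k * x l) * indicator B (x l))"
    by (rule Bochner_Integration.integrable_bound[OF ill']) (auto simp: indicator_def)
  have cross: "(LINT x|M. lin d (resid l i) x * (x l * indicator B (x l))) = 0"
    "integrable M (\<lambda>x. lin d (resid l i) x * (x l * indicator B (x l)))" if "i < d" for i
    using integral_indep_mult[OF l bil_resid_unit[OF that l], of "\<lambda>x. x" "\<lambda>y. y * indicator B y"] ilB
    by (simp_all add: integrable_lin_self expectation_lin)
  note sq = integral_resid_square_indicator[OF l bil_resid_unit[OF j l] bil_resid_unit[OF k l] B]
  have e: "x j * x k * indicator B (x l) = lin d (resid l j) x * lin d (resid l k) x * indicator B (x l)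
      + ?b k * (lin d (resid l j) x * (x l * indicator B (x l)))
      + ?b j * (lin d (resid l k) x * (x l * indicator B (x l)))
      + (?b j * x l) * (?b k * x l) * indicator B (x l)" for x
    by (simp add: lin_resid j k l algebra_simps)
  have "(LINT x|M. x j * x k * indicator B (x l)) =
      pcov l j k * (LINT x|M. indicator B (x l)) + (LINT x|M. (?b j * x l) * (?b k * x l) * indicator B (x l))"
    unfolding e using sq cross[OF j] cross[OF k] illB by (simp add: bil_resid_resid j k l)
  also have "\<dots> = (LINT x|M. (pcov l j k + (?b j * x l) * (?b k * x l)) * indicator B (x l))"
    using iB illB by (simp add: distrib_right)
  finally show "(LINT x|M. x j * x k * indicator B (x l)) =
      (LINT x|M. (pcov l j k + (?b j * x l) * (?b k * x l)) * indicator B (x l))" .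
qed (use l coord_measurable in auto)

lemma cond_cov_eq_pcov:
  assumes "j < d" "k < d" "l < d"
  shows "AE x in M. cond_cov M (\<lambda>x. x j) (\<lambda>x. x k) (\<lambda>x. x l) x = pcov l j k"
  using real_cond_exp_coord[OF assms(1,3)] real_cond_exp_coord[OF assms(2,3)]
    real_cond_exp_coord_mult[OF assms]
  by eventually_elim (simp add: cond_cov_def)

lemma m_gauss_None:
  assumes "j < d" "k < d"
  shows "m_gauss M j k None = \<bar>\<Sigma> j k\<bar> / sqrt (\<Sigma> j j * \<Sigma> k k)"
proof -
  have "cov M (\<lambda>x. x i) (\<lambda>x. x h) = \<Sigma> i h" if "i < d" "h < d" for i h
    using expectation_lin_mult[of "unit i" "unit h"] expectation_lin[of "unit i"] that
    by (simp add: cov_def lin_unit bil_unit)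
  then show ?thesis using assms by simp
qed

text \<open>The definite description in \<open>m_gauss\<close> is legitimate because two almost sure
  constants agree on a probability space.\<close>

lemma m_gauss_Some:
  assumes "j < d" "k < d" "l < d"
  shows "m_gauss M j k (Some l) = \<bar>pcov l j k\<bar> / sqrt (pcov l j j * pcov l k k)"
proof -
  let ?q = "\<lambda>x. \<bar>cond_cov M (\<lambda>x. x j) (\<lambda>x. x k) (\<lambda>x. x l) x\<bar>
      / sqrt (cond_cov M (\<lambda>x. x j) (\<lambda>x. x j) (\<lambda>x. x l) x * cond_cov M (\<lambda>x. x k) (\<lambda>x. x k) (\<lambda>x. x l) x)"
  let ?v = "\<bar>pcov l j k\<bar> / sqrt (pcov l j j * pcov l k k)"
  have ae: "AE x in M. ?q x = ?v"
    using cond_cov_eq_pcov[OF assms] cond_cov_eq_pcov[OF assms(1,1,3)] cond_cov_eq_pcov[OF assms(2,2,3)]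
    by eventually_elim simp
  have "(THE v. AE x in M. ?q x = v) = ?v"
  proof (rule the_equality)
    show "AE x in M. ?q x = ?v" by (rule ae)
    fix v assume "AE x in M. ?q x = v"
    with ae have "AE x in M. v = ?v" by eventually_elim simp
    then show "v = ?v" by simp
  qed
  then show ?thesis by simp
qed

text \<open>The conditional mean of one coordinate is enough: \<open>x j * x k\<close> has the same
  mean as \<open>x j\<close> times the regression of \<open>x k\<close> on \<open>x l\<close>, and
  the latter mean is a multiple of \<open>\<Sigma> j l\<close>.\<close>

lemma cond_indep_pcov:
  assumes "j < d" "k < d" "l < d" and ci: "cond_indep M (\<lambda>x. x j) (\<lambda>x. x k) (\<lambda>x. x l)"
  shows "pcov l j k = 0"
proof -
  have "(LINT x|M. x j * x k) = (LINT x|M. x j * (\<Sigma> k l / \<Sigma> l l * x l))"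
  proof (rule cond_indep_expectation[OF ci _ _ _ _ _ real_cond_exp_coord[OF assms(2,3)]])
    show "integrable M (\<lambda>x. x j * x k)"
      using integrable_lin_mult[of "unit j" "unit k"] assms by (simp add: lin_unit)
    show "integrable M (\<lambda>x. x j * (\<Sigma> k l / \<Sigma> l l * x l))"
      using integrable_mult_right[OF integrable_lin_mult[of "unit j" "unit l"], of "\<Sigma> k l / \<Sigma> l l"] assms
      by (simp add: lin_unit mult_ac)
    show "integrable M (\<lambda>x. x k)"
      using integrable_lin_self[of "unit k"] assms by (simp add: coord_eq)
    show "integrable M (\<lambda>x. \<Sigma> k l / \<Sigma> l l * x l)"
      using integrable_mult_right[OF integrable_lin_self[of "unit l"]] assms by (simp only: lin_unit)
  qed (use assms coord_measurable in auto)
  also have "\<dots> = \<Sigma> k l / \<Sigma> l l * (LINT x|M. x j * x l)" by (simp add: mult_ac flip: integral_mult_right_zero)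
  finally show ?thesis
    using expectation_lin_mult[of "unit j" "unit k"] expectation_lin_mult[of "unit j" "unit l"] assms
    by (simp add: pcov_def lin_unit bil_unit mult_ac)
qed

end

subsection \<open>Concentration of the sample partial correlation\<close>

definition savg :: "nat \<Rightarrow> nat \<Rightarrow> (nat \<Rightarrow> nat \<Rightarrow> real) \<Rightarrow> (nat \<Rightarrow> real) \<Rightarrow> (nat \<Rightarrow> real) \<Rightarrow> real" where
  "savg d n s u v = (1 / real n) * (\<Sum>i<n. lin d u (s i) * lin d v (s i))"

text \<open>Tilting the standard normal density by the exponential of a square gives a multiple of a
  centred normal density, with variance \<open>1 / (1 - 2 * c)\<close>.\<close>

lemma exp_square_normal_density:
  assumes "2 * c < 1"
  shows "exp (c * x\<^sup>2) * std_normal_density x = normal_density 0 (1 / sqrt (1 - 2 * c)) x / sqrt (1 - 2 * c)"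
proof -
  have a: "0 < 1 - 2 * c" using assms by simp
  have "exp (c * x\<^sup>2) * exp (- x\<^sup>2 / 2) = exp (- x\<^sup>2 / (2 * (1 / sqrt (1 - 2 * c))\<^sup>2))"
    using a by (simp add: power_divide field_simps flip: exp_add)
  moreover have "sqrt (2 * pi * (1 / sqrt (1 - 2 * c))\<^sup>2) * sqrt (1 - 2 * c) = sqrt (2 * pi)"
    using a by (simp add: real_sqrt_mult real_sqrt_divide power_divide)
  ultimately show ?thesis
    using a by (simp add: normal_density_def field_simps)
qed

text \<open>From \<open>ln (1 + x) \<ge> x - 2 * x^2\<close> at \<open>x = - 2 * u\<close>, where
  \<open>\<bar>x\<bar> \<le> 1 / 2\<close>. Taking the square root halves the exponent and turns
  \<open>8 * u^2\<close> into \<open>4 * u^2\<close>.\<close>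

lemma centered_chi_square_mgf:
  fixes u :: real
  assumes "\<bar>u\<bar> \<le> 1 / 4"
  shows "exp (- u) / sqrt (1 - 2 * u) \<le> exp (4 * u\<^sup>2)"
proof -
  have "\<bar>ln (1 + (- (2 * u))) - (- (2 * u))\<bar> \<le> 2 * (- (2 * u))\<^sup>2"
    using assms by (intro abs_ln_one_plus_x_minus_x_bound) simp
  then have l: "- (2 * u) - 8 * u\<^sup>2 \<le> ln (1 - 2 * u)"
    by (simp add: power_mult_distrib abs_le_iff)
  have pos: "0 < 1 - 2 * u" using assms by simp
  have "exp (- (2 * u) - 8 * u\<^sup>2) \<le> 1 - 2 * u" using l pos by (simp add: ln_ge_iff)
  then have "sqrt (exp (- (2 * u) - 8 * u\<^sup>2)) \<le> sqrt (1 - 2 * u)" by simp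
  moreover have "sqrt (exp (- (2 * u) - 8 * u\<^sup>2)) = exp (- u - 4 * u\<^sup>2)"
    by (rule real_sqrt_unique) (simp_all flip: exp_double)
  ultimately have "exp (4 * u\<^sup>2) * exp (- u - 4 * u\<^sup>2) \<le> exp (4 * u\<^sup>2) * sqrt (1 - 2 * u)"
    by simp
  then have "exp (- u) \<le> exp (4 * u\<^sup>2) * sqrt (1 - 2 * u)" by (simp flip: exp_add)
  then show ?thesis using pos by (simp add: field_simps)
qed

lemma sample_cov_eq_savg: "j < d \<Longrightarrow> k < d \<Longrightarrow> sample_cov n s j k = savg d n s (unit j) (unit k)"
  by (simp add: sample_cov_def savg_def lin_unit)

lemma savg_commute: "savg d n s u v = savg d n s v u"
  by (simp add: savg_def mult.commute)

lemma savg_combine: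
  "savg d n s (\<lambda>i. a * u i + b * v i) w = a * savg d n s u w + b * savg d n s v w"
  by (simp add: savg_def lin_combine sum.distrib sum_distrib_left algebra_simps)

lemma savg_combine_right:
  "savg d n s w (\<lambda>i. a * u i + b * v i) = a * savg d n s w u + b * savg d n s w v"
  by (simp add: savg_commute[of d n s w] savg_combine)

lemma savg_polarize:
  "savg d n s u v = (savg d n s (\<lambda>i. u i + v i) (\<lambda>i. u i + v i) - savg d n s (\<lambda>i. u i - v i) (\<lambda>i. u i - v i)) / 4"
  using savg_combine[of d n s 1 u 1 v] savg_combine_right[of d n s _ 1 u 1 v]
    savg_combine[of d n s 1 u "-1" v] savg_combine_right[of d n s _ 1 u "-1" v]
  by (simp add: savg_commute[of d n s v u])

text \<open>Each correction term such as \<open>Suw * Svw / Sww\<close> is at most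
  \<open>t * (1 / 5) / (4 / 5) = t / 4\<close>. So the numerator is at most
  \<open>5 / 4 * t\<close>, and both factors under the root are at least
  \<open>1 - 1 / 5 - 1 / 20 = 3 / 4\<close>.\<close>

lemma quotient_small:
  fixes t :: real
  assumes t: "0 < t" "t \<le> 1 / 5" and uv: "\<bar>Suv\<bar> < t" and uw: "\<bar>Suw\<bar> < t" and vw: "\<bar>Svw\<bar> < t"
    and uu: "\<bar>Suu - 1\<bar> < t" and vv: "\<bar>Svv - 1\<bar> < t" and ww: "\<bar>Sww - 1\<bar> < t"
  shows "\<bar>Suv - Suw * Svw / Sww\<bar> / sqrt ((Suu - Suw * Suw / Sww) * (Svv - Svw * Svw / Sww)) < 5 * t"
proof -
  have W: "Sww \<ge> 4 / 5" using ww t by linarith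
  have sm: "\<bar>a * b / Sww\<bar> \<le> t / 4" if "\<bar>a\<bar> < t" "\<bar>b\<bar> < t" for a b
  proof -
    have "\<bar>a\<bar> * \<bar>b\<bar> \<le> t * (1 / 5)" using that t by (intro mult_mono) auto
    then have "\<bar>a * b\<bar> \<le> t * (1 / 5)" by (simp add: abs_mult)
    moreover have "t * (1 / 5) \<le> t / 4 * Sww" using mult_left_mono[OF W, of "t / 4"] t by simp
    ultimately show ?thesis using W by (simp add: abs_divide pos_divide_le_eq)
  qed
  have N: "\<bar>Suv - Suw * Svw / Sww\<bar> \<le> 5 / 4 * t" using sm[OF uw vw] uv by linarith
  have "Suu - Suw * Suw / Sww \<ge> 3 / 4" "Svv - Svw * Svw / Sww \<ge> 3 / 4"
    using sm[OF uw uw] sm[OF vw vw] uu vv t by linarith+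
  then have "(3 / 4) * (3 / 4) \<le> (Suu - Suw * Suw / Sww) * (Svv - Svw * Svw / Sww)"
    by (intro mult_mono) auto
  then have D: "3 / 4 \<le> sqrt ((Suu - Suw * Suw / Sww) * (Svv - Svw * Svw / Sww))"
    by (intro real_le_rsqrt) (simp add: power2_eq_square)
  have "5 / 4 * t < 5 * t * (3 / 4)" using t by simp
  also have "\<dots> \<le> 5 * t * sqrt ((Suu - Suw * Suw / Sww) * (Svv - Svw * Svw / Sww))"
    using D t by (intro mult_left_mono) auto
  finally have "5 / 4 * t < 5 * t * sqrt ((Suu - Suw * Suw / Sww) * (Svv - Svw * Svw / Sww))" .
  then show ?thesis using N D by (subst pos_divide_less_eq) linarith+
qed

text \<open>With the same correction terms the numerator is at least
  \<open>10 * t - t - t / 4 \<ge> 8 * t\<close> and the root at most \<open>5 / 4\<close>. The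
  factor 10 between signal and precision is what lets the threshold \<open>5 * t\<close> separate
  this case from an uncorrelated pair.\<close>

lemma quotient_large:
  fixes t :: real
  assumes t: "0 < t" "t \<le> 1 / 10" and \<rho>: "10 * t \<le> \<bar>\<rho>\<bar>" and uv: "\<bar>Suv - \<rho>\<bar> < t"
    and uw: "\<bar>Suw\<bar> < t" and vw: "\<bar>Svw\<bar> < t"
    and uu: "\<bar>Suu - 1\<bar> < t" and vv: "\<bar>Svv - 1\<bar> < t" and ww: "\<bar>Sww - 1\<bar> < t"
  shows "\<bar>Suv - Suw * Svw / Sww\<bar> / sqrt ((Suu - Suw * Suw / Sww) * (Svv - Svw * Svw / Sww)) \<ge> 5 * t"
proof -
  have W: "Sww \<ge> 4 / 5" using ww t by linarith
  have sm: "\<bar>a * b / Sww\<bar> \<le> t / 4" if "\<bar>a\<bar> < t" "\<bar>b\<bar> < t" for a b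
  proof -
    have "\<bar>a\<bar> * \<bar>b\<bar> \<le> t * (1 / 5)" using that t by (intro mult_mono) auto
    then have "\<bar>a * b\<bar> \<le> t * (1 / 5)" by (simp add: abs_mult)
    moreover have "t * (1 / 5) \<le> t / 4 * Sww" using mult_left_mono[OF W, of "t / 4"] t by simp
    ultimately show ?thesis using W by (simp add: abs_divide pos_divide_le_eq)
  qed
  have N: "8 * t \<le> \<bar>Suv - Suw * Svw / Sww\<bar>" using sm[OF uw vw] uv \<rho> by linarith
  have *: "Suu - Suw * Suw / Sww > 0" "Svv - Svw * Svw / Sww > 0"
    "Suu - Suw * Suw / Sww \<le> 5 / 4" "Svv - Svw * Svw / Sww \<le> 5 / 4"
    using sm[OF uw uw] sm[OF vw vw] uu vv t by linarith+
  then have "(Suu - Suw * Suw / Sww) * (Svv - Svw * Svw / Sww) \<le> (5 / 4) * (5 / 4)"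
    by (intro mult_mono) auto
  then have D: "sqrt ((Suu - Suw * Suw / Sww) * (Svv - Svw * Svw / Sww)) \<le> 5 / 4"
    by (intro real_le_lsqrt) (simp_all add: power2_eq_square)
  have D0: "sqrt ((Suu - Suw * Suw / Sww) * (Svv - Svw * Svw / Sww)) > 0"
    using * by simp
  have "5 * t * sqrt ((Suu - Suw * Suw / Sww) * (Svv - Svw * Svw / Sww)) \<le> 5 * t * (5 / 4)"
    using D t by (intro mult_left_mono) auto
  also have "\<dots> \<le> 8 * t" using t by simp
  finally show ?thesis using N D0 by (subst pos_le_divide_eq) linarith+
qed

section \<open>Deviations of sample averages\<close>

context gaussian_law
begin

lemma product_prob_space_M: "product_prob_space (\<lambda>i::nat. M)"
  by (intro product_prob_spaceI) (rule prob_space_axioms)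

lemma prob_space_iid: "prob_space (iid_samples n M)"
  unfolding iid_samples_def by (intro prob_space_PiM) (rule prob_space_axioms)

lemma lin_iid_measurable [measurable]: "i < n \<Longrightarrow> (\<lambda>s. lin d v (s i)) \<in> borel_measurable (iid_samples n M)"
  unfolding iid_samples_def
  using measurable_compose[OF measurable_component_singleton[of i "{..<n}" "\<lambda>_. M"] lin_measurable_M[of v]] by simp

lemma savg_measurable [measurable]: "(\<lambda>s. savg d n s u v) \<in> borel_measurable (iid_samples n M)"
  unfolding savg_def by (intro borel_measurable_times borel_measurable_sum lin_iid_measurable) auto

lemma exp_square_lin:
  assumes "2 * (c * bil d \<Sigma> v v) < 1"
  shows "(\<integral>\<^sup>+ x. ennreal (exp (c * (lin d v x)\<^sup>2)) \<partial>M) = ennreal (1 / sqrt (1 - 2 * (c * bil d \<Sigma> v v)))"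
proof -
  let ?c = "c * bil d \<Sigma> v v"
  have "(\<integral>\<^sup>+ x. ennreal (exp (c * (lin d v x)\<^sup>2)) \<partial>M) =
      (\<integral>\<^sup>+ x. ennreal (exp (?c * x\<^sup>2)) \<partial>std_normal_distribution)"
    using nn_integral_lin[of "\<lambda>x. ennreal (exp (c * x\<^sup>2))" v]
    by (simp add: power_mult_distrib bil_nonneg mult.assoc)
  also have "\<dots> = (\<integral>\<^sup>+ x. ennreal (1 / sqrt (1 - 2 * ?c)) * ennreal (normal_density 0 (1 / sqrt (1 - 2 * ?c)) x) \<partial>lborel)"
    using assms exp_square_normal_density[OF assms]
    by (subst nn_integral_density) (simp_all add: mult.commute flip: ennreal_mult'')
  also have "\<dots> = ennreal (1 / sqrt (1 - 2 * ?c))"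
  proof -
    interpret N: prob_space "density lborel (normal_density 0 (1 / sqrt (1 - 2 * ?c)))"
      using assms by (intro prob_space_normal_density) simp
    have "(\<integral>\<^sup>+ x. ennreal (normal_density 0 (1 / sqrt (1 - 2 * ?c)) x) \<partial>lborel) = 1"
      using N.emeasure_space_1 by (simp add: emeasure_density)
    then show ?thesis by (simp add: nn_integral_cmult)
  qed
  finally show ?thesis .
qed

text \<open>Chernoff's method for the squares, with both directions covered by the sign
  \<open>\<sigma>\<close>. Variances up to 4 are allowed because the bound will be applied to sums
  and differences of two functionals of variance at most 1.\<close>

lemma square_deviation_one_sided:
  assumes q: "bil d \<Sigma> v v \<le> 4" and t: "0 < t" "t \<le> 4" and n: "0 < n" and \<sigma>: "\<bar>\<sigma>\<bar> = 1"
  shows "measure (iid_samples n M) {s \<in> space (iid_samples n M). \<sigma> * (savg d n s v v - bil d \<Sigma> v v) \<ge> t}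
    \<le> exp (- (real n * t\<^sup>2 / 256))"
proof -
  let ?P = "iid_samples n M" and ?q = "bil d \<Sigma> v v"
  interpret P: prob_space ?P by (rule prob_space_iid)
  interpret PP: product_prob_space "\<lambda>i::nat. M" by (rule product_prob_space_M)
  \<comment> \<open>Minimizes the exponent \<open>- \<theta> * t + 64 * \<theta>^2\<close>, with
    value \<open>- t^2 / 256\<close>. The condition \<open>t \<le> 4\<close> keeps \<open>c\<close>
    times the variance within \<open>1 / 8\<close>, inside the range of the moment bound.\<close>
  define \<theta> where "\<theta> = t / 128"
  define c where "c = \<theta> * \<sigma>"
  have c_abs: "\<bar>c\<bar> = \<theta>" using \<sigma> t by (simp add: c_def \<theta>_def abs_mult)
  have "\<theta> * \<bar>?q\<bar> \<le> \<theta> * 4" using q bil_nonneg[of v] t by (intro mult_left_mono) (auto simp: \<theta>_def)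
  then have cq: "\<bar>c * ?q\<bar> \<le> 4 * \<theta>" using c_abs by (simp add: abs_mult)
  then have cq': "\<bar>c * ?q\<bar> \<le> 1 / 8" using t by (simp add: \<theta>_def)
  have one: "(\<integral>\<^sup>+ x. ennreal (exp (c * ((lin d v x)\<^sup>2 - ?q) - \<theta> * t)) \<partial>M) \<le> ennreal (exp (- (t\<^sup>2 / 256)))"
  proof -
    have "(\<integral>\<^sup>+ x. ennreal (exp (c * ((lin d v x)\<^sup>2 - ?q) - \<theta> * t)) \<partial>M) =
        (\<integral>\<^sup>+ x. ennreal (exp (- (c * ?q) - \<theta> * t)) * ennreal (exp (c * (lin d v x)\<^sup>2)) \<partial>M)"
      by (intro nn_integral_cong) (simp add: algebra_simps flip: ennreal_mult'' exp_add)
    also have "\<dots> = ennreal (exp (- (c * ?q) - \<theta> * t)) * ennreal (1 / sqrt (1 - 2 * (c * ?q)))"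
      using cq' by (subst nn_integral_cmult) (auto simp: exp_square_lin)
    also have "\<dots> = ennreal (exp (- \<theta> * t) * (exp (- (c * ?q)) / sqrt (1 - 2 * (c * ?q))))"
      using cq' by (simp add: exp_diff exp_minus field_simps flip: ennreal_mult'')
    also have "\<dots> \<le> ennreal (exp (- (t\<^sup>2 / 256)))"
    proof (rule ennreal_leI)
      have "exp (- (c * ?q)) / sqrt (1 - 2 * (c * ?q)) \<le> exp (4 * (c * ?q)\<^sup>2)"
        using cq' by (intro centered_chi_square_mgf) simp
      also have "\<dots> \<le> exp (4 * (4 * \<theta>)\<^sup>2)"
        using power_mono[OF cq, of 2] by simp
      finally have "exp (- \<theta> * t) * (exp (- (c * ?q)) / sqrt (1 - 2 * (c * ?q))) \<le>
          exp (- \<theta> * t) * exp (4 * (4 * \<theta>)\<^sup>2)" by (intro mult_left_mono) auto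
      also have "\<dots> = exp (- (t\<^sup>2 / 256))"
        by (simp add: \<theta>_def power2_eq_square field_simps flip: exp_add)
      finally show "exp (- \<theta> * t) * (exp (- (c * ?q)) / sqrt (1 - 2 * (c * ?q))) \<le> exp (- (t\<^sup>2 / 256))" .
    qed
    finally show ?thesis .
  qed
  let ?E = "{s \<in> space ?P. \<sigma> * (savg d n s v v - ?q) \<ge> t}"
  have "emeasure ?P ?E = (\<integral>\<^sup>+ s. indicator ?E s \<partial>?P)"
    by (subst nn_integral_indicator) auto
  also have "\<dots> \<le> (\<integral>\<^sup>+ s. (\<Prod>i<n. ennreal (exp (c * ((lin d v (s i))\<^sup>2 - ?q) - \<theta> * t))) \<partial>?P)"
  proof (rule nn_integral_mono)
    fix s assume "s \<in> space ?P"
    show "indicator ?E s \<le> (\<Prod>i<n. ennreal (exp (c * ((lin d v (s i))\<^sup>2 - ?q) - \<theta> * t)))"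
    proof (cases "s \<in> ?E")
      case True
      have "(\<Sum>i<n. c * ((lin d v (s i))\<^sup>2 - ?q) - \<theta> * t) =
          real n * \<theta> * (\<sigma> * (savg d n s v v - ?q) - t)"
        using n by (simp add: savg_def c_def sum_subtractf sum_distrib_left power2_eq_square field_simps)
      also have "\<dots> \<ge> 0" using True t by (simp add: \<theta>_def)
      finally have "1 \<le> exp (\<Sum>i<n. c * ((lin d v (s i))\<^sup>2 - ?q) - \<theta> * t)" by simp
      then show ?thesis using True by (simp add: prod_ennreal exp_sum)
    qed simp
  qed
  also have "\<dots> = (\<Prod>i<n. \<integral>\<^sup>+ x. ennreal (exp (c * ((lin d v x)\<^sup>2 - ?q) - \<theta> * t)) \<partial>M)"
    unfolding iid_samples_def
    by (rule PP.product_nn_integral_prod[where f = "\<lambda>_ x. ennreal (exp (c * ((lin d v x)\<^sup>2 - ?q) - \<theta> * t))"]) auto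
  also have "\<dots> \<le> (\<Prod>i<n. ennreal (exp (- (t\<^sup>2 / 256))))"
    unfolding prod_constant by (rule power_mono[OF one]) simp
  also have "\<dots> = ennreal (exp (- (real n * t\<^sup>2 / 256)))"
    by (simp add: ennreal_power flip: exp_of_nat_mult)
  finally show ?thesis by (simp add: P.emeasure_eq_measure)
qed

lemma square_deviation:
  assumes q: "bil d \<Sigma> v v \<le> 4" and t: "0 < t" "t \<le> 4" and n: "0 < n"
  shows "measure (iid_samples n M) {s \<in> space (iid_samples n M). \<bar>savg d n s v v - bil d \<Sigma> v v\<bar> \<ge> t}
    \<le> 2 * exp (- (real n * t\<^sup>2 / 256))"
proof -
  let ?P = "iid_samples n M"
  interpret P: prob_space ?P by (rule prob_space_iid)
  let ?E = "\<lambda>\<sigma>::real. {s \<in> space ?P. \<sigma> * (savg d n s v v - bil d \<Sigma> v v) \<ge> t}"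
  have "{s \<in> space ?P. \<bar>savg d n s v v - bil d \<Sigma> v v\<bar> \<ge> t} = ?E 1 \<union> ?E (- 1)" by auto
  then have "measure ?P {s \<in> space ?P. \<bar>savg d n s v v - bil d \<Sigma> v v\<bar> \<ge> t} \<le> measure ?P (?E 1) + measure ?P (?E (- 1))"
    using measure_Un_le[of "?E 1" ?P "?E (- 1)"] by simp
  then show ?thesis
    using square_deviation_one_sided[OF q t n, of 1] square_deviation_one_sided[OF q t n, of "- 1"] by simp
qed

text \<open>By the parallelogram identity \<open>u + v\<close> and \<open>u - v\<close> have
  variance at most 4. If the polarized average is off by \<open>t\<close>, then one of the two
  squares is off by \<open>2 * t\<close>.\<close>

lemma savg_deviation:
  assumes u: "bil d \<Sigma> u u \<le> 1" and v: "bil d \<Sigma> v v \<le> 1" and t: "0 < t" "t \<le> 2" and n: "0 < n"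
  shows "measure (iid_samples n M) {s \<in> space (iid_samples n M). \<bar>savg d n s u v - bil d \<Sigma> u v\<bar> \<ge> t}
    \<le> 4 * exp (- (real n * t\<^sup>2 / 64))"
proof -
  let ?P = "iid_samples n M"
  interpret P: prob_space ?P by (rule prob_space_iid)
  let ?p = "\<lambda>i. u i + v i" and ?m = "\<lambda>i. u i - v i"
  let ?E = "\<lambda>w. {s \<in> space ?P. \<bar>savg d n s w w - bil d \<Sigma> w w\<bar> \<ge> 2 * t}"
  have "bil d \<Sigma> ?p ?p + bil d \<Sigma> ?m ?m = 2 * (bil d \<Sigma> u u + bil d \<Sigma> v v)"
    by (simp add: bil_add bil_diff bil_commute[of v u])
  then have q: "bil d \<Sigma> ?p ?p \<le> 4" "bil d \<Sigma> ?m ?m \<le> 4"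
    using add_increasing[OF bil_nonneg[of ?m] order_refl[of "bil d \<Sigma> ?p ?p"]]
      add_increasing2[OF bil_nonneg[of ?p] order_refl[of "bil d \<Sigma> ?m ?m"]] u v
    by (simp_all add: add.commute)
  have "{s \<in> space ?P. \<bar>savg d n s u v - bil d \<Sigma> u v\<bar> \<ge> t} \<subseteq> ?E ?p \<union> ?E ?m"
  proof -
    have "2 * t \<le> \<bar>a - a'\<bar> \<or> 2 * t \<le> \<bar>b - b'\<bar>" if "t \<le> \<bar>(a - b) / 4 - (a' - b') / 4\<bar>" for a b a' b' :: real
      using that by argo
    then show ?thesis unfolding savg_polarize[of d n _ u v] bil_polarize[of u v] by blast
  qed
  then have "measure ?P {s \<in> space ?P. \<bar>savg d n s u v - bil d \<Sigma> u v\<bar> \<ge> t} \<le> measure ?P (?E ?p) + measure ?P (?E ?m)"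
    by (intro order_trans[OF P.finite_measure_mono measure_Un_le]) auto
  then show ?thesis
    using square_deviation[OF q(1), of "2 * t" n] square_deviation[OF q(2), of "2 * t" n] t n
    by (simp add: power_mult_distrib)
qed

lemma savg_all_deviation:
  assumes u: "bil d \<Sigma> u u \<le> 1" and v: "bil d \<Sigma> v v \<le> 1" and w: "bil d \<Sigma> w w \<le> 1"
    and t: "0 < t" "t \<le> 2" and n: "0 < n"
  shows "measure (iid_samples n M) {s \<in> space (iid_samples n M).
      \<exists>(a, b) \<in> {(u, u), (v, v), (w, w), (u, v), (u, w), (v, w)}. \<bar>savg d n s a b - bil d \<Sigma> a b\<bar> \<ge> t}
    \<le> 24 * exp (- (real n * t\<^sup>2 / 64))"
proof -
  let ?P = "iid_samples n M"
  interpret P: prob_space ?P by (rule prob_space_iid)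
  let ?I = "{(u, u), (v, v), (w, w), (u, v), (u, w), (v, w)}"
  let ?E = "\<lambda>(a, b). {s \<in> space ?P. \<bar>savg d n s a b - bil d \<Sigma> a b\<bar> \<ge> t}"
  have "{s \<in> space ?P. \<exists>(a, b) \<in> ?I. \<bar>savg d n s a b - bil d \<Sigma> a b\<bar> \<ge> t} = (\<Union>p\<in>?I. ?E p)" by auto
  then have "measure ?P {s \<in> space ?P. \<exists>(a, b) \<in> ?I. \<bar>savg d n s a b - bil d \<Sigma> a b\<bar> \<ge> t} \<le> (\<Sum>p\<in>?I. measure ?P (?E p))"
    by (simp only:) (rule measure_UNION_le, auto)
  also have "\<dots> \<le> (\<Sum>p\<in>?I. 4 * exp (- (real n * t\<^sup>2 / 64)))"
    by (rule sum_mono) (use savg_deviation[OF _ _ t n] u v w in auto)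
  \<comment> \<open>The set has fewer than six elements when some of the functionals coincide, so
    its size is only bounded from above.\<close>
  also have "\<dots> \<le> 6 * (4 * exp (- (real n * t\<^sup>2 / 64)))"
    unfolding sum_constant by (intro mult_right_mono) (auto simp: card_insert_if)
  finally show ?thesis by simp
qed

end

section \<open>Measurability and error probabilities of the test\<close>

lemma vec_coord_measurable: "j < d \<Longrightarrow> (\<lambda>x. x j) \<in> borel_measurable (vec_space d)"
  unfolding vec_space_def by (rule measurable_component_singleton) simp

lemma sample_cov_measurable:
  assumes "j < d" "k < d"
  shows "(\<lambda>s. sample_cov n s j k) \<in> borel_measurable (iid_samples n (vec_space d))"
proof -
  have "(\<lambda>s. s i h) \<in> borel_measurable (iid_samples n (vec_space d))" if "i < n" "h < d" for i h
    unfolding iid_samples_def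
    using measurable_compose[OF measurable_component_singleton[of i "{..<n}" "\<lambda>_. vec_space d"]
        vec_coord_measurable[of h d]] that by simp
  then show ?thesis
    unfolding sample_cov_def using assms by (intro borel_measurable_times borel_measurable_sum borel_measurable_const) auto
qed

lemma m_hat_measurable:
  assumes "j < d" "k < d" "\<And>h. l = Some h \<Longrightarrow> h < d"
  shows "(\<lambda>s. m_hat n s j k l) \<in> borel_measurable (iid_samples n (vec_space d))"
proof (cases l)
  case None
  then show ?thesis using assms sample_cov_measurable[of _ d _ n] by simp
next
  case (Some h)
  have "(\<lambda>s. sample_cond_cov n s h a b) \<in> borel_measurable (iid_samples n (vec_space d))"
    if "a < d" "b < d" for a b
    unfolding sample_cond_cov_def using that assms(3)[OF Some] sample_cov_measurable[of _ d _ n]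
    by (intro borel_measurable_diff borel_measurable_times borel_measurable_inverse) auto
  then show ?thesis using Some assms(1,2) by simp
qed

lemma psi_gauss_measurable:
  assumes "j < d" "k < d" "\<And>h. l = Some h \<Longrightarrow> h < d"
  shows "psi_gauss n c j k l \<in> borel_measurable (iid_samples n (vec_space d))"
proof -
  have [measurable]: "(\<lambda>s. m_hat n s j k l) \<in> borel_measurable (iid_samples n (vec_space d))"
    by (rule m_hat_measurable) (use assms in auto)
  show ?thesis unfolding psi_gauss_def[abs_def] by measurable
qed

lemma psi_gauss_values: "psi_gauss n c j k l s \<in> {0, 1}"
  by (simp add: psi_gauss_def)

text \<open>The sample Schur complement is an average of products of empirical residuals. If the
  sample variance of the conditioning coordinate vanishes, the coefficients \<open>b\<close> are 0
  by the convention for \<open>inverse\<close>, and the formula persists.\<close>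

lemma sample_cond_cov_residuals:
  fixes s :: "nat \<Rightarrow> nat \<Rightarrow> real" and l n :: nat
  defines "b \<equiv> \<lambda>j. sample_cov n s j l * inverse (sample_cov n s l l)"
  shows "sample_cond_cov n s l j k = (1 / real n) * (\<Sum>i<n. (s i j - b j * s i l) * (s i k - b k * s i l))"
proof -
  have "(1 / real n) * (\<Sum>i<n. (s i j - b j * s i l) * (s i k - b k * s i l)) =
      sample_cov n s j k - b k * sample_cov n s j l - b j * sample_cov n s l k + b j * b k * sample_cov n s l l"
    by (simp add: sample_cov_def sum.distrib sum_subtractf sum_distrib_left algebra_simps)
  moreover have "sample_cov n s l k = sample_cov n s k l" by (simp add: sample_cov_def mult.commute)
  moreover have "sample_cov n s j k - b k * sample_cov n s j l - b j * sample_cov n s k l + b j * b k * sample_cov n s l l =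
      sample_cov n s j k - sample_cov n s j l * inverse (sample_cov n s l l) * sample_cov n s k l"
    by (cases "sample_cov n s l l = 0") (simp_all add: b_def field_simps)
  ultimately show ?thesis by (simp only: sample_cond_cov_def)
qed

text \<open>Cauchy-Schwarz for the empirical residuals. This serves testing radii above 2, for which
  the threshold exceeds 1 and the test never rejects.\<close>

lemma m_hat_le_1: "m_hat n s j k (Some l) \<le> 1"
proof -
  define r where "r = (\<lambda>j i. s i j - sample_cov n s j l * inverse (sample_cov n s l l) * s i l)"
  have e: "sample_cond_cov n s l j k = (1 / real n) * (\<Sum>i<n. r j i * r k i)" for j k
    by (simp add: sample_cond_cov_residuals r_def)
  have "(sample_cond_cov n s l j k)\<^sup>2 = (1 / real n)\<^sup>2 * (\<Sum>i<n. r j i * r k i)\<^sup>2"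
    by (simp add: e power_divide)
  also have "\<dots> \<le> (1 / real n)\<^sup>2 * ((\<Sum>i<n. (r j i)\<^sup>2) * (\<Sum>i<n. (r k i)\<^sup>2))"
    by (intro mult_left_mono Cauchy_Schwarz_ineq_sum) simp
  also have "\<dots> = sample_cond_cov n s l j j * sample_cond_cov n s l k k"
    by (simp add: e power2_eq_square)
  finally have "\<bar>sample_cond_cov n s l j k\<bar> \<le> sqrt (sample_cond_cov n s l j j * sample_cond_cov n s l k k)"
    by (intro real_le_rsqrt) simp
  then have "\<bar>sample_cond_cov n s l j k\<bar> / sqrt (sample_cond_cov n s l j j * sample_cond_cov n s l k k) \<le> 1"
    by (intro divide_le_eq_1[THEN iffD2]) (use abs_ge_zero[of "sample_cond_cov n s l j k"] in linarith)
  then show ?thesis by simp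
qed

context gaussian_law
begin

lemma correlation_le_1:
  assumes "bil d \<Sigma> u u = 1" "bil d \<Sigma> v v = 1"
  shows "\<bar>bil d \<Sigma> u v\<bar> \<le> 1"
  using bil_nonneg[of "\<lambda>i. u i + v i"] bil_nonneg[of "\<lambda>i. u i - v i"] assms
  by (simp add: bil_add bil_diff bil_commute[of v u] abs_le_iff)

text \<open>Subtracting multiples of coordinate \<open>l\<close> does not change the sample
  conditional covariance. So the coordinates may be replaced by their residuals for the true
  regression coefficients, although the test does not know these.\<close>

lemma sample_cond_cov_resid:
  assumes j: "j < d" and k: "k < d" and l: "l < d" and nz: "savg d n s (unit l) (unit l) \<noteq> 0"
  shows "sample_cond_cov n s l j k = savg d n s (resid l j) (resid l k) -
    savg d n s (resid l j) (unit l) * savg d n s (resid l k) (unit l) / savg d n s (unit l) (unit l)"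
proof -
  have r: "savg d n s (resid l a) w = savg d n s (unit a) w - \<Sigma> a l / \<Sigma> l l * savg d n s (unit l) w"
    "savg d n s w (resid l a) = savg d n s w (unit a) - \<Sigma> a l / \<Sigma> l l * savg d n s w (unit l)" for a w
    using savg_combine[of d n s 1 "unit a" "- (\<Sigma> a l / \<Sigma> l l)" "unit l" w]
      savg_combine_right[of d n s w 1 "unit a" "- (\<Sigma> a l / \<Sigma> l l)" "unit l"]
    by (simp_all add: resid_def)
  define x where "x = \<Sigma> j l / \<Sigma> l l"
  define y where "y = \<Sigma> k l / \<Sigma> l l"
  show ?thesis
    unfolding sample_cond_cov_def sample_cov_eq_savg[OF j k] sample_cov_eq_savg[OF j l]
      sample_cov_eq_savg[OF l l] sample_cov_eq_savg[OF l k] r x_def[symmetric] y_def[symmetric]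
      savg_commute[of d n s "unit k" "unit l"] savg_commute[of d n s "unit l" "unit j"]
    using nz by (simp add: field_simps)
qed

definition all_close :: "nat \<Rightarrow> real \<Rightarrow> (nat \<Rightarrow> nat \<Rightarrow> real) \<Rightarrow>
    (nat \<Rightarrow> real) \<Rightarrow> (nat \<Rightarrow> real) \<Rightarrow> (nat \<Rightarrow> real) \<Rightarrow> bool" where
  "all_close n t s u v w \<longleftrightarrow> (\<forall>(a, b) \<in> {(u, u), (v, v), (w, w), (u, v), (u, w), (v, w)}.
     \<bar>savg d n s a b - bil d \<Sigma> a b\<bar> < t)"

text \<open>The existential puts tests with and without conditioning into one format: for
  \<open>None\<close> the correction terms are \<open>0, 0, 1\<close>, and for \<open>Some\<close>
  they are sample averages involving the normalized conditioning coordinate \<open>w\<close>. In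
  both cases \<open>u\<close> and \<open>v\<close> have unit variance, and their covariance is the
  population value up to sign.\<close>

definition normalizes ::
    "nat \<Rightarrow> nat \<Rightarrow> nat option \<Rightarrow> (nat \<Rightarrow> real) \<Rightarrow> (nat \<Rightarrow> real) \<Rightarrow> (nat \<Rightarrow> real) \<Rightarrow> bool" where
  "normalizes j k l u v w \<longleftrightarrow> bil d \<Sigma> u u = 1 \<and> bil d \<Sigma> v v = 1 \<and> bil d \<Sigma> w w = 1 \<and>
    m_gauss M j k l = \<bar>bil d \<Sigma> u v\<bar> \<and>
    (\<forall>n s t. t \<le> 1 / 5 \<longrightarrow> all_close n t s u v w \<longrightarrow>
      (\<exists>Suw Svw Sww. \<bar>Suw\<bar> < t \<and> \<bar>Svw\<bar> < t \<and> \<bar>Sww - 1\<bar> < t \<and>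
        m_hat n s j k l = \<bar>savg d n s u v - Suw * Svw / Sww\<bar> /
          sqrt ((savg d n s u u - Suw * Suw / Sww) * (savg d n s v v - Svw * Svw / Sww))))"

lemma savg_all_close:
  assumes "bil d \<Sigma> u u \<le> 1" "bil d \<Sigma> v v \<le> 1" "bil d \<Sigma> w w \<le> 1" "0 < t" "t \<le> 2" "0 < n"
  shows "measure (iid_samples n M) {s \<in> space (iid_samples n M). \<not> all_close n t s u v w}
    \<le> 24 * exp (- (real n * t\<^sup>2 / 64))"
proof -
  have "{s \<in> space (iid_samples n M). \<not> all_close n t s u v w} = {s \<in> space (iid_samples n M).
      \<exists>(a, b) \<in> {(u, u), (v, v), (w, w), (u, v), (u, w), (v, w)}. \<bar>savg d n s a b - bil d \<Sigma> a b\<bar> \<ge> t}"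
    by (auto simp: all_close_def not_less)
  then show ?thesis using savg_all_deviation[OF assms] by (simp only:)
qed

lemma normalizing_triple:
  assumes j: "j < d" and k: "k < d" and jk: "j \<noteq> k" and l: "l \<in> cond_choices d j k"
  shows "\<exists>u v w. normalizes j k l u v w"
proof (cases l)
  case None
  define \<sigma> where "\<sigma> = sqrt (\<Sigma> j j)"
  define \<tau> where "\<tau> = sqrt (\<Sigma> k k)"
  have pos: "\<sigma> > 0" "\<tau> > 0" "\<sigma>\<^sup>2 = \<Sigma> j j" "\<tau>\<^sup>2 = \<Sigma> k k"
    using Sigma_diag_pos[OF j] Sigma_diag_pos[OF k] by (auto simp: \<sigma>_def \<tau>_def)
  define u where "u = (\<lambda>i. (1 / \<sigma>) * unit j i)"
  define v where "v = (\<lambda>i. (1 / \<tau>) * unit k i)"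
  have ju: "unit j = (\<lambda>i. \<sigma> * u i + 0 * u i)" and kv: "unit k = (\<lambda>i. \<tau> * v i + 0 * v i)"
    using pos by (auto simp: u_def v_def)
  have b: "bil d \<Sigma> u u = 1" "bil d \<Sigma> v v = 1" "bil d \<Sigma> u v = \<Sigma> j k / (\<sigma> * \<tau>)"
    unfolding u_def v_def bil_scale using pos j k Sigma_diag_pos[OF j] Sigma_diag_pos[OF k]
    by (simp_all add: bil_unit power2_eq_square)
  have m: "m_gauss M j k l = \<bar>bil d \<Sigma> u v\<bar>"
    using pos j k by (simp add: None m_gauss_None b abs_divide real_sqrt_mult \<sigma>_def \<tau>_def del: m_gauss.simps)
  have mh: "m_hat n s j k l = \<bar>savg d n s u v\<bar> / sqrt (savg d n s u u * savg d n s v v)" for n s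
  proof -
    have "savg d n s (unit j) (unit k) = \<sigma> * \<tau> * savg d n s u v"
      "savg d n s (unit j) (unit j) = \<sigma>\<^sup>2 * savg d n s u u" "savg d n s (unit k) (unit k) = \<tau>\<^sup>2 * savg d n s v v"
      unfolding ju kv savg_combine savg_combine_right by (simp_all add: power2_eq_square)
    then show ?thesis using pos(1,2)
      by (simp add: None sample_cov_eq_savg[OF j k] sample_cov_eq_savg[OF j j] sample_cov_eq_savg[OF k k]
          abs_mult real_sqrt_mult)
  qed
  have "\<exists>Suw Svw Sww. \<bar>Suw\<bar> < t \<and> \<bar>Svw\<bar> < t \<and> \<bar>Sww - 1\<bar> < t \<and>
        m_hat n s j k l = \<bar>savg d n s u v - Suw * Svw / Sww\<bar> /
          sqrt ((savg d n s u u - Suw * Suw / Sww) * (savg d n s v v - Svw * Svw / Sww))"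
    if "all_close n t s u v u"
    for n s t
  proof -
    have "\<bar>savg d n s u u - bil d \<Sigma> u u\<bar> < t" using that by (auto simp: all_close_def)
    then have "0 < t" by linarith
    show ?thesis
      by (rule exI[of _ 0], rule exI[of _ 0], rule exI[of _ 1]) (simp add: mh \<open>0 < t\<close>)
  qed
  note hat = this
  show ?thesis unfolding normalizes_def
    by (rule exI[of _ u], rule exI[of _ v], rule exI[of _ u], intro conjI allI impI) (rule b m hat, assumption?)+
next
  case (Some h)
  then have h: "h < d" "h \<noteq> j" "h \<noteq> k" using l by (auto simp: cond_choices_def)
  define \<sigma> where "\<sigma> = sqrt (pcov h j j)"
  define \<tau> where "\<tau> = sqrt (pcov h k k)"
  define \<zeta> where "\<zeta> = sqrt (\<Sigma> h h)"
  have pos: "\<sigma> > 0" "\<tau> > 0" "\<zeta> > 0" "\<sigma>\<^sup>2 = pcov h j j" "\<tau>\<^sup>2 = pcov h k k" "\<zeta>\<^sup>2 = \<Sigma> h h"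
    using pcov_pos[OF j h(1)] pcov_pos[OF k h(1)] Sigma_diag_pos[OF h(1)] h(2,3)
    by (auto simp: \<sigma>_def \<tau>_def \<zeta>_def)
  define u where "u = (\<lambda>i. (1 / \<sigma>) * resid h j i)"
  define v where "v = (\<lambda>i. (1 / \<tau>) * resid h k i)"
  define w where "w = (\<lambda>i. (1 / \<zeta>) * unit h i)"
  have ju: "resid h j = (\<lambda>i. \<sigma> * u i + 0 * u i)" and kv: "resid h k = (\<lambda>i. \<tau> * v i + 0 * v i)"
    and hw: "unit h = (\<lambda>i. \<zeta> * w i + 0 * w i)"
    using pos by (auto simp: u_def v_def w_def)
  have b: "bil d \<Sigma> u u = 1" "bil d \<Sigma> v v = 1" "bil d \<Sigma> w w = 1" "bil d \<Sigma> u v = pcov h j k / (\<sigma> * \<tau>)"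
    "bil d \<Sigma> u w = 0" "bil d \<Sigma> v w = 0"
    unfolding u_def v_def w_def bil_scale
    using pos j k h pcov_pos[OF j h(1)] pcov_pos[OF k h(1)] Sigma_diag_pos[OF h(1)]
    by (simp_all add: bil_unit bil_resid_resid bil_resid_unit power2_eq_square)
  have m: "m_gauss M j k l = \<bar>bil d \<Sigma> u v\<bar>"
    using pos j k h by (simp add: Some m_gauss_Some b abs_divide real_sqrt_mult \<sigma>_def \<tau>_def del: m_gauss.simps)
  have mh: "m_hat n s j k l = \<bar>savg d n s u v - savg d n s u w * savg d n s v w / savg d n s w w\<bar> /
      sqrt ((savg d n s u u - savg d n s u w * savg d n s u w / savg d n s w w) *
        (savg d n s v v - savg d n s v w * savg d n s v w / savg d n s w w))"
    if nz: "savg d n s w w \<noteq> 0" for n s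
  proof -
    have sc: "savg d n s (resid h j) (resid h k) = \<sigma> * \<tau> * savg d n s u v"
      "savg d n s (resid h j) (resid h j) = \<sigma>\<^sup>2 * savg d n s u u"
      "savg d n s (resid h k) (resid h k) = \<tau>\<^sup>2 * savg d n s v v"
      "savg d n s (resid h j) (unit h) = \<sigma> * \<zeta> * savg d n s u w"
      "savg d n s (resid h k) (unit h) = \<tau> * \<zeta> * savg d n s v w"
      "savg d n s (unit h) (unit h) = \<zeta>\<^sup>2 * savg d n s w w"
      unfolding ju kv hw savg_combine savg_combine_right by (simp_all add: power2_eq_square)
    have nz': "savg d n s (unit h) (unit h) \<noteq> 0" using nz pos(3) by (simp add: sc)
    have "sample_cond_cov n s h j k = \<sigma> * \<tau> * (savg d n s u v - savg d n s u w * savg d n s v w / savg d n s w w)"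
      "sample_cond_cov n s h j j = \<sigma>\<^sup>2 * (savg d n s u u - savg d n s u w * savg d n s u w / savg d n s w w)"
      "sample_cond_cov n s h k k = \<tau>\<^sup>2 * (savg d n s v v - savg d n s v w * savg d n s v w / savg d n s w w)"
      unfolding sample_cond_cov_resid[OF j k h(1) nz'] sample_cond_cov_resid[OF j j h(1) nz']
        sample_cond_cov_resid[OF k k h(1) nz'] sc
      using nz pos(3) by (simp_all add: field_simps power2_eq_square)
    then show ?thesis using pos(1,2)
      by (simp add: Some abs_mult real_sqrt_mult)
  qed
  have "\<exists>Suw Svw Sww. \<bar>Suw\<bar> < t \<and> \<bar>Svw\<bar> < t \<and> \<bar>Sww - 1\<bar> < t \<and>
        m_hat n s j k l = \<bar>savg d n s u v - Suw * Svw / Sww\<bar> /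
          sqrt ((savg d n s u u - Suw * Suw / Sww) * (savg d n s v v - Svw * Svw / Sww))"
    if t: "t \<le> 1 / 5"
      and dev: "all_close n t s u v w"
    for n s t
  proof -
    have *: "\<bar>savg d n s u w\<bar> < t" "\<bar>savg d n s v w\<bar> < t" "\<bar>savg d n s w w - 1\<bar> < t"
      using dev b by (auto simp: all_close_def)
    then have "savg d n s w w \<noteq> 0" using t by auto
    from mh[OF this] * show ?thesis by blast
  qed
  note hat = this
  show ?thesis unfolding normalizes_def
    by (rule exI[of _ u], rule exI[of _ v], rule exI[of _ w], intro conjI allI impI) (rule b m hat, assumption?)+
qed

lemma m_gauss_le_1:
  assumes "j < d" "k < d" "j \<noteq> k" "l \<in> cond_choices d j k"
  shows "m_gauss M j k l \<le> 1"
  using normalizing_triple[OF assms] correlation_le_1 by (fastforce simp: normalizes_def)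

lemma psi_gauss_null_error:
  assumes jk: "j < d" "k < d" "j \<noteq> k" "l \<in> cond_choices d j k"
    and c: "0 < c" "c \<le> 2" and n: "0 < n" and null: "m_gauss M j k l = 0"
  shows "measure (iid_samples n M) {s \<in> space (iid_samples n M). psi_gauss n c j k l s = 1}
    \<le> 24 * exp (- (real n * c\<^sup>2 / 6400))"
proof -
  let ?P = "iid_samples n M"
  interpret P: prob_space ?P by (rule prob_space_iid)
  obtain u v w where uvw: "normalizes j k l u v w"
    using normalizing_triple[OF jk] by blast
  then have b: "bil d \<Sigma> u u = 1" "bil d \<Sigma> v v = 1" "bil d \<Sigma> w w = 1" "m_gauss M j k l = \<bar>bil d \<Sigma> u v\<bar>"
    by (simp_all add: normalizes_def)
  \<comment> \<open>The threshold \<open>c / 2\<close> is then \<open>5 * t\<close>, and the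
    exponent \<open>t^2 / 64\<close> becomes \<open>c^2 / 6400\<close>.\<close>
  define t where "t = c / 10"
  have t: "0 < t" "t \<le> 1 / 5" using c by (simp_all add: t_def)
  have uv: "bil d \<Sigma> u v = 0" using b null by simp
  let ?B = "{s \<in> space ?P. \<not> all_close n t s u v w}"
  have "{s \<in> space ?P. psi_gauss n c j k l s = 1} \<subseteq> ?B"
  proof (rule subsetI, rule ccontr)
    fix s assume s: "s \<in> {s \<in> space ?P. psi_gauss n c j k l s = 1}" and "s \<notin> ?B"
    then have dev: "all_close n t s u v w" by auto
    with uvw t obtain Suw Svw Sww where S: "\<bar>Suw\<bar> < t" "\<bar>Svw\<bar> < t" "\<bar>Sww - 1\<bar> < t"
      "m_hat n s j k l = \<bar>savg d n s u v - Suw * Svw / Sww\<bar> /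
          sqrt ((savg d n s u u - Suw * Suw / Sww) * (savg d n s v v - Svw * Svw / Sww))"
      unfolding normalizes_def by blast
    have "\<bar>savg d n s u v\<bar> < t" "\<bar>savg d n s u u - 1\<bar> < t" "\<bar>savg d n s v v - 1\<bar> < t"
      using dev b uv by (auto simp: all_close_def)
    then have "m_hat n s j k l < 5 * t"
      unfolding S(4) by (intro quotient_small t S(1-3))
    then show False using s by (simp add: psi_gauss_def t_def split: if_splits)
  qed
  moreover have "?B \<in> sets ?P" unfolding all_close_def by measurable
  ultimately have "measure ?P {s \<in> space ?P. psi_gauss n c j k l s = 1} \<le> measure ?P ?B"
    by (intro P.finite_measure_mono)
  also have "\<dots> \<le> 24 * exp (- (real n * t\<^sup>2 / 64))"
    using b t n by (intro savg_all_close) auto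
  finally show ?thesis by (simp add: t_def power_divide)
qed

lemma psi_gauss_alt_error:
  assumes jk: "j < d" "k < d" "j \<noteq> k" "l \<in> cond_choices d j k"
    and c: "0 < c" and n: "0 < n" and alt: "m_gauss M j k l \<ge> c"
  shows "measure (iid_samples n M) {s \<in> space (iid_samples n M). psi_gauss n c j k l s = 0}
    \<le> 24 * exp (- (real n * c\<^sup>2 / 6400))"
proof -
  let ?P = "iid_samples n M"
  interpret P: prob_space ?P by (rule prob_space_iid)
  obtain u v w where uvw: "normalizes j k l u v w"
    using normalizing_triple[OF jk] by blast
  then have b: "bil d \<Sigma> u u = 1" "bil d \<Sigma> v v = 1" "bil d \<Sigma> w w = 1" "m_gauss M j k l = \<bar>bil d \<Sigma> u v\<bar>"
    by (simp_all add: normalizes_def)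
  define t where "t = c / 10"
  \<comment> \<open>The alternative itself bounds \<open>c\<close>, because population partial
    correlations do not exceed 1.\<close>
  have c1: "c \<le> 1" using alt m_gauss_le_1[OF jk] by simp
  then have t: "0 < t" "t \<le> 1 / 10" using c by (simp_all add: t_def)
  let ?B = "{s \<in> space ?P. \<not> all_close n t s u v w}"
  have "{s \<in> space ?P. psi_gauss n c j k l s = 0} \<subseteq> ?B"
  proof (rule subsetI, rule ccontr)
    fix s assume s: "s \<in> {s \<in> space ?P. psi_gauss n c j k l s = 0}" and "s \<notin> ?B"
    then have dev: "all_close n t s u v w" by auto
    moreover have "t \<le> 1 / 5" using t by simp
    ultimately obtain Suw Svw Sww where S: "\<bar>Suw\<bar> < t" "\<bar>Svw\<bar> < t" "\<bar>Sww - 1\<bar> < t"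
      "m_hat n s j k l = \<bar>savg d n s u v - Suw * Svw / Sww\<bar> /
          sqrt ((savg d n s u u - Suw * Suw / Sww) * (savg d n s v v - Svw * Svw / Sww))"
      using uvw unfolding normalizes_def by blast
    have "\<bar>savg d n s u v - bil d \<Sigma> u v\<bar> < t" "\<bar>savg d n s u u - 1\<bar> < t" "\<bar>savg d n s v v - 1\<bar> < t"
      using dev b by (auto simp: all_close_def)
    moreover have "10 * t \<le> \<bar>bil d \<Sigma> u v\<bar>" using alt b by (simp add: t_def)
    ultimately have "5 * t \<le> m_hat n s j k l"
      unfolding S(4) by (intro quotient_large t S(1-3))
    then show False using s by (simp add: psi_gauss_def t_def split: if_splits)
  qed
  moreover have "?B \<in> sets ?P" unfolding all_close_def by measurable
  ultimately have "measure ?P {s \<in> space ?P. psi_gauss n c j k l s = 0} \<le> measure ?P ?B"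
    by (intro P.finite_measure_mono)
  also have "\<dots> \<le> 24 * exp (- (real n * t\<^sup>2 / 64))"
    using b t n by (intro savg_all_close) auto
  finally show ?thesis by (simp add: t_def power_divide)
qed

end

subsection \<open>Covariances of a Markov law\<close>

abbreviation leb :: "nat set \<Rightarrow> (nat \<Rightarrow> real) measure" where
  "leb S \<equiv> (\<Pi>\<^sub>M i\<in>S. lborel)"

interpretation leb: product_sigma_finite "\<lambda>_::nat. lborel :: real measure"
  by (intro product_sigma_finite.intro lborel.sigma_finite_measure_axioms)

lemma sets_leb: "sets (leb {..<d}) = sets (vec_space d)"
  unfolding vec_space_def by (intro sets_PiM_cong) simp_all

lemma leb_restrict_measurable: "S \<subseteq> T \<Longrightarrow> (\<lambda>x. restrict x S) \<in> measurable (leb T) (leb S)"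
  by (rule measurable_restrict_subset)

text \<open>Fubini for the exceptional null set. The omitted coordinates, if any, carry infinite
  Lebesgue measure, but \<open>0\<close> times \<open>\<top>\<close> is \<open>0\<close> in
  \<open>ennreal\<close>.\<close>

lemma AE_leb_restrict:
  assumes J: "finite J" "I \<subseteq> J" and ae: "AE x in leb I. P x"
  shows "AE x in leb J. P (restrict x I)"
proof -
  obtain N where N: "{x \<in> space (leb I). \<not> P x} \<subseteq> N" "emeasure (leb I) N = 0" "N \<in> sets (leb I)"
    using ae by (auto elim: AE_E)
  note [measurable] = N(3) leb_restrict_measurable[OF J(2)]
  have IJ: "I \<union> (J - I) = J" using J by auto
  have fin: "finite I" "finite (J - I)" using J by (auto intro: finite_subset)
  have ind[measurable]: "(\<lambda>x. indicator N (restrict x I) :: ennreal) \<in> borel_measurable (leb (I \<union> (J - I)))"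
    unfolding IJ by measurable
  have "(\<integral>\<^sup>+ x. indicator N (restrict x I) \<partial>leb J) =
      (\<integral>\<^sup>+ x. (\<integral>\<^sup>+ y. indicator N (restrict (merge I (J - I) (x, y)) I) \<partial>leb (J - I)) \<partial>leb I)"
    using leb.product_nn_integral_fold[OF Diff_disjoint fin ind] unfolding IJ .
  also have "\<dots> = (\<integral>\<^sup>+ x. indicator N x * emeasure (leb (J - I)) (space (leb (J - I))) \<partial>leb I)"
  proof (rule nn_integral_cong)
    fix x assume "x \<in> space (leb I)"
    then have "restrict (merge I (J - I) (x, y)) I = x" for y
      by (auto simp: space_PiM merge_def PiE_iff extensional_def restrict_def fun_eq_iff)
    then show "(\<integral>\<^sup>+ y. indicator N (restrict (merge I (J - I) (x, y)) I) \<partial>leb (J - I)) =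
        indicator N x * emeasure (leb (J - I)) (space (leb (J - I)))" by simp
  qed
  also have "\<dots> = 0" using N(2,3) by (simp add: nn_integral_multc)
  finally have "AE x in leb J. indicator N (restrict x I) = (0::ennreal)"
    using ind by (subst (asm) nn_integral_0_iff_AE) (simp_all add: IJ)
  moreover have "AE x in leb J. x \<in> space (leb J)" by (rule AE_space)
  ultimately show ?thesis
  proof eventually_elim
    case (elim x)
    then have "restrict x I \<notin> N" by (simp add: indicator_eq_0_iff)
    moreover have "restrict x I \<in> space (leb I)"
      using elim(2) J(2) by (auto simp: space_PiM)
    ultimately show ?case using N(1) by blast
  qed
qed

locale markov_density = prob_space M for M :: "(nat \<Rightarrow> real) measure" +
  fixes d :: nat and E :: graph and f :: "nat set \<Rightarrow> (nat \<Rightarrow> real) \<Rightarrow> ennreal"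
  assumes dagE: "dag d E" and sets_vec: "sets M = sets (vec_space d)"
    and f_measurable: "S \<subseteq> {..<d} \<Longrightarrow> f S \<in> borel_measurable (leb S)"
    and f_density: "S \<subseteq> {..<d} \<Longrightarrow> distr M (leb S) (\<lambda>x. restrict x S) = density (leb S) (f S)"
    and f_factor: "AE x in leb {..<d}. f {..<d} x =
      (\<Prod>k<d. f (insert k (parents E k)) (restrict x (insert k (parents E k)))
                / f (parents E k) (restrict x (parents E k)))"
begin

definition q :: "nat \<Rightarrow> (nat \<Rightarrow> real) \<Rightarrow> ennreal" where
  "q k x = f (insert k (parents E k)) (restrict x (insert k (parents E k)))
    / f (parents E k) (restrict x (parents E k))"

text \<open>Usually called an ancestral set. The marginal of a Markov law on such a set factorizes
  over the same conditional densities \<open>q\<close>.\<close>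

definition lower :: "nat set \<Rightarrow> bool" where
  "lower A \<longleftrightarrow> A \<subseteq> {..<d} \<and> (\<forall>k\<in>A. parents E k \<subseteq> A)"

lemma parents_subset: "parents E k \<subseteq> {..<d}"
  using dagE by (auto simp: parents_def dag_def)

lemma finite_parents: "finite (parents E k)"
  using parents_subset by (rule finite_subset) simp

lemma not_self_parent: "k \<notin> parents E k"
  using dag_irrefl[OF dagE] by (auto simp: parents_def)

lemma restrict_measurable_M: "S \<subseteq> {..<d} \<Longrightarrow> (\<lambda>x. restrict x S) \<in> measurable M (leb S)"
  using leb_restrict_measurable[of S "{..<d}"]
  by (simp add: measurable_cong_sets[OF trans[OF sets_vec sets_leb[symmetric]] refl])

lemma nn_integral_density_M:
  assumes S: "S \<subseteq> {..<d}" and g[measurable]: "g \<in> borel_measurable (leb S)"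
  shows "(\<integral>\<^sup>+ x. g (restrict x S) \<partial>M) = (\<integral>\<^sup>+ x. f S x * g x \<partial>leb S)"
proof -
  note [measurable] = restrict_measurable_M[OF S] f_measurable[OF S]
  have "(\<integral>\<^sup>+ x. g (restrict x S) \<partial>M) = (\<integral>\<^sup>+ x. g x \<partial>distr M (leb S) (\<lambda>x. restrict x S))"
    by (subst nn_integral_distr) simp_all
  also have "\<dots> = (\<integral>\<^sup>+ x. f S x * g x \<partial>leb S)"
    unfolding f_density[OF S] by (subst nn_integral_density) simp_all
  finally show ?thesis .
qed

lemma q_measurable:
  assumes "insert k (parents E k) \<subseteq> A" "A \<subseteq> {..<d}"
  shows "q k \<in> borel_measurable (leb A)"
proof -
  have 1: "(\<lambda>x. f (insert k (parents E k)) (restrict x (insert k (parents E k)))) \<in> borel_measurable (leb A)"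
    using assms by (intro measurable_compose[OF leb_restrict_measurable f_measurable]) auto
  have 2: "(\<lambda>x. f (parents E k) (restrict x (parents E k))) \<in> borel_measurable (leb A)"
    using assms by (intro measurable_compose[OF leb_restrict_measurable f_measurable]) auto
  show ?thesis unfolding q_def[abs_def] using 1 2 by measurable
qed

text \<open>By uniqueness of densities, the marginal density of the parents is almost everywhere the
  integral \<open>h\<close> of the joint density over coordinate \<open>k\<close>. So
  \<open>q\<close> integrates to \<open>h / h\<close>, which is 1 unless \<open>h\<close> is
  \<open>0\<close> or \<open>\<top>\<close>, where this quotient is 0.\<close>

lemma integral_q_le_1:
  assumes k: "k < d"
  shows "AE y in leb (parents E k). (\<integral>\<^sup>+ z. q k (y(k := z)) \<partial>lborel) \<le> 1"
proof -
  let ?P = "parents E k" and ?S = "insert k (parents E k)"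
  interpret LP: sigma_finite_measure "leb ?P" by (rule leb.sigma_finite[OF finite_parents])
  have S: "?S \<subseteq> {..<d}" using parents_subset k by auto
  note [measurable] = f_measurable[OF S] f_measurable[OF parents_subset[of k]]
  define h where "h = (\<lambda>y. \<integral>\<^sup>+ z. f ?S (y(k := z)) \<partial>lborel)"
  have hm[measurable]: "h \<in> borel_measurable (leb ?P)" unfolding h_def by measurable
  have "density (leb ?P) (f ?P) = density (leb ?P) h"
  proof (rule measure_eqI)
    fix B assume "B \<in> sets (density (leb ?P) (f ?P))"
    then have B[measurable]: "B \<in> sets (leb ?P)" by simp
    have ind: "(\<lambda>x. indicator B (restrict x ?P) :: ennreal) \<in> borel_measurable (leb ?S)"
      using measurable_compose[OF leb_restrict_measurable[of ?P ?S] borel_measurable_indicator[OF B]] by auto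
    have "emeasure (density (leb ?P) (f ?P)) B = (\<integral>\<^sup>+ y. f ?P y * indicator B y \<partial>leb ?P)"
      by (simp add: emeasure_density)
    also have "\<dots> = (\<integral>\<^sup>+ x. indicator B (restrict x ?P) \<partial>M)"
      by (rule nn_integral_density_M[OF parents_subset, symmetric]) simp
    also have "\<dots> = (\<integral>\<^sup>+ x. indicator B (restrict (restrict x ?S) ?P) \<partial>M)"
      by (intro nn_integral_cong) (simp add: Int_absorb1 subset_insertI)
    also have "\<dots> = (\<integral>\<^sup>+ x. f ?S x * indicator B (restrict x ?P) \<partial>leb ?S)"
      by (rule nn_integral_density_M[OF S ind])
    also have "\<dots> = (\<integral>\<^sup>+ y. (\<integral>\<^sup>+ z. f ?S (y(k := z)) * indicator B (restrict (y(k := z)) ?P) \<partial>lborel) \<partial>leb ?P)"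
      by (intro leb.product_nn_integral_insert finite_parents not_self_parent borel_measurable_times_ennreal
          f_measurable[OF S] ind)
    also have "\<dots> = (\<integral>\<^sup>+ y. h y * indicator B y \<partial>leb ?P)"
    proof (rule nn_integral_cong)
      fix y assume y: "y \<in> space (leb ?P)"
      then have r: "restrict (y(k := z)) ?P = y" for z
        using not_self_parent[of k] by (auto simp: space_PiM PiE_iff extensional_def restrict_def fun_eq_iff)
      have "(\<lambda>z. f ?S (y(k := z))) \<in> borel_measurable lborel"
        using y not_self_parent[of k] by measurable
      then show "(\<integral>\<^sup>+ z. f ?S (y(k := z)) * indicator B (restrict (y(k := z)) ?P) \<partial>lborel) = h y * indicator B y"
        unfolding r h_def by (rule nn_integral_multc)
    qed
    also have "\<dots> = emeasure (density (leb ?P) h) B" by (simp add: emeasure_density)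
    finally show "emeasure (density (leb ?P) (f ?P)) B = emeasure (density (leb ?P) h) B" .
  qed simp
  then have "AE y in leb ?P. f ?P y = h y"
    by (intro LP.density_unique) measurable
  moreover have "AE y in leb ?P. y \<in> space (leb ?P)" by (rule AE_space)
  ultimately show ?thesis
  proof eventually_elim
    case (elim y)
    have r: "restrict (y(k := z)) ?P = y" "restrict (y(k := z)) ?S = y(k := z)" for z
      using not_self_parent[of k] elim(2) by (auto simp: space_PiM PiE_iff extensional_def restrict_def fun_eq_iff)
    have "(\<lambda>z. f ?S (y(k := z))) \<in> borel_measurable lborel"
      using elim(2) not_self_parent[of k] by measurable
    then have "(\<integral>\<^sup>+ z. q k (y(k := z)) \<partial>lborel) = h y / f ?P y"
      unfolding q_def r h_def divide_ennreal_def by (rule nn_integral_multc)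
    also have "\<dots> = h y / h y" using elim(1) by simp
    also have "\<dots> \<le> 1"
    proof (cases "h y = 0 \<or> h y = \<top>")
      case True
      then show ?thesis by (auto simp: divide_ennreal_def)
    next
      case False
      then show ?thesis by (simp add: ennreal_divide_self less_top)
    qed
    finally show ?case .
  qed
qed

lemma q_cong: "(\<And>i. i \<in> insert k (parents E k) \<Longrightarrow> x i = y i) \<Longrightarrow> q k x = q k y"
  unfolding q_def by (intro arg_cong2[of _ _ _ _ "(/)"] arg_cong[of _ _ "f _"]) (auto simp: restrict_def fun_eq_iff)

lemma integral_q_le_1_lower:
  assumes "k < d" "parents E k \<subseteq> A" "A \<subseteq> {..<d}"
  shows "AE y in leb A. (\<integral>\<^sup>+ z. q k (y(k := z)) \<partial>lborel) \<le> 1"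
proof -
  have "finite A" using assms(3) by (rule finite_subset) simp
  from AE_leb_restrict[OF this assms(2) integral_q_le_1[OF assms(1)]] show ?thesis
  proof eventually_elim
    case (elim y)
    have "q k ((restrict y (parents E k))(k := z)) = q k (y(k := z))" for z
      by (rule q_cong) auto
    then show ?case using elim by simp
  qed
qed

text \<open>Coordinate \<open>k\<close> is a sink of \<open>insert k A\<close>: no factor
  \<open>q i\<close> with \<open>i\<close> in \<open>A\<close> depends on it, so it can be
  integrated out first.\<close>

lemma lower_insert:
  assumes A: "lower A" and k: "k < d" "k \<notin> A" "parents E k \<subseteq> A"
    and G: "G \<in> borel_measurable (leb (insert k A))"
  shows "(\<integral>\<^sup>+ x. G x * (\<Prod>i\<in>insert k A. q i x) \<partial>leb (insert k A)) =
    (\<integral>\<^sup>+ y. (\<Prod>i\<in>A. q i y) * (\<integral>\<^sup>+ z. G (y(k := z)) * q k (y(k := z)) \<partial>lborel) \<partial>leb A)"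
proof -
  have fin: "finite A" and sub: "insert k A \<subseteq> {..<d}"
    using A k by (auto simp: lower_def intro: finite_subset)
  note G[measurable]
  have qk[measurable]: "q k \<in> borel_measurable (leb (insert k A))" using k sub by (intro q_measurable) auto
  have qi: "q i \<in> borel_measurable (leb (insert k A))" if "i \<in> A" for i
    using A that sub by (intro q_measurable) (auto simp: lower_def)
  have "(\<lambda>x. G x * (\<Prod>i\<in>insert k A. q i x)) \<in> borel_measurable (leb (insert k A))"
    using qi qk by (intro borel_measurable_times_ennreal G borel_measurable_prod_ennreal) auto
  then have "(\<integral>\<^sup>+ x. G x * (\<Prod>i\<in>insert k A. q i x) \<partial>leb (insert k A)) =
      (\<integral>\<^sup>+ y. (\<integral>\<^sup>+ z. G (y(k := z)) * (\<Prod>i\<in>insert k A. q i (y(k := z))) \<partial>lborel) \<partial>leb A)"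
    by (rule leb.product_nn_integral_insert[OF fin k(2)])
  also have "\<dots> = (\<integral>\<^sup>+ y. (\<Prod>i\<in>A. q i y) * (\<integral>\<^sup>+ z. G (y(k := z)) * q k (y(k := z)) \<partial>lborel) \<partial>leb A)"
  proof (rule nn_integral_cong)
    fix y assume y: "y \<in> space (leb A)"
    have "q i (y(k := z)) = q i y" if "i \<in> A" for i z
      using A k that by (intro q_cong) (auto simp: lower_def)
    then have "(\<Prod>i\<in>insert k A. q i (y(k := z))) = (\<Prod>i\<in>A. q i y) * q k (y(k := z))" for z
      using fin k(2) by (simp add: mult.commute)
    then have eq: "G (y(k := z)) * (\<Prod>i\<in>insert k A. q i (y(k := z))) =
        (\<Prod>i\<in>A. q i y) * (G (y(k := z)) * q k (y(k := z)))" for z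
      by (simp add: mult_ac)
    have "(\<lambda>z. G (y(k := z)) * q k (y(k := z))) \<in> borel_measurable lborel"
      using y k(2) by measurable
    then show "(\<integral>\<^sup>+ z. G (y(k := z)) * (\<Prod>i\<in>insert k A. q i (y(k := z))) \<partial>lborel) =
        (\<Prod>i\<in>A. q i y) * (\<integral>\<^sup>+ z. G (y(k := z)) * q k (y(k := z)) \<partial>lborel)"
      unfolding eq by (rule nn_integral_cmult)
  qed
  finally show ?thesis .
qed

lemma lower_insert_le:
  assumes A: "lower A" and k: "k < d" "k \<notin> A" "parents E k \<subseteq> A"
    and g: "g \<in> borel_measurable (leb A)"
  shows "(\<integral>\<^sup>+ x. g (restrict x A) * (\<Prod>i\<in>insert k A. q i x) \<partial>leb (insert k A)) \<le>
    (\<integral>\<^sup>+ y. g y * (\<Prod>i\<in>A. q i y) \<partial>leb A)"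
proof -
  have sub: "insert k A \<subseteq> {..<d}" using A k by (auto simp: lower_def)
  have "(\<integral>\<^sup>+ x. g (restrict x A) * (\<Prod>i\<in>insert k A. q i x) \<partial>leb (insert k A)) =
      (\<integral>\<^sup>+ y. (\<Prod>i\<in>A. q i y) * (\<integral>\<^sup>+ z. g (restrict (y(k := z)) A) * q k (y(k := z)) \<partial>lborel) \<partial>leb A)"
    by (rule lower_insert[OF A k]) (intro measurable_compose[OF leb_restrict_measurable g], auto)
  also have "\<dots> \<le> (\<integral>\<^sup>+ y. g y * (\<Prod>i\<in>A. q i y) \<partial>leb A)"
  proof (rule nn_integral_mono_AE)
    have "A \<subseteq> {..<d}" using sub by auto
    from integral_q_le_1_lower[OF k(1,3) this] AE_space[of "leb A"]
    show "AE y in leb A. (\<Prod>i\<in>A. q i y) * (\<integral>\<^sup>+ z. g (restrict (y(k := z)) A) * q k (y(k := z)) \<partial>lborel)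
        \<le> g y * (\<Prod>i\<in>A. q i y)"
    proof eventually_elim
      case (elim y)
      have r: "restrict (y(k := z)) A = y" for z
        using elim(2) k(2) by (auto simp: space_PiM PiE_iff extensional_def restrict_def fun_eq_iff)
      have "q k \<in> borel_measurable (leb (insert k A))" using k sub by (intro q_measurable) auto
      then have "(\<lambda>z. q k (y(k := z))) \<in> borel_measurable lborel"
        using elim(2) k(2) by measurable
      then have "(\<integral>\<^sup>+ z. g (restrict (y(k := z)) A) * q k (y(k := z)) \<partial>lborel) = g y * (\<integral>\<^sup>+ z. q k (y(k := z)) \<partial>lborel)"
        unfolding r by (rule nn_integral_cmult)
      also have "\<dots> \<le> g y * 1" by (rule mult_left_mono[OF elim(1)]) simp
      finally have "(\<integral>\<^sup>+ z. g (restrict (y(k := z)) A) * q k (y(k := z)) \<partial>lborel) \<le> g y" by simp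
      then show ?case by (subst mult.commute) (intro mult_right_mono, auto)
    qed
  qed
  finally show ?thesis .
qed

lemma wf_E: "wf E" "wf (E\<inverse>)"
proof -
  have "finite E" "acyclic E" using dagE by (auto simp: dag_def intro: finite_subset)
  then show "wf E" "wf (E\<inverse>)" by (auto intro: finite_acyclic_wf finite_acyclic_wf_converse)
qed

text \<open>Sinks of \<open>A\<close> are removed one by one, and each removal contributes a factor
  of at most 1.\<close>

lemma lower_mass_le_1:
  assumes "lower A"
  shows "(\<integral>\<^sup>+ x. (\<Prod>i\<in>A. q i x) \<partial>leb A) \<le> 1"
proof -
  have "finite A" using assms by (auto simp: lower_def intro: finite_subset)
  then show ?thesis using assms
  proof (induction "card A" arbitrary: A)
    case 0
    then have "A = {}" by simp
    then show ?case by (simp add: PiM_empty)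
  next
    case (Suc n)
    then have "A \<noteq> {}" by auto
    then obtain k where k: "k \<in> A" "\<And>j. (k, j) \<in> E \<Longrightarrow> j \<notin> A"
      using wfE_min[OF wf_E(2), of _ A] by (metis converse_iff all_not_in_conv)
    define B where "B = A - {k}"
    have A: "A = insert k B" "k \<notin> B" using k by (auto simp: B_def)
    have "lower B" using Suc.prems(2) k by (auto simp: lower_def B_def parents_def)
    have pk: "k < d" "parents E k \<subseteq> B"
      using Suc.prems(2) k(1) not_self_parent[of k] by (auto simp: lower_def B_def)
    have "(\<integral>\<^sup>+ x. (\<Prod>i\<in>A. q i x) \<partial>leb A) \<le> (\<integral>\<^sup>+ x. (\<Prod>i\<in>B. q i x) \<partial>leb B)"
      using lower_insert_le[OF \<open>lower B\<close> pk(1) A(2) pk(2), of "\<lambda>_. 1"] by (simp add: A(1))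
    also have "\<dots> \<le> 1"
      using Suc A(2) \<open>lower B\<close> by (intro Suc.hyps(1)) (auto simp: A(1))
    finally show ?case .
  qed
qed

text \<open>Induction on the complement of \<open>A\<close>, whose sources have all their parents in
  \<open>A\<close> and can be added. For the full set the factorization gives equality; integrating
  a coordinate out again contributes a factor of at most 1, whence the inequality.\<close>

lemma lower_law_le:
  assumes "lower A" "g \<in> borel_measurable (leb A)"
  shows "(\<integral>\<^sup>+ x. g (restrict x A) \<partial>M) \<le> (\<integral>\<^sup>+ x. g x * (\<Prod>i\<in>A. q i x) \<partial>leb A)"
  using assms
proof (induction "card ({..<d} - A)" arbitrary: A g)
  case 0
  then have A: "A = {..<d}" by (auto simp: lower_def)
  have "(\<integral>\<^sup>+ x. g (restrict x A) \<partial>M) = (\<integral>\<^sup>+ x. f A x * g x \<partial>leb A)"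
    using 0 by (intro nn_integral_density_M) (auto simp: A)
  also have "\<dots> = (\<integral>\<^sup>+ x. g x * (\<Prod>i\<in>A. q i x) \<partial>leb A)"
    using f_factor unfolding A q_def[symmetric]
    by (intro nn_integral_cong_AE) (auto simp: mult.commute elim!: eventually_mono)
  finally show ?case by (rule eq_refl)
next
  case (Suc n)
  have "{..<d} - A \<noteq> {}" using Suc.hyps(2) by (metis card.empty nat.distinct(1))
  then obtain k where k: "k \<in> {..<d} - A" "\<And>j. (j, k) \<in> E \<Longrightarrow> j \<notin> {..<d} - A"
    using wfE_min[OF wf_E(1), of _ "{..<d} - A"] by (metis all_not_in_conv)
  have kA: "k < d" "k \<notin> A" "parents E k \<subseteq> A"
    using k parents_subset[of k] by (auto simp: parents_def)
  have low: "lower (insert k A)" using Suc.prems(1) kA by (auto simp: lower_def)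
  have "card ({..<d} - insert k A) = n"
    using Suc.hyps(2) kA by (metis Diff_insert card_Diff_singleton diff_Suc_1 k(1))
  then have "(\<integral>\<^sup>+ x. g (restrict (restrict x (insert k A)) A) \<partial>M) \<le>
      (\<integral>\<^sup>+ x. g (restrict x A) * (\<Prod>i\<in>insert k A. q i x) \<partial>leb (insert k A))"
    using low measurable_compose[OF leb_restrict_measurable[of A "insert k A"] Suc.prems(2)]
    by (intro Suc.hyps(1)) auto
  also have "\<dots> \<le> (\<integral>\<^sup>+ x. g x * (\<Prod>i\<in>A. q i x) \<partial>leb A)"
    by (rule lower_insert_le[OF Suc.prems(1) kA Suc.prems(2)])
  finally show ?case by (simp add: Int_absorb1 subset_insertI)
qed

text \<open>Where the marginal density of the parents vanishes, \<open>q\<close> need not integrate to 1.  So sinks can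
  only be integrated out with inequalities, which are equalities because both masses are 1 in the end.\<close>

lemma lower_law:
  assumes A: "lower A" and g: "g \<in> borel_measurable (leb A)"
  shows "(\<integral>\<^sup>+ x. g (restrict x A) \<partial>M) = (\<integral>\<^sup>+ x. g x * (\<Prod>i\<in>A. q i x) \<partial>leb A)"
proof -
  have sub: "A \<subseteq> {..<d}" using A by (simp add: lower_def)
  have qi: "q i \<in> borel_measurable (leb A)" if "i \<in> A" for i
    using A that sub by (intro q_measurable) (auto simp: lower_def)
  have D[measurable]: "(\<lambda>x. \<Prod>i\<in>A. q i x) \<in> borel_measurable (leb A)"
    using qi by (intro borel_measurable_prod_ennreal) auto
  note [measurable] = restrict_measurable_M[OF sub] g
  let ?L = "distr M (leb A) (\<lambda>x. restrict x A)" and ?R = "density (leb A) (\<lambda>x. \<Prod>i\<in>A. q i x)"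
  interpret L: prob_space ?L by (rule prob_space_distr) simp
  have L: "emeasure ?L B = (\<integral>\<^sup>+ x. indicator B (restrict x A) \<partial>M)" if "B \<in> sets (leb A)" for B
    using that by (simp add: emeasure_distr_nn_integral)
  have R: "emeasure ?R B = (\<integral>\<^sup>+ x. indicator B x * (\<Prod>i\<in>A. q i x) \<partial>leb A)" if "B \<in> sets (leb A)" for B
    using that by (simp add: emeasure_density mult.commute)
  have le: "emeasure ?L B \<le> emeasure ?R B" if "B \<in> sets (leb A)" for B
    unfolding L[OF that] R[OF that] using that by (intro lower_law_le[OF A]) simp
  have R1: "emeasure ?R (space (leb A)) \<le> 1"
    using lower_mass_le_1[OF A] by (simp add: emeasure_density cong: nn_integral_cong)
  have "?L = ?R"
  proof (rule measure_eqI)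
    fix B assume "B \<in> sets ?L"
    then have B[measurable]: "B \<in> sets (leb A)" by simp
    \<comment> \<open>\<open>?L\<close> is below \<open>?R\<close> on every set, while the total
      mass of \<open>?R\<close> does not exceed that of \<open>?L\<close>. Comparing the two on the
      complement turns this into equality on \<open>B\<close>.\<close>
    let ?C = "space (leb A) - B"
    have C: "?C \<in> sets (leb A)" by simp
    have "emeasure ?R B + emeasure ?R ?C = emeasure ?R (space (leb A))"
      using sets.sets_into_space[OF B] by (subst plus_emeasure) (auto simp: Un_absorb1)
    also have "\<dots> \<le> emeasure ?L B + emeasure ?L ?C"
    proof -
      have "emeasure ?L B + emeasure ?L ?C = emeasure ?L (space ?L)"
        using sets.sets_into_space[OF B] by (subst plus_emeasure) (auto simp: Un_absorb1)
      then show ?thesis using R1 L.emeasure_space_1 by simp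
    qed
    also have "\<dots> \<le> emeasure ?L B + emeasure ?R ?C"
      by (intro add_left_mono le C)
    finally have "emeasure ?R B + emeasure ?R ?C \<le> emeasure ?L B + emeasure ?R ?C" .
    moreover have "emeasure ?R ?C \<noteq> \<top>"
    proof -
      have "emeasure ?R ?C \<le> emeasure ?R (space (leb A))" by (intro emeasure_mono) auto
      then show ?thesis using R1 by (metis ennreal_one_neq_top neq_top_trans top.extremum_unique)
    qed
    ultimately have "emeasure ?R B \<le> emeasure ?L B"
      by (simp add: ennreal_add_left_cancel_le add.commute[of _ "emeasure ?R ?C"])
    then show "emeasure ?L B = emeasure ?R B" using le[OF B] by simp
  qed simp
  then have "(\<integral>\<^sup>+ x. g x \<partial>?L) = (\<integral>\<^sup>+ x. g x \<partial>?R)" by simp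
  then show ?thesis by (simp add: nn_integral_distr nn_integral_density mult.commute)
qed

end

section \<open>Linear structural equations\<close>

lemma leb_component_measurable: "i \<in> S \<Longrightarrow> (\<lambda>x. x i) \<in> borel_measurable (leb S)"
  using measurable_component_singleton[of i S "\<lambda>_. lborel :: real measure"] by simp

lemma bil_expand_right: "bil d \<Sigma> u v = (\<Sum>i<d. v i * bil d \<Sigma> u (unit i))"
proof -
  have "bil d \<Sigma> u v = bil d \<Sigma> u (\<lambda>i. \<Sum>k<d. v k * unit k i)"
    unfolding bil_def by (intro sum.cong refl) (simp add: unit_def if_distrib[of "\<lambda>a. _ * a"] cong: if_cong)
  then show ?thesis by (simp add: bil_sum_right)
qed

text \<open>Gram-Schmidt with the values outside \<open>P\<close> held fixed, which provides the
  regression on the coordinates in \<open>P\<close> without inverting a matrix. The induction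
  hypothesis is needed for \<open>w\<close> and for \<open>unit p\<close>.\<close>

lemma (in gaussian_law) orthogonalize:
  assumes "finite P" "P \<subseteq> {..<d}"
  shows "\<exists>u. (\<forall>i. i \<notin> P \<longrightarrow> u i = w i) \<and> (\<forall>i\<in>P. bil d \<Sigma> u (unit i) = 0)"
  using assms
proof (induction P arbitrary: w rule: finite_induct)
  case empty
  show ?case by (rule exI[of _ w]) simp
next
  case (insert p P)
  obtain u where u: "\<And>i. i \<notin> P \<Longrightarrow> u i = w i" "\<And>i. i \<in> P \<Longrightarrow> bil d \<Sigma> u (unit i) = 0"
    using insert.IH[of w] insert.prems by auto
  obtain e where e: "\<And>i. i \<notin> P \<Longrightarrow> e i = unit p i" "\<And>i. i \<in> P \<Longrightarrow> bil d \<Sigma> e (unit i) = 0"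
    using insert.IH[of "unit p"] insert.prems by auto
  have ep: "e p = 1" using e(1)[OF insert.hyps(2)] by (simp add: unit_def)
  have p: "p < d" using insert.prems by simp
  have pos: "bil d \<Sigma> e e > 0" using bil_pos[OF p] ep by simp
  define c where "c = bil d \<Sigma> u e / bil d \<Sigma> e e"
  define u' where "u' = (\<lambda>i. 1 * u i + (- c) * e i)"
  have orth: "bil d \<Sigma> u' (unit i) = 0" if "i \<in> P" for i
    unfolding u'_def bil_combine_left using u(2) e(2) that by simp
  have e0: "e i = 0" if "i \<notin> insert p P" for i using e(1)[of i] that by (simp add: unit_def)
  \<comment> \<open>\<open>e\<close> is \<open>unit p\<close> plus a combination of coordinates in
    \<open>P\<close>, and \<open>u'\<close> is orthogonal to \<open>P\<close>. So orthogonality to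
    \<open>e\<close> amounts to orthogonality to \<open>unit p\<close>.\<close>
  have "bil d \<Sigma> u' e = 0" unfolding u'_def bil_combine_left using pos by (simp add: c_def)
  moreover have "bil d \<Sigma> u' e = (\<Sum>i\<in>{p}. e i * bil d \<Sigma> u' (unit i))"
    unfolding bil_expand_right[of d \<Sigma> u' e] using p e0 orth
    by (intro sum.mono_neutral_right) auto
  ultimately have "bil d \<Sigma> u' (unit p) = 0" by (simp add: ep)
  moreover have "u' i = w i" if "i \<notin> insert p P" for i
    using that u(1) e(1) by (simp add: u'_def unit_def)
  ultimately show ?case using orth by (intro exI[of _ u']) auto
qed

locale markov_gaussian = gaussian_law M d \<Sigma> + markov_density M d E f
  for M d \<Sigma> E f
begin

text \<open>The local Markov property in kernel form: given the coordinates in an ancestral set that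
  contains the parents of \<open>k\<close> but not \<open>k\<close>, functions of \<open>k\<close>
  and its parents are averaged by a kernel that sees only the parents.\<close>

lemma residual_kernel:
  assumes A: "lower A" and k: "k < d" "k \<notin> A" "parents E k \<subseteq> A"
    and g: "g \<in> borel_measurable (leb A)" and h: "h \<in> borel_measurable (leb (insert k (parents E k)))"
  shows "(\<integral>\<^sup>+ x. g (restrict x A) * h (restrict x (insert k (parents E k))) \<partial>M) =
    (\<integral>\<^sup>+ x. g (restrict x A) * (\<integral>\<^sup>+ z. h ((restrict x (parents E k))(k := z)) *
      q k ((restrict x (parents E k))(k := z)) \<partial>lborel) \<partial>M)"
proof -
  let ?P = "parents E k" and ?S = "insert k (parents E k)" and ?A = "insert k A"
  have sub: "A \<subseteq> {..<d}" "?A \<subseteq> {..<d}" using A k by (auto simp: lower_def)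
  have low: "lower ?A" using A k by (auto simp: lower_def)
  have SA: "?S \<subseteq> ?A" using k by auto
  define H where "H = (\<lambda>y. \<integral>\<^sup>+ z. h (y(k := z)) * q k (y(k := z)) \<partial>lborel)"
  have qS: "q k \<in> borel_measurable (leb ?S)" using k sub by (intro q_measurable) auto
  note [measurable] = g h qS
  have Hm: "H \<in> borel_measurable (leb ?P)" unfolding H_def by measurable
  have gm: "(\<lambda>x. g (restrict x A)) \<in> borel_measurable (leb ?A)"
    using measurable_compose[OF leb_restrict_measurable[of A ?A] g] by auto
  have hm: "(\<lambda>x. h (restrict x ?S)) \<in> borel_measurable (leb ?A)"
    using measurable_compose[OF leb_restrict_measurable[OF SA] h] by auto
  have HA: "(\<lambda>x. H (restrict x ?P)) \<in> borel_measurable (leb A)"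
    using measurable_compose[OF leb_restrict_measurable[OF k(3)] Hm] by auto
  have rr: "restrict (restrict x ?A) A = restrict x A" "restrict (restrict x ?A) ?S = restrict x ?S"
    "restrict (restrict x A) ?P = restrict x ?P" for x :: "nat \<Rightarrow> real"
    using k(3) by (auto simp: restrict_def fun_eq_iff)
  have "(\<integral>\<^sup>+ x. g (restrict x A) * h (restrict x ?S) \<partial>M) =
      (\<integral>\<^sup>+ x. g (restrict x A) * h (restrict x ?S) * (\<Prod>i\<in>?A. q i x) \<partial>leb ?A)"
    using lower_law[OF low borel_measurable_times_ennreal[OF gm hm]] by (simp only: rr)
  also have "\<dots> = (\<integral>\<^sup>+ y. (\<Prod>i\<in>A. q i y) * (\<integral>\<^sup>+ z. g (restrict (y(k := z)) A) * h (restrict (y(k := z)) ?S) *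
      q k (y(k := z)) \<partial>lborel) \<partial>leb A)"
    by (rule lower_insert[OF A k borel_measurable_times_ennreal[OF gm hm]])
  also have "\<dots> = (\<integral>\<^sup>+ y. g y * H (restrict y ?P) * (\<Prod>i\<in>A. q i y) \<partial>leb A)"
  proof (rule nn_integral_cong)
    fix y assume y: "y \<in> space (leb A)"
    have r: "restrict (y(k := z)) A = y" for z
      using y k(2) by (auto simp: space_PiM PiE_iff extensional_def restrict_def fun_eq_iff)
    have s: "restrict (y(k := z)) ?S = (restrict y ?P)(k := z)" for z
      using not_self_parent[of k] by (auto simp: restrict_def fun_eq_iff)
    have t: "q k (y(k := z)) = q k ((restrict y ?P)(k := z))" for z by (rule q_cong) auto
    have "restrict y ?P \<in> space (leb ?P)" by (simp add: space_PiM)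
    then have "(\<lambda>z. h ((restrict y ?P)(k := z)) * q k ((restrict y ?P)(k := z))) \<in> borel_measurable lborel"
      using not_self_parent[of k] by measurable
    then have "(\<integral>\<^sup>+ z. g (restrict (y(k := z)) A) * h (restrict (y(k := z)) ?S) * q k (y(k := z)) \<partial>lborel) =
        g y * H (restrict y ?P)"
      unfolding r s t H_def mult.assoc by (rule nn_integral_cmult)
    then show "(\<Prod>i\<in>A. q i y) * (\<integral>\<^sup>+ z. g (restrict (y(k := z)) A) * h (restrict (y(k := z)) ?S) *
        q k (y(k := z)) \<partial>lborel) = g y * H (restrict y ?P) * (\<Prod>i\<in>A. q i y)"
      by (simp add: mult.commute)
  qed
  also have "\<dots> = (\<integral>\<^sup>+ x. g (restrict x A) * H (restrict x ?P) \<partial>M)"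
    using lower_law[OF A borel_measurable_times_ennreal[OF g HA]] by (simp only: rr)
  finally show ?thesis by (simp only: H_def)
qed

text \<open>\<open>lin d u\<close> is independent of the parents of \<open>k\<close>. Its
  conditional law given all of \<open>A\<close> depends on the parents only, and by this
  independence it is almost surely constant in them. Hence \<open>lin d u\<close> is independent of
  every coordinate in \<open>A\<close>.\<close>

lemma residual_uncorrelated:
  assumes A: "lower A" and k: "k < d" "k \<notin> A" "parents E k \<subseteq> A"
    and supp: "\<And>i. i \<notin> insert k (parents E k) \<Longrightarrow> u i = 0"
    and orth: "\<And>i. i \<in> parents E k \<Longrightarrow> bil d \<Sigma> u (unit i) = 0" and m: "m \<in> A"
  shows "bil d \<Sigma> u (unit m) = 0"
proof -
  let ?P = "parents E k" and ?S = "insert k (parents E k)"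
  have md: "m < d" using A m by (auto simp: lower_def)
  have Sd: "?S \<subseteq> {..<d}" using k parents_subset[of k] by auto
  have [measurable]: "(\<lambda>x. x m) \<in> borel_measurable M" using md by (rule coord_measurable)
  have linS: "lin d u x = (\<Sum>i\<in>?S. u i * x i)" for x
    unfolding lin_def using supp Sd finite_parents[of k] by (intro sum.mono_neutral_right) auto
  have lin_restr: "lin d u (restrict x ?S) = lin d u x" for x
    unfolding linS by (intro sum.cong) auto
  have lin_m: "lin d u \<in> borel_measurable (leb ?S)"
    unfolding linS[abs_def]
    by (intro borel_measurable_sum borel_measurable_times borel_measurable_const leb_component_measurable)
  have indep: "(\<integral>\<^sup>+ x. indicator B (x m) * indicator C (lin d u x) \<partial>M) =
      (\<integral>\<^sup>+ x. indicator C (lin d u x) \<partial>M) * (\<integral>\<^sup>+ x. indicator B (x m) \<partial>M)"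
    if B[measurable]: "B \<in> sets borel" and C[measurable]: "C \<in> sets borel" for B C :: "real set"
  proof -
    define h :: "(nat \<Rightarrow> real) \<Rightarrow> ennreal" where "h = (\<lambda>x. indicator C (lin d u x))"
    have h: "h \<in> borel_measurable (leb ?S)" unfolding h_def using lin_m by measurable
    have hr: "h (restrict x ?S) = h x" for x by (simp only: h_def lin_restr)
    define H where "H = (\<lambda>y. \<integral>\<^sup>+ z. h (y(k := z)) * q k (y(k := z)) \<partial>lborel)"
    have qS: "q k \<in> borel_measurable (leb ?S)" using Sd by (intro q_measurable) auto
    have Hm[measurable]: "H \<in> borel_measurable (leb ?P)" unfolding H_def using h qS by measurable
    have kernel: "(\<integral>\<^sup>+ x. g (restrict x A) * h x \<partial>M) = (\<integral>\<^sup>+ x. g (restrict x A) * H (restrict x ?P) \<partial>M)"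
      if "g \<in> borel_measurable (leb A)" for g
      using residual_kernel[OF A k that h] by (simp only: hr H_def)
    define \<kappa> where "\<kappa> = (\<integral>\<^sup>+ x. h x \<partial>M)"
    note rP[measurable] = restrict_measurable_M[OF parents_subset[of k]]
    let ?L = "distr M (leb ?P) (\<lambda>x. restrict x ?P)"
    interpret L: prob_space ?L by (rule prob_space_distr) simp
    \<comment> \<open>A function with the same integrals as a constant over all events of the
      parents is almost surely that constant under their law.\<close>
    have "AE y in ?L. H y = \<kappa>"
    proof (rule L.density_unique_finite_measure)
      fix D assume "D \<in> sets ?L"
      then have D[measurable]: "D \<in> sets (leb ?P)" by simp
      have gD: "(\<lambda>y. indicator D (restrict y ?P) :: ennreal) \<in> borel_measurable (leb A)"
        using measurable_compose[OF leb_restrict_measurable[OF k(3)] borel_measurable_indicator[OF D]] by auto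
      have rr: "restrict (restrict x A) ?P = restrict x ?P" for x :: "nat \<Rightarrow> real"
        using k(3) by (auto simp: restrict_def fun_eq_iff)
      have "(\<integral>\<^sup>+ y. H y * indicator D y \<partial>?L) = (\<integral>\<^sup>+ x. indicator D (restrict x ?P) * H (restrict x ?P) \<partial>M)"
        by (subst nn_integral_distr) (simp_all add: mult.commute)
      also have "\<dots> = (\<integral>\<^sup>+ x. h x * indicator D (restrict x ?P) \<partial>M)"
        using kernel[OF gD] unfolding rr by (simp only: mult.commute)
      also have "\<dots> = \<kappa> * (\<integral>\<^sup>+ x. indicator D (restrict x ?P) \<partial>M)"
        unfolding \<kappa>_def h_def
      proof (rule nn_integral_lin_indep[OF finite_parents parents_subset orth])
        show "(\<lambda>x. indicator D x :: ennreal) \<in> borel_measurable (\<Pi>\<^sub>M j\<in>?P. borel)"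
          using D by (simp add: borel_measurable_indicator_iff cong: measurable_cong_sets sets_PiM_cong)
      qed simp_all
      also have "\<dots> = (\<integral>\<^sup>+ y. \<kappa> * indicator D y \<partial>?L)"
        by (subst nn_integral_distr) (simp_all add: nn_integral_cmult)
      finally show "(\<integral>\<^sup>+ y. H y * indicator D y \<partial>?L) = (\<integral>\<^sup>+ y. \<kappa> * indicator D y \<partial>?L)" .
    qed (simp_all)
    then have ae: "AE x in M. H (restrict x ?P) = \<kappa>" by (subst (asm) AE_distr_iff) simp_all
    have gB: "(\<lambda>y. indicator B (y m) :: ennreal) \<in> borel_measurable (leb A)"
      using measurable_compose[OF leb_component_measurable[OF m] borel_measurable_indicator[OF B]] by simp
    have "(\<integral>\<^sup>+ x. indicator B (x m) * h x \<partial>M) = (\<integral>\<^sup>+ x. indicator B (x m) * H (restrict x ?P) \<partial>M)"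
      using kernel[OF gB] m by simp
    also have "\<dots> = (\<integral>\<^sup>+ x. \<kappa> * indicator B (x m) \<partial>M)"
      using ae by (intro nn_integral_cong_AE) (auto simp: mult.commute elim!: eventually_mono)
    also have "\<dots> = \<kappa> * (\<integral>\<^sup>+ x. indicator B (x m) \<partial>M)" by (simp add: nn_integral_cmult)
    finally show ?thesis by (simp add: h_def \<kappa>_def)
  qed
  have "indep_var borel (lin d u) borel (\<lambda>x. x m)"
    by (rule indep_var_indicator) (simp_all add: indep mult.commute[of "indicator _ (lin d u _)"])
  then have "(LINT x|M. lin d u x * x m) = (LINT x|M. lin d u x) * (LINT x|M. x m)"
    using integrable_lin_self[of u] integrable_lin_self[of "unit m"] md
    by (intro indep_var_lebesgue_integral) (simp_all add: coord_eq)
  then show ?thesis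
    using expectation_lin_mult[of u "unit m"] by (simp add: expectation_lin lin_unit md)
qed

text \<open>\<open>u\<close> is the residual of node \<open>k\<close> after regression on its
  parents. The non-descendants form an ancestral set containing the parents, so \<open>u\<close> is
  uncorrelated with all of them; \<open>\<beta>\<close> consists of the coefficients of the parents
  in \<open>u\<close> with opposite sign.\<close>

lemma structural_equation:
  assumes k: "k < d"
  shows "\<exists>\<beta>. \<forall>m<d. (k, m) \<notin> E\<^sup>* \<longrightarrow> \<Sigma> k m = (\<Sum>i\<in>parents E k. \<beta> i * \<Sigma> i m)"
proof -
  let ?P = "parents E k"
  obtain u where u: "\<And>i. i \<notin> ?P \<Longrightarrow> u i = unit k i" "\<And>i. i \<in> ?P \<Longrightarrow> bil d \<Sigma> u (unit i) = 0"
    using orthogonalize[OF finite_parents parents_subset, of k "unit k"] by blast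
  have uk: "u k = 1" using u(1)[OF not_self_parent] by (simp add: unit_def)
  define A where "A = {m. m < d \<and> (k, m) \<notin> E\<^sup>*}"
  have "lower A"
    using dagE by (auto simp: lower_def A_def parents_def dag_def dest: rtrancl_into_rtrancl)
  moreover have "?P \<subseteq> A"
    using dag_no_cycle[OF dagE] parents_subset[of k] by (auto simp: A_def parents_def)
  ultimately have 0: "bil d \<Sigma> u (unit m) = 0" if "m < d" "(k, m) \<notin> E\<^sup>*" for m
    using residual_uncorrelated[of A k u m] u k that by (auto simp: A_def unit_def)
  have "\<Sigma> k m = (\<Sum>i\<in>?P. - u i * \<Sigma> i m)" if m: "m < d" "(k, m) \<notin> E\<^sup>*" for m
  proof -
    have "bil d \<Sigma> u (unit m) = (\<Sum>i<d. u i * \<Sigma> i m)"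
      using m by (simp add: bil_def unit_def if_distrib[of "\<lambda>a. _ * a"] cong: if_cong)
    also have "\<dots> = (\<Sum>i\<in>insert k ?P. u i * \<Sigma> i m)"
      using u(1) k parents_subset[of k] by (intro sum.mono_neutral_right) (auto simp: unit_def)
    also have "\<dots> = \<Sigma> k m + (\<Sum>i\<in>?P. u i * \<Sigma> i m)"
      using finite_parents not_self_parent uk by simp
    finally show ?thesis using 0[OF m] by (simp add: sum_negf)
  qed
  then show ?thesis by (intro exI[of _ "\<lambda>i. - u i"]) blast
qed

end

section \<open>Covariances in a forest\<close>

lemma ancestral_detour:
  assumes "(a, x) \<in> E\<^sup>*" "(k, x) \<notin> E\<^sup>*"
  shows "(a, x) \<in> (detour E l k)\<^sup>*"
  using assms
proof (induction rule: converse_rtrancl_induct)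
  case (step a y)
  have "k \<noteq> a" "k \<noteq> y" using step.hyps step.prems by (auto dest: converse_rtrancl_into_rtrancl)
  then have "(a, y) \<in> detour E l k" using step.hyps(1) by (auto simp: detour_def adj_def doubleton_eq_iff)
  then show ?case using step.IH[OF step.prems] by (rule converse_rtrancl_into_rtrancl)
qed simp

text \<open>Below \<open>k\<close> a directed path cannot come back to the parent \<open>l\<close>,
  by acyclicity, so it never uses the edge \<open>l - k\<close>.\<close>

lemma descending_detour:
  assumes "dag d E" "(l, k) \<in> E" "(k, x) \<in> E\<^sup>*"
  shows "(k, x) \<in> (detour E l k)\<^sup>*"
  using assms(3)
proof (induction rule: rtrancl_induct)
  case (step y z)
  have "(k, l) \<notin> E\<^sup>*" using dag_no_cycle[OF assms(1,2)] .
  then have "l \<noteq> y" "l \<noteq> z" using step.hyps by (auto dest: rtrancl_into_rtrancl)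
  then have "(y, z) \<in> detour E l k" using step.hyps(2) by (auto simp: detour_def adj_def doubleton_eq_iff)
  then show ?case using step.IH by (rule rtrancl_into_rtrancl[rotated])
qed simp

lemma detour_rtrancl_sym: "(a, b) \<in> (detour E u v)\<^sup>* \<Longrightarrow> (b, a) \<in> (detour E u v)\<^sup>*"
  using sym_rtrancl[OF sym_detour] by (rule symD)

context
  fixes d :: nat and E :: graph and \<Sigma> :: "nat \<Rightarrow> nat \<Rightarrow> real"
  assumes forest: "E \<in> poly_forests d"
    and sem: "\<And>k. k < d \<Longrightarrow> \<exists>\<beta>. \<forall>m<d. (k, m) \<notin> E\<^sup>* \<longrightarrow> \<Sigma> k m = (\<Sum>i\<in>parents E k. \<beta> i * \<Sigma> i m)"
begin

lemma parent_less: "i \<in> parents E k \<Longrightarrow> i < d"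
  using poly_forest_dag[OF forest] by (auto simp: parents_def dag_def)

text \<open>Unless \<open>j\<close> is a descendant of \<open>k\<close>, the structural equation of
  \<open>k\<close> shows that some parent of \<open>k\<close> is correlated with \<open>j\<close>,
  and the induction goes upwards.\<close>

lemma correlated_common_ancestor:
  assumes "k < d" "j < d" "\<Sigma> k j \<noteq> 0"
  shows "\<exists>a. (a, k) \<in> E\<^sup>* \<and> (a, j) \<in> E\<^sup>*"
proof -
  have "wf E"
    using poly_forest_dag[OF forest] by (auto simp: dag_def intro!: finite_acyclic_wf intro: finite_subset)
  then show ?thesis using assms
  proof (induction k rule: wf_induct_rule)
    case (less k)
    show ?case
    proof (cases "(k, j) \<in> E\<^sup>*")
      case False
      obtain \<beta> where "\<Sigma> k j = (\<Sum>i\<in>parents E k. \<beta> i * \<Sigma> i j)"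
        using sem[OF less.prems(1)] less.prems(2) False by blast
      then have "(\<Sum>i\<in>parents E k. \<beta> i * \<Sigma> i j) \<noteq> 0" using less.prems(3) by simp
      then obtain i where i: "i \<in> parents E k" "\<beta> i * \<Sigma> i j \<noteq> 0"
        by (rule sum.not_neutral_contains_not_neutral)
      then have "(i, k) \<in> E" "\<Sigma> i j \<noteq> 0" "i < d" using parent_less by (auto simp: parents_def)
      then obtain a where "(a, i) \<in> E\<^sup>*" "(a, j) \<in> E\<^sup>*"
        using less.IH[of i] less.prems(2) by blast
      then show ?thesis using i(1) by (auto simp: parents_def dest: rtrancl_into_rtrancl)
    qed auto
  qed
qed

text \<open>Once the edge \<open>l -> k\<close> is deleted, the other parents of \<open>k\<close>
  lie in the component of \<open>k\<close> and not in that of \<open>l\<close>, so they are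
  uncorrelated with the nodes \<open>m\<close> connected to \<open>l\<close>. The structural
  equation then reads \<open>\<Sigma> k m = \<beta> l * \<Sigma> l m\<close>. It is used for
  \<open>m = j\<close> and for \<open>m = l\<close>, and \<open>\<beta> l\<close> is
  eliminated.\<close>

lemma chain_covariance:
  assumes lk: "(l, k) \<in> E" and j: "j < d" "(k, j) \<notin> E\<^sup>*" and lj: "(l, j) \<in> (detour E l k)\<^sup>*"
  shows "\<Sigma> k j * \<Sigma> l l = \<Sigma> k l * \<Sigma> l j"
proof -
  note dagE = poly_forest_dag[OF forest]
  have k: "k < d" and l: "l < d" using lk dagE by (auto simp: dag_def)
  have kl: "(k, l) \<notin> E\<^sup>*" using dag_no_cycle[OF dagE lk] .
  obtain \<beta> where \<beta>: "\<And>m. m < d \<Longrightarrow> (k, m) \<notin> E\<^sup>* \<Longrightarrow> \<Sigma> k m = (\<Sum>i\<in>parents E k. \<beta> i * \<Sigma> i m)"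
    using sem[OF k] by blast
  have zero: "\<Sigma> i m = 0" if i: "i \<in> parents E k" "i \<noteq> l" and m: "m < d" "(k, m) \<notin> E\<^sup>*" "(l, m) \<in> (detour E l k)\<^sup>*" for i m
  proof (rule ccontr)
    assume "\<Sigma> i m \<noteq> 0"
    then obtain a where a: "(a, i) \<in> E\<^sup>*" "(a, m) \<in> E\<^sup>*"
      using correlated_common_ancestor[of i m] parent_less[OF i(1)] m(1) by blast
    have ik: "(i, k) \<in> E" using i(1) by (simp add: parents_def)
    have "(a, i) \<in> (detour E l k)\<^sup>*" "(a, m) \<in> (detour E l k)\<^sup>*"
      using ancestral_detour[OF a(1) dag_no_cycle[OF dagE ik]] ancestral_detour[OF a(2) m(2)] by blast+
    then have "(l, i) \<in> (detour E l k)\<^sup>*"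
      using rtrancl_trans[OF rtrancl_trans[OF m(3) detour_rtrancl_sym]] by blast
    moreover have "(i, k) \<in> detour E l k"
      using ik i(2) dag_irrefl[OF dagE ik] by (auto simp: detour_def adj_def doubleton_eq_iff)
    ultimately have "(l, k) \<in> (detour E l k)\<^sup>*" by (rule rtrancl_into_rtrancl)
    then show False using poly_forest_no_detour[OF forest, of l k] lk by (auto simp: adj_def)
  qed
  have "parents E k \<subseteq> {..<d}" using parent_less by blast
  then have fin: "finite (parents E k)" by (rule finite_subset) simp
  have "\<Sigma> k m = \<beta> l * \<Sigma> l m" if m: "m < d" "(k, m) \<notin> E\<^sup>*" "(l, m) \<in> (detour E l k)\<^sup>*" for m
  proof -
    have "(\<Sum>i\<in>parents E k. \<beta> i * \<Sigma> i m) = (\<Sum>i\<in>{l}. \<beta> i * \<Sigma> i m)"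
      using zero[OF _ _ m] lk fin by (intro sum.mono_neutral_right) (auto simp: parents_def)
    then show ?thesis using \<beta>[OF m(1,2)] by simp
  qed
  from this[OF j lj] this[OF l kl] show ?thesis by simp
qed

text \<open>The separating node is a parent of \<open>k\<close> that is correlated with
  \<open>j\<close>; one exists because \<open>\<Sigma> k j \<noteq> 0\<close>. A common ancestor
  connects this parent with \<open>j\<close> without using its edge to \<open>k\<close>.\<close>

lemma nonadjacent_directed:
  assumes jk: "j < d" "k < d" "\<not> adj E j k" and nd: "(k, j) \<notin> E\<^sup>*" and nz: "\<Sigma> k j \<noteq> 0"
  shows "\<exists>l<d. l \<noteq> j \<and> l \<noteq> k \<and> \<Sigma> k j * \<Sigma> l l = \<Sigma> k l * \<Sigma> l j"
proof -
  note dagE = poly_forest_dag[OF forest]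
  obtain \<beta> where "\<Sigma> k j = (\<Sum>i\<in>parents E k. \<beta> i * \<Sigma> i j)"
    using sem[OF jk(2)] jk(1) nd by blast
  then have "(\<Sum>i\<in>parents E k. \<beta> i * \<Sigma> i j) \<noteq> 0" using nz by simp
  then obtain l where "l \<in> parents E k" "\<beta> l * \<Sigma> l j \<noteq> 0"
    by (rule sum.not_neutral_contains_not_neutral)
  then have l: "l \<in> parents E k" "\<Sigma> l j \<noteq> 0" by auto
  have lk: "(l, k) \<in> E" using l by (simp add: parents_def)
  have "l < d" "l \<noteq> k" "l \<noteq> j"
    using parent_less[OF l(1)] dag_irrefl[OF dagE lk] jk(3) lk by (auto simp: adj_def)
  moreover obtain a where a: "(a, l) \<in> E\<^sup>*" "(a, j) \<in> E\<^sup>*"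
    using correlated_common_ancestor[OF parent_less[OF l(1)] jk(1) l(2)] by blast
  have "(a, l) \<in> (detour E l k)\<^sup>*" "(a, j) \<in> (detour E l k)\<^sup>*"
    using ancestral_detour[OF a(1) dag_no_cycle[OF dagE lk]] ancestral_detour[OF a(2) nd] by blast+
  then have "(l, j) \<in> (detour E l k)\<^sup>*"
    using rtrancl_trans[OF detour_rtrancl_sym] by blast
  ultimately show ?thesis using chain_covariance[OF lk jk(1) nd] by blast
qed

text \<open>\<open>j\<close> is attached to \<open>l\<close> by an edge other than
  \<open>l - k\<close>. If \<open>j\<close> were a descendant of \<open>k\<close>, that connection
  would bypass the edge \<open>l - k\<close>.\<close>

lemma noncollider_directed:
  assumes jl: "adj E j l" and lk: "(l, k) \<in> E" and "j \<noteq> k"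
  shows "\<Sigma> k j * \<Sigma> l l = \<Sigma> k l * \<Sigma> l j"
proof (rule chain_covariance[OF lk])
  note dagE = poly_forest_dag[OF forest]
  have jl': "(l, j) \<in> detour E l k"
    using jl \<open>j \<noteq> k\<close> dag_adj_neq[OF dagE jl] by (auto simp: detour_def adj_def doubleton_eq_iff)
  then show "(l, j) \<in> (detour E l k)\<^sup>*" by blast
  show "j < d" using dag_adj_less[OF dagE jl] by simp
  show "(k, j) \<notin> E\<^sup>*"
  proof
    assume "(k, j) \<in> E\<^sup>*"
    then have "(j, k) \<in> (detour E l k)\<^sup>*"
      using descending_detour[OF dagE lk] detour_rtrancl_sym by blast
    then have "(l, k) \<in> (detour E l k)\<^sup>*" using jl' by (rule converse_rtrancl_into_rtrancl[rotated])
    then show False using poly_forest_no_detour[OF forest, of l k] lk by (auto simp: adj_def)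
  qed
qed

end

context gaussian_law
begin

lemma markov_structural_equation:
  assumes "dag d E" "markov_to d M E" "k < d"
  shows "\<exists>\<beta>. \<forall>m<d. (k, m) \<notin> E\<^sup>* \<longrightarrow> \<Sigma> k m = (\<Sum>i\<in>parents E k. \<beta> i * \<Sigma> i m)"
proof -
  obtain f where f: "\<And>S. S \<subseteq> {..<d} \<Longrightarrow> f S \<in> borel_measurable (leb S)"
      "\<And>S. S \<subseteq> {..<d} \<Longrightarrow> distr M (leb S) (\<lambda>x. restrict x S) = density (leb S) (f S)"
      "AE x in leb {..<d}. f {..<d} x =
             (\<Prod>k<d. f (insert k (parents E k)) (restrict x (insert k (parents E k)))
                      / f (parents E k) (restrict x (parents E k)))"
    using assms(2) unfolding markov_to_def by blast
  interpret markov_gaussian M d \<Sigma> E f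
    by unfold_locales (use assms(1) f sets_M in auto)
  show ?thesis by (rule structural_equation[OF assms(3)])
qed

lemma pcov_eq_0I:
  assumes "j < d" "k < d" "l < d" "\<Sigma> k j * \<Sigma> l l = \<Sigma> k l * \<Sigma> l j"
  shows "pcov l j k = 0"
  using assms Sigma_diag_pos[of l] Sigma_sym[of k j] Sigma_sym[of l j]
  by (simp add: pcov_def field_simps)

lemma pcov_commute: "j < d \<Longrightarrow> k < d \<Longrightarrow> pcov l j k = pcov l k j"
  using Sigma_sym[of j k] by (simp add: pcov_def)

text \<open>Two distinct nodes cannot be descendants of each other, so the structural equation is
  applicable for one order of the pair. Marginally uncorrelated pairs are handled by
  \<open>None\<close>.\<close>

lemma nonadjacent_uncorrelated:
  assumes E: "E \<in> poly_forests d" and mk: "markov_to d M E"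
    and jk: "j < d" "k < d" "j \<noteq> k" "\<not> adj E j k"
  shows "\<exists>l\<in>cond_choices d j k. m_gauss M j k l = 0"
proof (cases "\<Sigma> j k = 0")
  case True
  then show ?thesis using jk
    by (intro bexI[of _ None]) (simp_all add: m_gauss_None cond_choices_def del: m_gauss.simps)
next
  case False
  note sem = markov_structural_equation[OF poly_forest_dag[OF E] mk]
  have "\<exists>l<d. l \<noteq> j \<and> l \<noteq> k \<and> pcov l j k = 0"
  proof (cases "(k, j) \<in> E\<^sup>*")
    case True
    then have "(j, k) \<notin> E\<^sup>*"
      using jk(3) poly_forest_dag[OF E] by (metis acyclic_impl_antisym_rtrancl antisymD dag_def)
    then obtain l where "l < d" "l \<noteq> j" "l \<noteq> k" "\<Sigma> j k * \<Sigma> l l = \<Sigma> j l * \<Sigma> l k"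
      using nonadjacent_directed[OF E sem jk(2,1)] jk(4) False adj_sym by metis
    then show ?thesis using pcov_eq_0I[OF jk(2,1)] pcov_commute[OF jk(1,2)] by metis
  next
    case nd: False
    then obtain l where "l < d" "l \<noteq> j" "l \<noteq> k" "\<Sigma> k j * \<Sigma> l l = \<Sigma> k l * \<Sigma> l j"
      using nonadjacent_directed[OF E sem jk(1,2,4) nd] False Sigma_sym[OF jk(1,2)] by metis
    then show ?thesis using pcov_eq_0I[OF jk(1,2)] by metis
  qed
  then obtain l where l: "l < d" "l \<noteq> j" "l \<noteq> k" "pcov l j k = 0" by blast
  then show ?thesis using jk
    by (intro bexI[of _ "Some l"]) (simp_all add: m_gauss_Some cond_choices_def del: m_gauss.simps)
qed

lemma noncollider_uncorrelated:
  assumes E: "E \<in> poly_forests d" and mk: "markov_to d M E"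
    and jl: "adj E j l" and kl: "adj E k l" and jk: "j \<noteq> k" and nv: "\<not> v_structure E j l k"
  shows "m_gauss M j k (Some l) = 0"
proof -
  note sem = markov_structural_equation[OF poly_forest_dag[OF E] mk]
  note less = dag_adj_less[OF poly_forest_dag[OF E]]
  have jd: "j < d" and kd: "k < d" and ld: "l < d" using less[OF jl] less[OF kl] by auto
  consider "(l, k) \<in> E" | "(l, j) \<in> E"
    using poly_forest_v_structure_iff[OF E] nv jl kl jk by (auto simp: adj_def)
  then have "pcov l j k = 0"
  proof cases
    case 1
    then show ?thesis using noncollider_directed[OF E sem jl 1 jk] pcov_eq_0I[OF jd kd ld] by blast
  next
    case 2
    then show ?thesis
      using noncollider_directed[OF E sem kl 2] jk pcov_eq_0I[OF kd jd ld] pcov_commute[OF jd kd] by metis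
  qed
  then show ?thesis using jd kd ld by (simp add: m_gauss_Some del: m_gauss.simps)
qed

end

subsection \<open>Single-edge alternatives\<close>

lemma PiM_density_prod:
  assumes I: "finite I" and M: "product_sigma_finite M" and MD: "product_sigma_finite (\<lambda>i. density (M i) (f i))"
    and f: "\<And>i. i \<in> I \<Longrightarrow> f i \<in> borel_measurable (M i)"
  shows "PiM I (\<lambda>i. density (M i) (f i)) = density (PiM I M) (\<lambda>x. \<Prod>i\<in>I. f i (x i))"
proof -
  interpret M: product_sigma_finite M by fact
  interpret D: product_sigma_finite "\<lambda>i. density (M i) (f i)" by fact
  have fm: "(\<lambda>x. \<Prod>i\<in>I. f i (x i)) \<in> borel_measurable (PiM I M)"
    using f by (intro borel_measurable_prod_ennreal measurable_PiM_component_rev) auto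
  show ?thesis
  proof (rule D.PiM_eqI[OF I, symmetric])
    show "sets (density (PiM I M) (\<lambda>x. \<Prod>i\<in>I. f i (x i))) = sets (PiM I (\<lambda>i. density (M i) (f i)))"
      by (simp cong: sets_PiM_cong)
    fix A assume A: "\<And>i. i \<in> I \<Longrightarrow> A i \<in> sets (density (M i) (f i))"
    then have A': "\<And>i. i \<in> I \<Longrightarrow> A i \<in> sets (M i)" by simp
    have PA: "Pi\<^sub>E I A \<in> sets (PiM I M)" using I A' by (intro sets_PiM_I_finite)
    have "emeasure (density (PiM I M) (\<lambda>x. \<Prod>i\<in>I. f i (x i))) (Pi\<^sub>E I A) =
        (\<integral>\<^sup>+ x. (\<Prod>i\<in>I. f i (x i)) * indicator (Pi\<^sub>E I A) x \<partial>PiM I M)"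
      using PA fm by (simp add: emeasure_density)
    also have "\<dots> = (\<integral>\<^sup>+ x. (\<Prod>i\<in>I. f i (x i) * indicator (A i) (x i)) \<partial>PiM I M)"
    proof (rule nn_integral_cong)
      fix x assume "x \<in> space (PiM I M)"
      then have "indicator (Pi\<^sub>E I A) x = (\<Prod>i\<in>I. indicator (A i) (x i) :: ennreal)"
        using I by (cases "x \<in> Pi\<^sub>E I A") (auto simp: space_PiM PiE_iff prod.neutral intro!: prod_zero[symmetric] bexI)
      then show "(\<Prod>i\<in>I. f i (x i)) * indicator (Pi\<^sub>E I A) x = (\<Prod>i\<in>I. f i (x i) * indicator (A i) (x i))"
        by (simp add: prod.distrib)
    qed
    also have "\<dots> = (\<Prod>i\<in>I. \<integral>\<^sup>+ x. f i x * indicator (A i) x \<partial>M i)"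
      using f A' by (intro M.product_nn_integral_prod[OF I]) auto
    also have "\<dots> = (\<Prod>i\<in>I. emeasure (density (M i) (f i)) (A i))"
      using f A' by (intro prod.cong refl) (simp add: emeasure_density)
    finally show "emeasure (density (PiM I M) (\<lambda>x. \<Prod>i\<in>I. f i (x i))) (Pi\<^sub>E I A) =
        (\<Prod>i\<in>I. emeasure (density (M i) (f i)) (A i))" .
  qed
qed

text \<open>The density of the normal law with unit variances and correlation \<open>c\<close> with respect to the
  standard normal law in two dimensions.\<close>

definition lr :: "real \<Rightarrow> real \<Rightarrow> real \<Rightarrow> real" where
  "lr c a b = normal_density (c * a) (sqrt (1 - c\<^sup>2)) b / std_normal_density b"

lemma lr_nonneg [simp]: "0 \<le> lr c a b"
  by (simp add: lr_def)

lemma lr_measurable [measurable]: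
  assumes [measurable]: "f \<in> borel_measurable M" "g \<in> borel_measurable M"
  shows "(\<lambda>x. lr c (f x) (g x)) \<in> borel_measurable M"
  unfolding lr_def normal_density_def by measurable

lemma lr_zero: "lr 0 a b = 1"
  using normal_density_pos[of 1 0 b] by (simp add: lr_def)

lemma one_minus_square_pos: "0 \<le> c \<Longrightarrow> c < 1 \<Longrightarrow> 0 < 1 - (c::real)\<^sup>2"
  by (simp add: power_less_one_iff abs_square_less_1)

text \<open>Closed form that exhibits the symmetry of the ratio in its arguments, although it is
  defined by conditioning the second on the first.\<close>

lemma lr_alt:
  assumes c: "0 \<le> c" "c < 1"
  shows "lr c a b = exp (- (c\<^sup>2 * a\<^sup>2 + c\<^sup>2 * b\<^sup>2 - 2 * c * a * b) / (2 * (1 - c\<^sup>2))) / sqrt (1 - c\<^sup>2)"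
proof -
  note s = one_minus_square_pos[OF c]
  have "lr c a b = exp (- (b - c * a)\<^sup>2 / (2 * (1 - c\<^sup>2))) / exp (- b\<^sup>2 / 2) / sqrt (1 - c\<^sup>2)"
    using s by (simp add: lr_def normal_density_def real_sqrt_mult)
  also have "exp (- (b - c * a)\<^sup>2 / (2 * (1 - c\<^sup>2))) / exp (- b\<^sup>2 / 2) =
      exp (- (c\<^sup>2 * a\<^sup>2 + c\<^sup>2 * b\<^sup>2 - 2 * c * a * b) / (2 * (1 - c\<^sup>2)))"
    unfolding exp_diff[symmetric] using s
    by (intro arg_cong[of _ _ exp]) (simp add: field_simps power2_eq_square)
  finally show ?thesis .
qed

lemma lr_commute: "0 \<le> c \<Longrightarrow> c < 1 \<Longrightarrow> lr c a b = lr c b a"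
  by (simp add: lr_alt algebra_simps)

lemma nn_integral_normal_density_1: "0 < \<sigma> \<Longrightarrow> (\<integral>\<^sup>+ x. ennreal (normal_density \<mu> \<sigma> x) \<partial>lborel) = 1"
  using prob_space.emeasure_space_1[OF prob_space_normal_density[of \<sigma> \<mu>]]
  by (simp add: emeasure_density)

text \<open>Substitution \<open>y = c * a + sqrt (1 - c^2) * z\<close>: conditionally on the value
  \<open>a\<close> of the first coordinate, the second is normal with mean \<open>c * a\<close> and
  variance \<open>1 - c^2\<close>.\<close>

lemma nn_integral_lr:
  assumes c: "0 \<le> c" "c < 1" and G[measurable]: "G \<in> borel_measurable borel"
  shows "(\<integral>\<^sup>+ z. G (c * a + sqrt (1 - c\<^sup>2) * z) \<partial>std_normal_distribution) =
    (\<integral>\<^sup>+ y. G y * ennreal (lr c a y) \<partial>std_normal_distribution)"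
proof -
  define s where "s = sqrt (1 - c\<^sup>2)"
  have s: "0 < s" using one_minus_square_pos[OF c] by (simp add: s_def)
  have "(\<integral>\<^sup>+ y. G y * ennreal (lr c a y) \<partial>std_normal_distribution) =
      (\<integral>\<^sup>+ y. G y * ennreal (normal_density (c * a) s y) \<partial>lborel)"
  proof (subst nn_integral_density)
    show "(\<integral>\<^sup>+ y. ennreal (std_normal_density y) * (G y * ennreal (lr c a y)) \<partial>lborel) =
        (\<integral>\<^sup>+ y. G y * ennreal (normal_density (c * a) s y) \<partial>lborel)"
    proof (rule nn_integral_cong)
      fix y
      have "ennreal (std_normal_density y) * ennreal (lr c a y) = ennreal (normal_density (c * a) s y)"
        using normal_density_pos[of 1 0 y] by (simp add: lr_def s_def flip: ennreal_mult)
      then show "ennreal (std_normal_density y) * (G y * ennreal (lr c a y)) = G y * ennreal (normal_density (c * a) s y)"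
        by (simp add: mult.left_commute)
    qed
  qed (auto intro!: borel_measurable_times_ennreal)
  also have "\<dots> = ennreal s * (\<integral>\<^sup>+ z. G (c * a + s * z) * ennreal (normal_density (c * a) s (c * a + s * z)) \<partial>lborel)"
    using s by (subst nn_integral_real_affine[of _ s "c * a"]) simp_all
  also have "\<dots> = (\<integral>\<^sup>+ z. ennreal s * (G (c * a + s * z) * ennreal (normal_density (c * a) s (c * a + s * z))) \<partial>lborel)"
    by (rule nn_integral_cmult[symmetric]) measurable
  also have "\<dots> = (\<integral>\<^sup>+ z. ennreal (std_normal_density z) * G (c * a + s * z) \<partial>lborel)"
  proof (rule nn_integral_cong)
    fix z
    have "s * normal_density (c * a) s (c * a + s * z) = std_normal_density z"
      using s by (simp add: normal_density_def power_mult_distrib real_sqrt_mult)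
    then have "ennreal s * ennreal (normal_density (c * a) s (c * a + s * z)) = ennreal (std_normal_density z)"
      using s by (simp flip: ennreal_mult)
    moreover have "x * (y * w) = (x * w) * y" for x y w :: ennreal by (simp add: mult_ac)
    ultimately show "ennreal s * (G (c * a + s * z) * ennreal (normal_density (c * a) s (c * a + s * z))) =
        ennreal (std_normal_density z) * G (c * a + s * z)"
      by simp
  qed
  also have "\<dots> = (\<integral>\<^sup>+ z. G (c * a + s * z) \<partial>std_normal_distribution)"
    by (subst nn_integral_density) simp_all
  finally show ?thesis by (simp add: s_def)
qed

lemma nn_integral_lr_1:
  assumes "0 \<le> c" "c < 1"
  shows "(\<integral>\<^sup>+ y. ennreal (lr c a y) \<partial>std_normal_distribution) = 1"
  using nn_integral_lr[OF assms, of "\<lambda>_. 1" a]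
    prob_space.emeasure_space_1[OF prob_space_normal_density[of 1 0]] by simp

text \<open>Completing the square splits the integrand into a normal density in \<open>a\<close> of
  variance \<open>(1 + c^2) / (1 - c^2)\<close> and one in \<open>b\<close> of the reciprocal
  variance, centred at \<open>2 * c * a / (1 + c^2)\<close>. The factor \<open>1 / (1 - c^2)\<close>
  is what remains.\<close>

lemma nn_integral_lr_square:
  assumes c: "0 \<le> c" "c < 1"
  shows "(\<integral>\<^sup>+ a. (\<integral>\<^sup>+ b. ennreal (lr c a b * lr c a b) \<partial>std_normal_distribution) \<partial>std_normal_distribution) =
    ennreal (1 / (1 - c\<^sup>2))"
proof -
  note p = one_minus_square_pos[OF c]
  have p': "0 < 1 + c\<^sup>2" by (simp add: add_pos_nonneg)
  define \<sigma> where "\<sigma> = sqrt ((1 + c\<^sup>2) / (1 - c\<^sup>2))"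
  define \<tau> where "\<tau> = sqrt ((1 - c\<^sup>2) / (1 + c\<^sup>2))"
  have \<sigma>\<tau>: "0 < \<sigma>" "0 < \<tau>" "\<sigma>\<^sup>2 = (1 + c\<^sup>2) / (1 - c\<^sup>2)" "\<tau>\<^sup>2 = (1 - c\<^sup>2) / (1 + c\<^sup>2)" "\<sigma> * \<tau> = 1"
    using p p' by (simp_all add: \<sigma>_def \<tau>_def flip: real_sqrt_mult)
  have key: "std_normal_density a * (std_normal_density b * (lr c a b * lr c a b)) =
      1 / (1 - c\<^sup>2) * normal_density 0 \<sigma> a * normal_density (2 * c * a / (1 + c\<^sup>2)) \<tau> b" for a b
  proof -
    have "exp (x / (2 * y)) * exp (x / (2 * y)) = exp (x / y)" for x y :: real
      by (simp flip: exp_add)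
    then have "lr c a b * lr c a b =
        exp (- (c\<^sup>2 * a\<^sup>2 + c\<^sup>2 * b\<^sup>2 - 2 * c * a * b) / (1 - c\<^sup>2)) / (1 - c\<^sup>2)"
      using p by (simp only: lr_alt[OF c] times_divide_times_eq real_sqrt_mult_self abs_of_pos)
    then have "std_normal_density a * (std_normal_density b * (lr c a b * lr c a b)) =
        (exp (- a\<^sup>2 / 2) * (exp (- b\<^sup>2 / 2) *
          exp (- (c\<^sup>2 * a\<^sup>2 + c\<^sup>2 * b\<^sup>2 - 2 * c * a * b) / (1 - c\<^sup>2)))) / (2 * pi * (1 - c\<^sup>2))"
      by (simp add: std_normal_density_def)
    also have "exp (- a\<^sup>2 / 2) * (exp (- b\<^sup>2 / 2) *
          exp (- (c\<^sup>2 * a\<^sup>2 + c\<^sup>2 * b\<^sup>2 - 2 * c * a * b) / (1 - c\<^sup>2))) =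
        exp (- a\<^sup>2 / (2 * \<sigma>\<^sup>2)) * exp (- (b - 2 * c * a / (1 + c\<^sup>2))\<^sup>2 / (2 * \<tau>\<^sup>2))"
    proof -
      have "- a\<^sup>2 / 2 + (- b\<^sup>2 / 2 + - (c\<^sup>2 * a\<^sup>2 + c\<^sup>2 * b\<^sup>2 - 2 * c * a * b) / (1 - c\<^sup>2)) =
          - a\<^sup>2 / (2 * ((1 + c\<^sup>2) / (1 - c\<^sup>2))) +
          - (b - 2 * c * a / (1 + c\<^sup>2))\<^sup>2 / (2 * ((1 - c\<^sup>2) / (1 + c\<^sup>2)))"
      proof -
        define P where "P = 1 - c\<^sup>2"
        define Q where "Q = 1 + c\<^sup>2"
        have PQ: "P > 0" "Q > 0" using p p' by (simp_all add: P_def Q_def)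
        have "(b - 2 * c * a / Q)\<^sup>2 / (2 * (P / Q)) = (b\<^sup>2 * Q - 4 * c * a * b + 4 * c\<^sup>2 * a\<^sup>2 / Q) / (2 * P)"
          using PQ by (simp add: field_simps power2_eq_square)
        moreover have "4 * c\<^sup>2 * a\<^sup>2 / Q = (Q - P * P / Q) * a\<^sup>2"
          using PQ by (simp add: field_simps) (simp add: P_def Q_def power2_eq_square algebra_simps)
        ultimately have "- a\<^sup>2 / (2 * (Q / P)) + - (b - 2 * c * a / Q)\<^sup>2 / (2 * (P / Q)) =
            - (a\<^sup>2 * P / (2 * Q)) - (b\<^sup>2 * Q - 4 * c * a * b + (Q - P * P / Q) * a\<^sup>2) / (2 * P)"
          by (simp only: minus_divide_left[symmetric]) simp
        also have "\<dots> = - (a\<^sup>2 * Q + b\<^sup>2 * Q - 4 * c * a * b) / (2 * P)"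
          using PQ by (simp add: field_simps)
        also have "\<dots> = - a\<^sup>2 / 2 + (- b\<^sup>2 / 2 + - (c\<^sup>2 * a\<^sup>2 + c\<^sup>2 * b\<^sup>2 - 2 * c * a * b) / P)"
          using PQ(1) by (simp add: field_simps) (simp add: P_def Q_def power2_eq_square algebra_simps)
        finally show ?thesis by (simp add: P_def Q_def)
      qed
      then show ?thesis by (simp only: exp_add[symmetric] \<sigma>\<tau>)
    qed
    also have "(exp (- a\<^sup>2 / (2 * \<sigma>\<^sup>2)) * exp (- (b - 2 * c * a / (1 + c\<^sup>2))\<^sup>2 / (2 * \<tau>\<^sup>2))) / (2 * pi * (1 - c\<^sup>2)) =
        1 / (1 - c\<^sup>2) * normal_density 0 \<sigma> a * normal_density (2 * c * a / (1 + c\<^sup>2)) \<tau> b"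
    proof -
      have "sqrt (2 * pi * \<sigma>\<^sup>2) * sqrt (2 * pi * \<tau>\<^sup>2) = 2 * pi"
      proof -
        have "(2 * pi * \<sigma>\<^sup>2) * (2 * pi * \<tau>\<^sup>2) = (2 * pi)\<^sup>2 * (\<sigma> * \<tau>)\<^sup>2"
          by (simp add: power2_eq_square mult_ac)
        then have "sqrt ((2 * pi * \<sigma>\<^sup>2) * (2 * pi * \<tau>\<^sup>2)) = 2 * pi"
          using \<sigma>\<tau>(5) by (simp add: real_sqrt_unique)
        then show ?thesis by (simp only: real_sqrt_mult)
      qed
      then show ?thesis by (simp add: normal_density_def)
    qed
    finally show ?thesis .
  qed
  have "(\<integral>\<^sup>+ a. (\<integral>\<^sup>+ b. ennreal (lr c a b * lr c a b) \<partial>std_normal_distribution) \<partial>std_normal_distribution) =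
      (\<integral>\<^sup>+ a. ennreal (std_normal_density a) * (\<integral>\<^sup>+ b. ennreal (std_normal_density b) * ennreal (lr c a b * lr c a b) \<partial>lborel) \<partial>lborel)"
    by (subst nn_integral_density) (simp_all add: nn_integral_density)
  also have "\<dots> = (\<integral>\<^sup>+ a. (\<integral>\<^sup>+ b. ennreal (1 / (1 - c\<^sup>2) * normal_density 0 \<sigma> a) *
      ennreal (normal_density (2 * c * a / (1 + c\<^sup>2)) \<tau> b) \<partial>lborel) \<partial>lborel)"
    using p by (intro nn_integral_cong, subst nn_integral_cmult[symmetric])
      (simp_all add: key flip: ennreal_mult)
  also have "\<dots> = (\<integral>\<^sup>+ a. ennreal (1 / (1 - c\<^sup>2)) * ennreal (normal_density 0 \<sigma> a) \<partial>lborel)"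
  proof (rule nn_integral_cong)
    fix a
    have "(\<integral>\<^sup>+ b. ennreal (1 / (1 - c\<^sup>2) * normal_density 0 \<sigma> a) *
        ennreal (normal_density (2 * c * a / (1 + c\<^sup>2)) \<tau> b) \<partial>lborel) = ennreal (1 / (1 - c\<^sup>2) * normal_density 0 \<sigma> a)"
      by (subst nn_integral_cmult, simp, subst nn_integral_normal_density_1[OF \<sigma>\<tau>(2)], simp)
    also have "\<dots> = ennreal (1 / (1 - c\<^sup>2)) * ennreal (normal_density 0 \<sigma> a)"
      using p by (intro ennreal_mult) auto
    finally show "(\<integral>\<^sup>+ b. ennreal (1 / (1 - c\<^sup>2) * normal_density 0 \<sigma> a) *
        ennreal (normal_density (2 * c * a / (1 + c\<^sup>2)) \<tau> b) \<partial>lborel) =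
        ennreal (1 / (1 - c\<^sup>2)) * ennreal (normal_density 0 \<sigma> a)" .
  qed
  also have "\<dots> = ennreal (1 / (1 - c\<^sup>2))"
    by (simp add: nn_integral_cmult nn_integral_normal_density_1[OF \<sigma>\<tau>(1)])
  finally show ?thesis .
qed

section \<open>Standard normal products and laws with a single correlated pair\<close>

abbreviation snv :: "nat set \<Rightarrow> (nat \<Rightarrow> real) measure" where
  "snv S \<equiv> (\<Pi>\<^sub>M i\<in>S. std_normal_distribution)"

interpretation snv: product_sigma_finite "\<lambda>_::nat. std_normal_distribution"
  by (intro product_sigma_finite.intro prob_space_imp_sigma_finite prob_space_normal_density) simp

lemma sets_snv: "sets (snv S) = sets (leb S)"
  by (intro sets_PiM_cong) simp_all

lemma snv_component: "i \<in> S \<Longrightarrow> (\<lambda>x. x i) \<in> borel_measurable (snv S)"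
  using measurable_component_singleton[of i S "\<lambda>_. std_normal_distribution"] by simp

lemma snv_density:
  assumes "finite S"
  shows "snv S = density (leb S) (\<lambda>x. \<Prod>i\<in>S. ennreal (std_normal_density (x i)))"
  by (rule PiM_density_prod[OF assms leb.product_sigma_finite_axioms snv.product_sigma_finite_axioms]) simp

lemma nn_integral_snv_restrict:
  assumes "finite T" "S \<subseteq> T" "g \<in> borel_measurable (snv S)"
  shows "(\<integral>\<^sup>+ x. g (restrict x S) \<partial>snv T) = (\<integral>\<^sup>+ x. g x \<partial>snv S)"
proof -
  have "finite S" using assms(1,2) by (rule rev_finite_subset)
  then have d: "distr (snv T) (snv S) (\<lambda>x. restrict x S) = snv S"
    by (intro product_prob_space.distr_PiM_restrict_finite[OF product_prob_spaceI _ assms(2)]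
        prob_space_normal_density) simp
  have "(\<integral>\<^sup>+ x. g x \<partial>snv S) = (\<integral>\<^sup>+ x. g x \<partial>distr (snv T) (snv S) (\<lambda>x. restrict x S))"
    by (simp only: d)
  also have "\<dots> = (\<integral>\<^sup>+ x. g (restrict x S) \<partial>snv T)"
    by (rule nn_integral_distr[OF measurable_restrict_subset[OF assms(2)]]) (simp add: assms(3))
  finally show ?thesis by simp
qed

text \<open>For each value of \<open>x a\<close> the ratio integrates to 1 over \<open>x b\<close>.
  This yields the marginals of the single-edge laws as well as the mixed second moments of two
  different edges.\<close>

lemma nn_integral_lr_marginal:
  assumes c: "0 \<le> c" "c < 1" and T: "finite T" "a \<in> T" "b \<in> T" "a \<noteq> b"
    and h[measurable]: "h \<in> borel_measurable (snv T)" and ignore: "\<And>x z. h (x(b := z)) = h x"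
  shows "(\<integral>\<^sup>+ x. h x * ennreal (lr c (x a) (x b)) \<partial>snv T) = (\<integral>\<^sup>+ x. h x \<partial>snv T)"
proof -
  define I where "I = T - {b}"
  have TI: "T = insert b I" "finite I" "b \<notin> I" "a \<in> I" using T by (auto simp: I_def)
  have [measurable]: "(\<lambda>x. x a) \<in> borel_measurable (snv T)" "(\<lambda>x. x b) \<in> borel_measurable (snv T)"
    using T by (auto intro: snv_component)
  have m: "(\<lambda>x. h x * ennreal (lr c (x a) (x b))) \<in> borel_measurable (snv (insert b I))"
    unfolding TI(1)[symmetric] by measurable
  have m': "h \<in> borel_measurable (snv (insert b I))" using h by (simp add: TI(1))
  have "(\<integral>\<^sup>+ x. h x * ennreal (lr c (x a) (x b)) \<partial>snv T) =
      (\<integral>\<^sup>+ x. (\<integral>\<^sup>+ z. h x * ennreal (lr c (x a) z) \<partial>std_normal_distribution) \<partial>snv I)"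
    unfolding TI(1) using snv.product_nn_integral_insert[OF TI(2,3) m] T(4) by (simp add: ignore)
  also have "\<dots> = (\<integral>\<^sup>+ x. (\<integral>\<^sup>+ z. h x \<partial>std_normal_distribution) \<partial>snv I)"
    using prob_space.emeasure_space_1[OF prob_space_normal_density[of 1 0]]
    by (simp add: nn_integral_cmult nn_integral_lr_1[OF c])
  also have "\<dots> = (\<integral>\<^sup>+ x. h x \<partial>snv T)"
    unfolding TI(1) using snv.product_nn_integral_insert[OF TI(2,3) m'] by (simp add: ignore)
  finally show ?thesis .
qed

lemma nn_integral_lr_square_snv:
  assumes c: "0 \<le> c" "c < 1" and T: "finite T" "a \<in> T" "b \<in> T" "a \<noteq> b"
  shows "(\<integral>\<^sup>+ x. ennreal (lr c (x a) (x b) * lr c (x a) (x b)) \<partial>snv T) = ennreal (1 / (1 - c\<^sup>2))"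
proof -
  define I where "I = T - {b}"
  have TI: "T = insert b I" "finite I" "b \<notin> I" "a \<in> I" using T by (auto simp: I_def)
  have [measurable]: "(\<lambda>x. x a) \<in> borel_measurable (snv T)" "(\<lambda>x. x b) \<in> borel_measurable (snv T)"
    using T by (auto intro: snv_component)
  have m: "(\<lambda>x. ennreal (lr c (x a) (x b) * lr c (x a) (x b))) \<in> borel_measurable (snv (insert b I))"
    unfolding TI(1)[symmetric] by measurable
  interpret N: prob_space std_normal_distribution by (rule prob_space_normal_density) simp
  define F where "F = (\<lambda>y. \<integral>\<^sup>+ z. ennreal (lr c y z * lr c y z) \<partial>std_normal_distribution)"
  have Fm: "F \<in> borel_measurable std_normal_distribution" unfolding F_def by measurable
  have "(\<integral>\<^sup>+ x. ennreal (lr c (x a) (x b) * lr c (x a) (x b)) \<partial>snv T) = (\<integral>\<^sup>+ x. F (x a) \<partial>snv I)"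
    unfolding TI(1) F_def using snv.product_nn_integral_insert[OF TI(2,3) m] T(4) by simp
  also have "\<dots> = (\<integral>\<^sup>+ y. F y \<partial>distr (snv I) std_normal_distribution (\<lambda>x. x a))"
    by (rule nn_integral_distr[symmetric, OF measurable_component_singleton[OF TI(4)]]) (use Fm in simp)
  also have "\<dots> = (\<integral>\<^sup>+ y. F y \<partial>std_normal_distribution)"
    using distr_PiM_component[of I "\<lambda>_. std_normal_distribution" a] TI(4) N.prob_space_axioms by simp
  also have "\<dots> = ennreal (1 / (1 - c\<^sup>2))" unfolding F_def by (rule nn_integral_lr_square[OF c])
  finally show ?thesis .
qed

text \<open>Coordinates \<open>0\<close> and \<open>k\<close> have correlation \<open>c\<close> and
  the others are independent. The density relative to the standard normal law makes the likelihood
  ratio explicit; that this is a normal law is then a matter of proof.\<close>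

definition edge_law :: "nat \<Rightarrow> nat \<Rightarrow> real \<Rightarrow> (nat \<Rightarrow> real) measure" where
  "edge_law d k c = density (std_normal_vec d) (\<lambda>x. ennreal (lr c (x 0) (x k)))"

definition edge_cov :: "nat \<Rightarrow> real \<Rightarrow> nat \<Rightarrow> nat \<Rightarrow> real" where
  "edge_cov k c i j = (if i = j then 1 else if {i, j} = {0, k} then c else 0)"

lemma std_normal_vec_snv: "std_normal_vec d = snv {..<d}"
  by (simp add: std_normal_vec_def)

text \<open>The mixed term \<open>2 * c * v 0 * v k\<close> is in absolute value at most
  \<open>c\<close> times the sum of squares, and \<open>c < 1\<close>.\<close>

lemma pos_def_edge_cov:
  assumes k: "0 < k" "k < d" and c: "0 \<le> c" "c < 1"
  shows "pos_def d (edge_cov k c)"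
  unfolding pos_def_def
proof (intro conjI allI impI)
  show "edge_cov k c i j = edge_cov k c j i" for i j
    by (auto simp: edge_cov_def insert_commute)
  fix v :: "nat \<Rightarrow> real" assume "\<exists>i<d. v i \<noteq> 0"
  then obtain h where h: "h < d" "v h \<noteq> 0" by blast
  have inner: "(\<Sum>j<d. v i * edge_cov k c i j * v j) =
      (v i)\<^sup>2 + (if i = 0 then c * v 0 * v k else 0) + (if i = k then c * v 0 * v k else 0)" if "i < d" for i
  proof -
    have "v i * edge_cov k c i j * v j = (if j = i then (v i)\<^sup>2 else 0) +
        (if j = k then (if i = 0 then c * v 0 * v k else 0) else 0) +
        (if j = 0 then (if i = k then c * v 0 * v k else 0) else 0)" for j
      using k by (auto simp: edge_cov_def power2_eq_square doubleton_eq_iff)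
    then show ?thesis using that k by (simp add: sum.distrib)
  qed
  have "(\<Sum>i<d. \<Sum>j<d. v i * edge_cov k c i j * v j) =
      (\<Sum>i<d. (v i)\<^sup>2 + (if i = 0 then c * v 0 * v k else 0) + (if i = k then c * v 0 * v k else 0))"
    by (intro sum.cong refl inner) simp
  also have "\<dots> = (\<Sum>i<d. (v i)\<^sup>2) + 2 * (c * (v 0 * v k))" using k by (simp add: sum.distrib)
  also have "\<dots> > 0"
  proof -
    have "(v h)\<^sup>2 \<le> (\<Sum>i<d. (v i)\<^sup>2)" using h by (intro member_le_sum) auto
    then have S: "0 < (\<Sum>i<d. (v i)\<^sup>2)" using h(2) by (smt (verit) zero_less_power2)
    have "(\<Sum>i\<in>{0, k}. (v i)\<^sup>2) \<le> (\<Sum>i<d. (v i)\<^sup>2)" using k by (intro sum_mono2) auto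
    then have "(v 0)\<^sup>2 + (v k)\<^sup>2 \<le> (\<Sum>i<d. (v i)\<^sup>2)" using k by simp
    moreover have "- (2 * (v 0 * v k)) \<le> (v 0)\<^sup>2 + (v k)\<^sup>2"
      using zero_le_power2[of "v 0 + v k"] by (simp add: power2_sum)
    ultimately have "c * - (2 * (v 0 * v k)) \<le> c * (\<Sum>i<d. (v i)\<^sup>2)"
      using c by (intro mult_left_mono) auto
    moreover have "c * (\<Sum>i<d. (v i)\<^sup>2) < 1 * (\<Sum>i<d. (v i)\<^sup>2)"
      using c S by (intro mult_strict_right_mono) auto
    ultimately show ?thesis by (simp add: mult_ac)
  qed
  finally show "(\<Sum>i<d. \<Sum>j<d. v i * edge_cov k c i j * v j) > 0" .
qed

text \<open>\<open>A\<close> is the identity except for row \<open>k\<close>, which has the entries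
  \<open>c\<close> at \<open>0\<close> and \<open>sqrt (1 - c^2)\<close> at \<open>k\<close>.
  Integrating over coordinate \<open>k\<close> first identifies the image measure with the
  density.\<close>

lemma is_normal_law_edge_law:
  assumes k: "0 < k" "k < d" and c: "0 \<le> c" "c < 1"
  shows "is_normal_law d (edge_cov k c) (edge_law d k c)"
proof -
  define s where "s = sqrt (1 - c\<^sup>2)"
  define A where "A = (\<lambda>i. if i = k then (\<lambda>j. c * unit 0 j + s * unit k j) else unit i)"
  have lin_A: "lin d (A i) x = (if i = k then c * x 0 + s * x k else x i)" if "i < d" for i x
    using that k by (simp add: A_def lin_combine lin_unit)
  have "edge_cov k c i j = (\<Sum>l<d. A i l * A j l)" if "i < d" "j < d" for i j
  proof -
    have "s * s = 1 - c\<^sup>2" using one_minus_square_pos[OF c] by (simp add: s_def)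
    then have "lin d (A i) (A j) = edge_cov k c i j"
      unfolding lin_A[OF that(1)] using k by (auto simp: A_def unit_def edge_cov_def doubleton_eq_iff power2_eq_square)
    then show ?thesis by (simp add: lin_def)
  qed
  moreover have "edge_law d k c = distr (std_normal_vec d) (vec_space d) (\<lambda>w. \<lambda>i\<in>{..<d}. \<Sum>l<d. A i l * w l)"
  proof (rule measure_eqI)
    show "sets (edge_law d k c) = sets (distr (std_normal_vec d) (vec_space d) (\<lambda>w. \<lambda>i\<in>{..<d}. \<Sum>l<d. A i l * w l))"
      by (simp add: edge_law_def sets_std_normal_vec)
    fix B assume "B \<in> sets (edge_law d k c)"
    then have B: "B \<in> sets (vec_space d)" by (simp add: edge_law_def sets_std_normal_vec)
    define I where "I = {..<d} - {k}"
    have I: "{..<d} = insert k I" "finite I" "k \<notin> I" "0 \<in> I" using k by (auto simp: I_def)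
    let ?S = "snv (insert k I)"
    have S: "std_normal_vec d = ?S" by (simp add: std_normal_vec_snv I(1))
    have sS: "sets ?S = sets (vec_space d)" using sets_std_normal_vec[of d] S by simp
    have [measurable]: "B \<in> sets ?S" using B sS by simp
    have cm[measurable]: "(\<lambda>x. x 0) \<in> borel_measurable ?S" "(\<lambda>x. x k) \<in> borel_measurable ?S"
      using I by (auto intro: snv_component)
    let ?T = "\<lambda>w. \<lambda>i\<in>{..<d}. \<Sum>l<d. A i l * w l"
    have T: "?T w = w(k := c * w 0 + s * w k)" if "w \<in> space ?S" for w
    proof
      fix i
      show "?T w i = (w(k := c * w 0 + s * w k)) i"
      proof (cases "i < d")
        case True
        then show ?thesis using lin_A[of i w] by (simp add: lin_def)
      next
        case False
        then have "i \<notin> insert k I" using I(1) by auto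
        then show ?thesis using that False k by (auto simp: space_PiM PiE_iff extensional_def)
      qed
    qed
    have Tm: "?T \<in> measurable ?S (vec_space d)"
    proof -
      have "(\<lambda>w. w(k := c * w 0 + s * w k)) \<in> measurable ?S (snv (insert k I))"
        by (rule measurable_fun_upd[of _ "insert k I"]) (auto intro: cm)
      then have "?T \<in> measurable ?S (snv (insert k I))" by (subst measurable_cong[OF T])
      then show ?thesis by (simp add: measurable_cong_sets[OF refl sS])
    qed
    have "emeasure (distr ?S (vec_space d) ?T) B = (\<integral>\<^sup>+ w. indicator B (?T w) \<partial>?S)"
      by (rule emeasure_distr_nn_integral[OF Tm B])
    also have "\<dots> = (\<integral>\<^sup>+ w. indicator B (w(k := c * w 0 + s * w k)) \<partial>?S)"
      by (intro nn_integral_cong) (simp only: T)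
    also have "\<dots> = (\<integral>\<^sup>+ w. (\<integral>\<^sup>+ z. indicator B (w(k := c * w 0 + s * z)) \<partial>std_normal_distribution) \<partial>snv I)"
    proof -
      have "(\<lambda>w. w(k := c * w 0 + s * w k)) \<in> measurable ?S ?S"
        by (rule measurable_fun_upd[of _ "insert k I"]) (auto intro: cm)
      then have "(\<lambda>w. indicator B (w(k := c * w 0 + s * w k)) :: ennreal) \<in> borel_measurable ?S"
        by measurable
      from snv.product_nn_integral_insert[OF I(2,3) this] show ?thesis using I k by simp
    qed
    also have "\<dots> = (\<integral>\<^sup>+ w. (\<integral>\<^sup>+ z. indicator B (w(k := z)) * ennreal (lr c (w 0) z) \<partial>std_normal_distribution) \<partial>snv I)"
    proof (rule nn_integral_cong)
      fix w assume w: "w \<in> space (snv I)"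
      have "(\<lambda>z. w(k := z)) \<in> measurable std_normal_distribution ?S"
        using measurable_component_update[OF w I(3)] .
      then have "(\<lambda>z. indicator B (w(k := z)) :: ennreal) \<in> borel_measurable std_normal_distribution"
        by measurable
      then have "(\<lambda>z. indicator B (w(k := z)) :: ennreal) \<in> borel_measurable borel" by simp
      from nn_integral_lr[OF c this, of "w 0"]
      show "(\<integral>\<^sup>+ z. indicator B (w(k := c * w 0 + s * z)) \<partial>std_normal_distribution) =
          (\<integral>\<^sup>+ z. indicator B (w(k := z)) * ennreal (lr c (w 0) z) \<partial>std_normal_distribution)"
        by (simp add: s_def)
    qed
    also have "\<dots> = (\<integral>\<^sup>+ w. indicator B w * ennreal (lr c (w 0) (w k)) \<partial>?S)"
    proof -
      have "(\<lambda>w. indicator B w * ennreal (lr c (w 0) (w k))) \<in> borel_measurable ?S" by measurable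
      from snv.product_nn_integral_insert[OF I(2,3) this] show ?thesis using k by simp
    qed
    also have "\<dots> = emeasure (edge_law d k c) B"
      unfolding edge_law_def S by (simp add: emeasure_density mult.commute)
    finally show "emeasure (edge_law d k c) B = emeasure (distr (std_normal_vec d) (vec_space d) ?T) B"
      by (simp add: S)
  qed
  ultimately show ?thesis unfolding is_normal_law_def by blast
qed

lemma gaussian_law_edge_law:
  assumes "0 < k" "k < d" "0 \<le> c" "c < 1"
  shows "gaussian_law (edge_law d k c) d (edge_cov k c)"
  by (intro gaussian_law_if_normal_law pos_def_edge_cov is_normal_law_edge_law assms)

lemma edge_law_gaussian:
  assumes "0 < k" "k < d" "0 \<le> c" "c < 1"
  shows "edge_law d k c \<in> gaussian_laws d"
  unfolding gaussian_laws_def using pos_def_edge_cov[OF assms] is_normal_law_edge_law[OF assms] by blast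

lemma edge_law_0: "edge_law d k 0 = std_normal_vec d"
  by (simp add: edge_law_def lr_zero density_1)

lemma m_gauss_edge_law:
  assumes k: "0 < k" "k < d" and c: "0 \<le> c" "c < 1"
    and ab: "{a, b} = {0, k}" and l: "l \<in> cond_choices d a b"
  shows "m_gauss (edge_law d k c) a b l = c"
proof -
  interpret gaussian_law "edge_law d k c" d "edge_cov k c" by (rule gaussian_law_edge_law[OF k c])
  have abd: "a < d" "b < d" "a \<noteq> b" using ab k by (auto simp: doubleton_eq_iff)
  show ?thesis
  proof (cases l)
    case None
    then show ?thesis using abd ab c by (simp add: m_gauss_None edge_cov_def del: m_gauss.simps)
  next
    case (Some h)
    then have "h < d" "h \<noteq> a" "h \<noteq> b" using l by (auto simp: cond_choices_def)
    moreover from this have "edge_cov k c a h = 0" "edge_cov k c b h = 0"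
      using ab by (auto simp: edge_cov_def doubleton_eq_iff)
    ultimately show ?thesis using Some abd ab c
      by (simp add: m_gauss_Some pcov_def edge_cov_def del: m_gauss.simps)
  qed
qed

section \<open>Graphs and Markov property of the single-edge laws\<close>

lemma short_paths_poly_forest:
  assumes dag: "dag d E" and few: "\<And>x y z. adj E x y \<Longrightarrow> adj E y z \<Longrightarrow> x = z"
  shows "E \<in> poly_forests d"
proof -
  have shape: "p = (if a = b then [a] else [a, b])" if p: "path_between E a b p" for a b p
  proof (cases p)
    case Nil
    then show ?thesis using p by (simp add: path_between_def)
  next
    case (Cons x p1)
    show ?thesis
    proof (cases p1)
      case Nil
      then show ?thesis using p Cons by (auto simp: path_between_def)
    next
      case c2: (Cons y p2)
      have "p2 = []"
        using p few Cons c2 by (cases p2) (auto simp: path_between_def)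
      then show ?thesis using p Cons c2 by (auto simp: path_between_def)
    qed
  qed
  have "p = q" if "path_between E a b p" "path_between E a b q" for a b p q
    by (simp only: shape[OF that(1)] shape[OF that(2)])
  then show ?thesis using dag unfolding poly_forests_def by blast
qed

lemma empty_poly_forest: "{} \<in> poly_forests d"
  by (rule short_paths_poly_forest) (auto simp: dag_def adj_def acyclic_def)

lemma single_edge_poly_forest:
  assumes "0 < k" "k < d"
  shows "{(0, k)} \<in> poly_forests d"
proof (rule short_paths_poly_forest)
  show "dag d {(0, k)}"
    using assms by (auto simp: dag_def acyclic_insert acyclic_def[of "{}"])
qed (use assms in \<open>auto simp: adj_def\<close>)

text \<open>If \<open>0\<close> or \<open>k\<close> is missing from \<open>S\<close>, the ratio
  integrates out and the marginal is standard normal; for a missing \<open>0\<close> this uses the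
  symmetry of \<open>lr\<close>.\<close>

lemma nn_integral_edge_law_restrict:
  assumes k: "0 < k" "k < d" and c: "0 \<le> c" "c < 1" and S: "S \<subseteq> {..<d}"
    and g: "g \<in> borel_measurable (leb S)"
  shows "(\<integral>\<^sup>+ x. g (restrict x S) \<partial>edge_law d k c) =
    (\<integral>\<^sup>+ x. (\<Prod>i\<in>S. ennreal (std_normal_density (x i))) *
      (if 0 \<in> S \<and> k \<in> S then ennreal (lr c (x 0) (x k)) else 1) * g x \<partial>leb S)"
proof -
  let ?V = "{..<d}"
  have fin: "finite S" using S by (rule finite_subset) simp
  have gS: "g \<in> borel_measurable (snv S)" using g by (simp add: measurable_cong_sets[OF sets_snv refl])
  have gV: "(\<lambda>x. g (restrict x S)) \<in> borel_measurable (snv ?V)"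
    using measurable_compose[OF measurable_restrict_subset[OF S] gS] .
  have lrV: "(\<lambda>x. ennreal (lr c (x 0) (x k))) \<in> borel_measurable (snv ?V)"
    using k snv_component[of 0 ?V] snv_component[of k ?V]
    by (intro measurable_compose[OF _ measurable_ennreal] lr_measurable) auto
  have dens: "(\<integral>\<^sup>+ x. h x \<partial>snv S) = (\<integral>\<^sup>+ x. (\<Prod>i\<in>S. ennreal (std_normal_density (x i))) * h x \<partial>leb S)"
    if h: "h \<in> borel_measurable (leb S)" for h
  proof -
    have "(\<lambda>x. \<Prod>i\<in>S. ennreal (std_normal_density (x i))) \<in> borel_measurable (leb S)"
      using measurable_component_singleton[of _ S "\<lambda>_. lborel :: real measure"]
      by (intro borel_measurable_prod_ennreal measurable_compose[OF _ measurable_ennreal]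
        measurable_compose[OF _ borel_measurable_normal_density]) simp
    then show ?thesis unfolding snv_density[OF fin] using h by (rule nn_integral_density)
  qed
  have "(\<integral>\<^sup>+ x. g (restrict x S) \<partial>edge_law d k c) =
      (\<integral>\<^sup>+ x. g (restrict x S) * ennreal (lr c (x 0) (x k)) \<partial>snv ?V)"
    unfolding edge_law_def std_normal_vec_snv
    by (subst nn_integral_density[OF lrV gV]) (simp add: mult.commute)
  also have "\<dots> = (\<integral>\<^sup>+ x. (\<Prod>i\<in>S. ennreal (std_normal_density (x i))) *
      (if 0 \<in> S \<and> k \<in> S then ennreal (lr c (x 0) (x k)) else 1) * g x \<partial>leb S)"
  proof -
    have drop: "(\<integral>\<^sup>+ x. g (restrict x S) * ennreal (lr c (x a) (x b)) \<partial>snv ?V) =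
        (\<integral>\<^sup>+ x. (\<Prod>i\<in>S. ennreal (std_normal_density (x i))) * g x \<partial>leb S)"
      if "a < d" "b < d" "a \<noteq> b" "b \<notin> S" for a b
    proof -
      have "(\<integral>\<^sup>+ x. g (restrict x S) * ennreal (lr c (x a) (x b)) \<partial>snv ?V) = (\<integral>\<^sup>+ x. g (restrict x S) \<partial>snv ?V)"
        by (rule nn_integral_lr_marginal[OF c _ _ _ _ gV]) (use that in \<open>auto simp: restrict_upd\<close>)
      also have "\<dots> = (\<integral>\<^sup>+ x. g x \<partial>snv S)" by (rule nn_integral_snv_restrict[OF _ S gS]) simp
      finally show ?thesis using dens[OF g] by simp
    qed
    consider "0 \<in> S \<and> k \<in> S" | "k \<notin> S" | "0 \<notin> S" "k \<in> S" by blast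
    then show ?thesis
    proof cases
      case 1
      have m: "(\<lambda>x. g x * ennreal (lr c (x 0) (x k))) \<in> borel_measurable (snv S)"
        using 1 snv_component[of 0 S] snv_component[of k S]
        by (intro borel_measurable_times_ennreal gS measurable_compose[OF _ measurable_ennreal] lr_measurable) auto
      then have m': "(\<lambda>x. g x * ennreal (lr c (x 0) (x k))) \<in> borel_measurable (leb S)"
        by (simp add: measurable_cong_sets[OF sets_snv refl])
      have "(\<integral>\<^sup>+ x. g (restrict x S) * ennreal (lr c (x 0) (x k)) \<partial>snv ?V) =
          (\<integral>\<^sup>+ x. (\<lambda>x. g x * ennreal (lr c (x 0) (x k))) (restrict x S) \<partial>snv ?V)"
        using 1 by simp
      also have "\<dots> = (\<integral>\<^sup>+ x. g x * ennreal (lr c (x 0) (x k)) \<partial>snv S)"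
        by (rule nn_integral_snv_restrict[OF _ S m]) simp
      finally show ?thesis using dens[OF m'] 1 by (simp add: mult_ac)
    next
      case 2
      then show ?thesis using drop[of 0 k] k by simp
    next
      case 3
      then show ?thesis using drop[of k 0] k lr_commute[OF c] by simp
    qed
  qed
  finally show ?thesis .
qed

definition edge_marginal :: "nat \<Rightarrow> real \<Rightarrow> nat set \<Rightarrow> (nat \<Rightarrow> real) \<Rightarrow> ennreal" where
  "edge_marginal k c S x = (\<Prod>i\<in>S. ennreal (std_normal_density (x i))) *
      (if 0 \<in> S \<and> k \<in> S then ennreal (lr c (x 0) (x k)) else 1)"

lemma edge_marginal_measurable: "edge_marginal k c S \<in> borel_measurable (leb S)"
proof -
  have 1: "(\<lambda>x. \<Prod>i\<in>S. ennreal (std_normal_density (x i))) \<in> borel_measurable (leb S)"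
    using measurable_component_singleton[of _ S "\<lambda>_. lborel :: real measure"]
    by (intro borel_measurable_prod_ennreal measurable_compose[OF _ measurable_ennreal]
        measurable_compose[OF _ borel_measurable_normal_density]) simp
  have 2: "(\<lambda>x. ennreal (lr c (x 0) (x k))) \<in> borel_measurable (leb S)" if "0 \<in> S" "k \<in> S"
    using that measurable_component_singleton[of 0 S "\<lambda>_. lborel :: real measure"]
      measurable_component_singleton[of k S "\<lambda>_. lborel :: real measure"]
    by (intro measurable_compose[OF _ measurable_ennreal] lr_measurable) auto
  show ?thesis
  proof (cases "0 \<in> S \<and> k \<in> S")
    case True
    then show ?thesis using 1 2 by (simp add: edge_marginal_def[abs_def] borel_measurable_times_ennreal)
  next
    case False
    then have "edge_marginal k c S = (\<lambda>x. \<Prod>i\<in>S. ennreal (std_normal_density (x i)))"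
      by (auto simp: edge_marginal_def fun_eq_iff)
    then show ?thesis using 1 by (simp only:)
  qed
qed

lemma edge_law_marginal:
  assumes k: "0 < k" "k < d" and c: "0 \<le> c" "c < 1" and S: "S \<subseteq> {..<d}"
  shows "distr (edge_law d k c) (leb S) (\<lambda>x. restrict x S) = density (leb S) (edge_marginal k c S)"
proof (rule measure_eqI)
  fix B assume "B \<in> sets (distr (edge_law d k c) (leb S) (\<lambda>x. restrict x S))"
  then have B: "B \<in> sets (leb S)" by simp
  have "sets (edge_law d k c) = sets (leb {..<d})"
    by (simp add: edge_law_def std_normal_vec_snv sets_snv)
  then have m: "(\<lambda>x. restrict x S) \<in> measurable (edge_law d k c) (leb S)"
    using leb_restrict_measurable[OF S] measurable_cong_sets by blast
  have "emeasure (distr (edge_law d k c) (leb S) (\<lambda>x. restrict x S)) B =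
      (\<integral>\<^sup>+ x. indicator B (restrict x S) \<partial>edge_law d k c)"
    by (rule emeasure_distr_nn_integral[OF m B])
  also have "\<dots> = (\<integral>\<^sup>+ x. edge_marginal k c S x * indicator B x \<partial>leb S)"
    unfolding edge_marginal_def by (rule nn_integral_edge_law_restrict[OF k c S]) (use B in simp)
  also have "\<dots> = emeasure (density (leb S) (edge_marginal k c S)) B"
    using B edge_marginal_measurable by (simp add: emeasure_density)
  finally show "emeasure (distr (edge_law d k c) (leb S) (\<lambda>x. restrict x S)) B =
      emeasure (density (leb S) (edge_marginal k c S)) B" .
qed simp

lemma std_density_ennreal: "ennreal (std_normal_density y) \<noteq> 0" "ennreal (std_normal_density y) \<noteq> \<top>"
  using normal_density_pos[of 1 0 y] by auto

text \<open>The marginal densities are explicit, and the standard normal density of the parent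
  \<open>0\<close> is positive and finite, so it cancels in the only quotient with a nontrivial
  denominator.\<close>

lemma edge_law_markov:
  assumes k: "0 < k" "k < d" and c: "0 \<le> c" "c < 1"
  shows "markov_to d (edge_law d k c) {(0, k)}"
  unfolding markov_to_def
proof (intro exI[of _ "edge_marginal k c"] conjI allI impI AE_I2)
  show "edge_marginal k c S \<in> borel_measurable (leb S)" for S by (rule edge_marginal_measurable)
  show "distr (edge_law d k c) (leb S) (\<lambda>x. restrict x S) = density (leb S) (edge_marginal k c S)"
    if "S \<subseteq> {..<d}" for S by (rule edge_law_marginal[OF k c that])
  fix x :: "nat \<Rightarrow> real"
  let ?\<phi> = "\<lambda>i. ennreal (std_normal_density (x i))"
  let ?r = "\<lambda>j. edge_marginal k c (insert j (parents {(0, k)} j)) (restrict x (insert j (parents {(0, k)} j)))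
      / edge_marginal k c (parents {(0, k)} j) (restrict x (parents {(0, k)} j))"
  have p: "parents {(0, k)} j = (if j = k then {0} else {})" for j by (auto simp: parents_def)
  have r: "?r j = ?\<phi> j * (if j = k then ennreal (lr c (x 0) (x k)) else 1)" for j
  proof (cases "j = k")
    case True
    have "?\<phi> 0 * a / ?\<phi> 0 = a" for a
      using mult_divide_eq_ennreal[OF std_density_ennreal[of "x 0"], of a] by (simp only: mult.commute)
    moreover have "edge_marginal k c {k, 0} (restrict x {k, 0}) = ?\<phi> 0 * (?\<phi> k * ennreal (lr c (x 0) (x k)))"
      using k by (simp add: edge_marginal_def mult_ac)
    moreover have "edge_marginal k c {0} (restrict x {0}) = ?\<phi> 0"
      using k by (simp add: edge_marginal_def)
    ultimately show ?thesis using True by (simp add: p)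
  next
    case False
    have "a / (1::ennreal) = a" for a by (simp add: divide_ennreal_def)
    then show ?thesis using False k by (auto simp: p edge_marginal_def)
  qed
  have "(\<Prod>j<d. ?r j) = (\<Prod>j<d. ?\<phi> j) * (\<Prod>j<d. if j = k then ennreal (lr c (x 0) (x k)) else 1)"
    by (simp only: r prod.distrib)
  also have "(\<Prod>j<d. if j = k then ennreal (lr c (x 0) (x k)) else 1) = ennreal (lr c (x 0) (x k))"
    using k by simp
  finally have "(\<Prod>j<d. ?r j) = (\<Prod>j<d. ?\<phi> j) * ennreal (lr c (x 0) (x k))" .
  moreover have "edge_marginal k c {..<d} x = (\<Prod>j<d. ?\<phi> j) * ennreal (lr c (x 0) (x k))"
    using k by (simp add: edge_marginal_def)
  ultimately show "edge_marginal k c {..<d} x = (\<Prod>j<d. ?r j)" by (simp only:)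
qed

lemma std_normal_vec_markov:
  assumes k: "0 < k" "k < d"
  shows "markov_to d (std_normal_vec d) {}"
  unfolding markov_to_def
proof (intro exI[of _ "edge_marginal k 0"] conjI allI impI AE_I2)
  show "edge_marginal k 0 S \<in> borel_measurable (leb S)" for S by (rule edge_marginal_measurable)
  show "distr (std_normal_vec d) (leb S) (\<lambda>x. restrict x S) = density (leb S) (edge_marginal k 0 S)"
    if "S \<subseteq> {..<d}" for S using edge_law_marginal[OF k _ _ that, of 0] by (simp add: edge_law_0)
  fix x :: "nat \<Rightarrow> real"
  have "a / (1::ennreal) = a" for a by (simp add: divide_ennreal_def)
  then show "edge_marginal k 0 {..<d} x =
      (\<Prod>j<d. edge_marginal k 0 (insert j (parents {} j)) (restrict x (insert j (parents {} j)))
        / edge_marginal k 0 (parents {} j) (restrict x (parents {} j)))"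
    using k by (auto simp: edge_marginal_def parents_def lr_zero intro!: prod.cong)
qed

text \<open>The mixture ratio \<open>S\<close> has variance \<open>(V - 1) / m\<close>, hence at
  most \<open>1 / 2\<close>. Any test has error sum at least the integral of
  \<open>1 - \<bar>1 - S\<bar>\<close>, and this absolute value is bounded by a quadratic.\<close>

lemma (in prob_space) mixture_second_moment:
  fixes L :: "'k \<Rightarrow> 'a \<Rightarrow> real" and f :: "'a \<Rightarrow> real"
  assumes K: "finite K" "K \<noteq> {}"
    and L[measurable]: "\<And>k. k \<in> K \<Longrightarrow> L k \<in> borel_measurable M" and L0: "\<And>k x. 0 \<le> L k x"
    and L1: "\<And>k. k \<in> K \<Longrightarrow> (\<integral>\<^sup>+ x. ennreal (L k x) \<partial>M) = 1"
    and L2: "\<And>k k'. k \<in> K \<Longrightarrow> k' \<in> K \<Longrightarrow>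
      (\<integral>\<^sup>+ x. ennreal (L k x * L k' x) \<partial>M) = ennreal (if k = k' then V else 1)"
    and V: "0 \<le> V" "V - 1 \<le> real (card K) / 2"
    and f[measurable]: "f \<in> borel_measurable M" and f01: "\<And>x. 0 \<le> f x" "\<And>x. f x \<le> 1"
  shows "1 / 4 < (LINT x|M. f x) + (\<Sum>k\<in>K. LINT x|M. L k x * (1 - f x)) / real (card K)"
proof -
  define m where "m = real (card K)"
  have m: "0 < m" using K by (simp add: m_def card_gt_0_iff)
  have int1: "integrable M (L k)" "(LINT x|M. L k x) = 1" if "k \<in> K" for k
    using L1[OF that] L[OF that] L0
    by (auto simp: integrable_iff_bounded integral_eq_nn_integral)
  have int2: "integrable M (\<lambda>x. L k x * L k' x)" "(LINT x|M. L k x * L k' x) = (if k = k' then V else 1)"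
    if "k \<in> K" "k' \<in> K" for k k'
    using L2[OF that] L[OF that(1)] L[OF that(2)] L0 V(1)
    by (auto simp: integrable_iff_bounded integral_eq_nn_integral abs_mult split: if_splits)
  define S where "S = (\<lambda>x. (\<Sum>k\<in>K. L k x) / m)"
  have intS: "integrable M S" "(LINT x|M. S x) = 1"
    using int1 K m by (auto simp: S_def m_def)
  have S2: "S x * S x = (\<Sum>k\<in>K. \<Sum>k'\<in>K. L k x * L k' x) / m\<^sup>2" for x
    by (simp add: S_def sum_product power2_eq_square)
  have intS2: "integrable M (\<lambda>x. S x * S x)"
    unfolding S2 using int2 by (intro integrable_divide Bochner_Integration.integrable_sum) auto
  have "(LINT x|M. S x * S x) = (\<Sum>k\<in>K. \<Sum>k'\<in>K. if k = k' then V else 1) / m\<^sup>2"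
    unfolding S2 using int2
    by (simp add: Bochner_Integration.integral_sum Bochner_Integration.integrable_sum)
  also have "(\<Sum>k\<in>K. \<Sum>k'\<in>K. if k = k' then V else 1) = (\<Sum>k\<in>K. V + (m - 1))"
  proof (rule sum.cong[OF refl])
    fix k assume k: "k \<in> K"
    have "(\<Sum>k'\<in>K. if k = k' then V else 1) = (\<Sum>k'\<in>K. (if k' = k then V - 1 else 0) + 1)"
      by (intro sum.cong) auto
    then show "(\<Sum>k'\<in>K. if k = k' then V else 1) = V + (m - 1)"
      using k K by (simp add: sum.distrib m_def)
  qed
  also have "\<dots> / m\<^sup>2 = 1 + (V - 1) / m"
    using m by (simp add: m_def[symmetric] power2_eq_square field_simps)
  finally have S2int: "(LINT x|M. S x * S x) = 1 + (V - 1) / m" .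
  have fint: "integrable M f" by (rule integrable_const_bound[of _ 1]) (use f01 in auto)
  have Lf: "integrable M (\<lambda>x. L k x * (1 - f x))" if "k \<in> K" for k
    by (rule Bochner_Integration.integrable_bound[OF int1(1)[OF that]])
      (use L[OF that] f01 L0 in \<open>auto simp: abs_mult mult_left_le intro!: borel_measurable_times\<close>)
  have Sf: "integrable M (\<lambda>x. S x * (1 - f x))"
    unfolding S_def times_divide_eq_left sum_distrib_right using Lf by (intro integrable_divide Bochner_Integration.integrable_sum) auto
  have Sfi: "(LINT x|M. S x * (1 - f x)) = (\<Sum>k\<in>K. LINT x|M. L k x * (1 - f x)) / m"
    unfolding S_def times_divide_eq_left sum_distrib_right using Lf by (simp add: Bochner_Integration.integral_sum)
  have point: "1 - (3 / 8 + 2 / 3 * (1 - 2 * S x + S x * S x)) \<le> f x + S x * (1 - f x)" for x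
  proof -
    define y where "y = 1 - S x"
    \<comment> \<open>A tangent bound with equality at \<open>3 / 4\<close>, in place of the
      Cauchy-Schwarz inequality. With variance \<open>1 / 2\<close> it leaves
      \<open>1 - 3 / 8 - 1 / 3 = 7 / 24 > 1 / 4\<close>.\<close>
    have y: "\<bar>y\<bar> \<le> 3 / 8 + 2 / 3 * y\<^sup>2"
      using zero_le_power2[of "\<bar>y\<bar> - 3 / 4"] by (simp add: power2_diff field_simps)
    have "\<bar>(1 - f x) * y\<bar> \<le> \<bar>y\<bar>" using f01[of x] by (simp add: abs_mult mult_left_le_one_le)
    then have "1 - (3 / 8 + 2 / 3 * y\<^sup>2) \<le> 1 - (1 - f x) * y" using y by linarith
    moreover have "y\<^sup>2 = 1 - 2 * S x + S x * S x" "1 - (1 - f x) * y = f x + S x * (1 - f x)"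
      by (simp_all add: y_def power2_eq_square algebra_simps)
    ultimately show ?thesis by simp
  qed
  have "(V - 1) / m \<le> 1 / 2" using V(2) m by (simp add: m_def[symmetric] field_simps)
  then have "1 / 4 < 1 - (3 / 8 + 2 / 3 * (1 - 2 * 1 + (1 + (V - 1) / m)))" by argo
  also have "\<dots> = (LINT x|M. 1 - (3 / 8 + 2 / 3 * (1 - 2 * S x + S x * S x)))"
    using intS intS2 S2int by (simp add: prob_space)
  also have "\<dots> \<le> (LINT x|M. f x + S x * (1 - f x))"
    using intS intS2 fint Sf point by (intro integral_mono) auto
  also have "\<dots> = (LINT x|M. f x) + (\<Sum>k\<in>K. LINT x|M. L k x * (1 - f x)) / m"
    using fint Sf by (simp add: Sfi)
  finally show ?thesis by (simp add: m_def)
qed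

definition edge_ratio :: "nat \<Rightarrow> nat \<Rightarrow> real \<Rightarrow> (nat \<Rightarrow> nat \<Rightarrow> real) \<Rightarrow> real" where
  "edge_ratio n k c s = (\<Prod>i<n. lr c (s i 0) (s i k))"

lemma sets_iid_std: "sets (iid_samples n (std_normal_vec d)) = sets (iid_samples n (vec_space d))"
  unfolding iid_samples_def by (intro sets_PiM_cong sets_std_normal_vec) simp

lemma std_coord: "j < d \<Longrightarrow> (\<lambda>x. x j) \<in> borel_measurable (std_normal_vec d)"
  using vec_coord_measurable[of j d] by (simp add: measurable_cong_sets[OF sets_std_normal_vec refl])

lemma iid_coord: "i < n \<Longrightarrow> j < d \<Longrightarrow> (\<lambda>s. s i j) \<in> borel_measurable (iid_samples n (std_normal_vec d))"
  unfolding iid_samples_def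
  using measurable_compose[OF measurable_component_singleton[of i "{..<n}" "\<lambda>_. std_normal_vec d"] std_coord[of j d]]
  by simp

lemma edge_ratio_measurable:
  assumes "0 < k" "k < d"
  shows "edge_ratio n k c \<in> borel_measurable (iid_samples n (std_normal_vec d))"
  unfolding edge_ratio_def[abs_def] using assms
  by (intro borel_measurable_prod lr_measurable iid_coord) auto

interpretation std_iid: product_sigma_finite "\<lambda>_::nat. std_normal_vec d" for d
  by (intro product_sigma_finite.intro prob_space_imp_sigma_finite prob_space_std_normal_vec)

lemma iid_edge_law:
  assumes k: "0 < k" "k < d" and c: "0 \<le> c" "c < 1"
  shows "iid_samples n (edge_law d k c) =
    density (iid_samples n (std_normal_vec d)) (\<lambda>s. ennreal (edge_ratio n k c s))"
proof -
  interpret G: gaussian_law "edge_law d k c" d "edge_cov k c" by (rule gaussian_law_edge_law[OF k c])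
  have p: "product_sigma_finite (\<lambda>_::nat. density (std_normal_vec d) (\<lambda>x. ennreal (lr c (x 0) (x k))))"
    unfolding edge_law_def[symmetric]
    by (intro product_sigma_finite.intro prob_space_imp_sigma_finite G.prob_space_axioms)
  have m: "(\<lambda>x. ennreal (lr c (x 0) (x k))) \<in> borel_measurable (std_normal_vec d)"
    using k by (intro measurable_compose[OF _ measurable_ennreal] lr_measurable std_coord) auto
  show ?thesis
    unfolding iid_samples_def edge_law_def edge_ratio_def
    using PiM_density_prod[OF _ std_iid.product_sigma_finite_axioms p, of "{..<n}"] m
    by (simp add: prod_ennreal)
qed

lemma edge_ratio_nonneg: "0 \<le> edge_ratio n k c s"
  unfolding edge_ratio_def by (intro prod_nonneg) simp

lemma nn_integral_edge_ratio:
  assumes k: "0 < k" "k < d" and c: "0 \<le> c" "c < 1"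
  shows "(\<integral>\<^sup>+ s. ennreal (edge_ratio n k c s) \<partial>iid_samples n (std_normal_vec d)) = 1"
proof -
  interpret G: gaussian_law "edge_law d k c" d "edge_cov k c" by (rule gaussian_law_edge_law[OF k c])
  interpret I: prob_space "iid_samples n (edge_law d k c)" by (rule G.prob_space_iid)
  have "emeasure (iid_samples n (edge_law d k c)) (space (iid_samples n (edge_law d k c))) = 1"
    by (rule I.emeasure_space_1)
  then show ?thesis
    unfolding iid_edge_law[OF k c] using edge_ratio_measurable[OF k]
    by (simp add: emeasure_density measurable_compose[OF _ measurable_ennreal] cong: nn_integral_cong)
qed

text \<open>Observations are independent, so a single one is considered. The ratios of two different
  edges share only coordinate 0, so \<open>x k\<close> and then \<open>x k'\<close> can be
  integrated out, and the mixed moment is 1.\<close>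

lemma nn_integral_edge_ratio_mult:
  assumes k: "0 < k" "k < d" and k': "0 < k'" "k' < d" and c: "0 \<le> c" "c < 1"
  shows "(\<integral>\<^sup>+ s. ennreal (edge_ratio n k c s * edge_ratio n k' c s) \<partial>iid_samples n (std_normal_vec d)) =
    ennreal (if k = k' then (1 / (1 - c\<^sup>2)) ^ n else 1)"
proof -
  define g where "g = (\<lambda>x :: nat \<Rightarrow> real. ennreal (lr c (x 0) (x k) * lr c (x 0) (x k')))"
  have g: "g \<in> borel_measurable (std_normal_vec d)"
    unfolding g_def using k k'
    by (intro measurable_compose[OF _ measurable_ennreal] borel_measurable_times lr_measurable std_coord) auto
  have "(\<integral>\<^sup>+ s. ennreal (edge_ratio n k c s * edge_ratio n k' c s) \<partial>iid_samples n (std_normal_vec d)) =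
      (\<integral>\<^sup>+ s. (\<Prod>i<n. g (s i)) \<partial>iid_samples n (std_normal_vec d))"
    by (simp add: edge_ratio_def g_def prod_ennreal prod.distrib)
  also have "\<dots> = (\<Prod>i<n. \<integral>\<^sup>+ x. g x \<partial>std_normal_vec d)"
    unfolding iid_samples_def using g by (intro std_iid.product_nn_integral_prod) auto
  also have "(\<integral>\<^sup>+ x. g x \<partial>std_normal_vec d) = ennreal (if k = k' then 1 / (1 - c\<^sup>2) else 1)"
  proof (cases "k = k'")
    case True
    then show ?thesis
      using nn_integral_lr_square_snv[OF c, of "{..<d}" 0 k] k by (simp add: g_def std_normal_vec_snv)
  next
    case False
    have m: "(\<lambda>x. ennreal (lr c (x 0) (x k'))) \<in> borel_measurable (snv {..<d})"
      using k' snv_component[of 0 "{..<d}"] snv_component[of k' "{..<d}"]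
      by (intro measurable_compose[OF _ measurable_ennreal] lr_measurable) auto
    have "(\<integral>\<^sup>+ x. g x \<partial>std_normal_vec d) =
        (\<integral>\<^sup>+ x. ennreal (lr c (x 0) (x k')) * ennreal (lr c (x 0) (x k)) \<partial>snv {..<d})"
      by (simp add: g_def std_normal_vec_snv ennreal_mult mult.commute)
    also have "\<dots> = (\<integral>\<^sup>+ x. ennreal (lr c (x 0) (x k')) \<partial>snv {..<d})"
      by (rule nn_integral_lr_marginal[OF c _ _ _ _ m]) (use k k' False in auto)
    also have "\<dots> = (\<integral>\<^sup>+ x. 1 * ennreal (lr c (x 0) (x k')) \<partial>snv {..<d})" by simp
    also have "\<dots> = (\<integral>\<^sup>+ x. 1 \<partial>snv {..<d})"
      by (rule nn_integral_lr_marginal[OF c]) (use k' in auto)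
    also have "\<dots> = 1"
      using prob_space.emeasure_space_1[OF prob_space_std_normal_vec[of d]] by (simp add: std_normal_vec_snv)
    finally show ?thesis using False by simp
  qed
  also have "(\<Prod>i<n. ennreal (if k = k' then 1 / (1 - c\<^sup>2) else 1)) = ennreal (if k = k' then (1 / (1 - c\<^sup>2)) ^ n else 1)"
    using one_minus_square_pos[OF c] by (simp add: ennreal_power)
  finally show ?thesis .
qed

text \<open>The conclusion is meant to contradict given error bounds: they will be
  \<open>1 / 8\<close> and \<open>1 / 8\<close> for testing, \<open>1 / 10\<close> and
  \<open>1 / 10\<close> for learning.\<close>

lemma testing_lower_bound:
  fixes f :: "(nat \<Rightarrow> nat \<Rightarrow> real) \<Rightarrow> real"
  assumes K: "finite K" "K \<noteq> {}" "K \<subseteq> {0<..<d}" and c: "0 \<le> c" "c < 1"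
    and V: "(1 / (1 - c\<^sup>2)) ^ n - 1 \<le> real (card K) / 2"
    and f: "f \<in> borel_measurable (iid_samples n (vec_space d))" and f01: "\<And>s. 0 \<le> f s" "\<And>s. f s \<le> 1"
    and null: "(\<integral>\<^sup>+ s. ennreal (f s) \<partial>iid_samples n (std_normal_vec d)) \<le> ennreal e"
    and alt: "\<And>k. k \<in> K \<Longrightarrow> (\<integral>\<^sup>+ s. ennreal (1 - f s) \<partial>iid_samples n (edge_law d k c)) \<le> ennreal e'"
    and e: "0 \<le> e" "0 \<le> e'"
  shows "1 / 4 < e + e'"
proof -
  let ?Q = "iid_samples n (std_normal_vec d)"
  interpret Q: prob_space ?Q
    unfolding iid_samples_def by (intro prob_space_PiM prob_space_std_normal_vec)
  have fQ: "f \<in> borel_measurable ?Q" using f by (simp add: measurable_cong_sets[OF sets_iid_std refl])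
  have Kd: "0 < k" "k < d" if "k \<in> K" for k using K(3) that by auto
  have "1 / 4 < (LINT s|?Q. f s) + (\<Sum>k\<in>K. LINT s|?Q. edge_ratio n k c s * (1 - f s)) / real (card K)"
  proof (rule Q.mixture_second_moment[OF K(1,2) _ _ _ _ _ V fQ f01])
    show "edge_ratio n k c \<in> borel_measurable ?Q" if "k \<in> K" for k
      using edge_ratio_measurable[OF Kd[OF that]] .
    show "(\<integral>\<^sup>+ s. ennreal (edge_ratio n k c s) \<partial>?Q) = 1" if "k \<in> K" for k
      using nn_integral_edge_ratio[OF Kd[OF that] c] .
    show "(\<integral>\<^sup>+ s. ennreal (edge_ratio n k c s * edge_ratio n k' c s) \<partial>?Q) =
        ennreal (if k = k' then (1 / (1 - c\<^sup>2)) ^ n else 1)" if "k \<in> K" "k' \<in> K" for k k'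
      using nn_integral_edge_ratio_mult[OF Kd[OF that(1)] Kd[OF that(2)] c] .
  qed (use edge_ratio_nonneg one_minus_square_pos[OF c] in auto)
  moreover have "(LINT s|?Q. f s) \<le> e"
  proof -
    have "integrable ?Q f" by (rule Q.integrable_const_bound[of _ 1]) (use f01 fQ in auto)
    then have "ennreal (LINT s|?Q. f s) \<le> ennreal e"
      using null f01 by (simp add: nn_integral_eq_integral)
    then show ?thesis using e by (simp add: ennreal_le_iff)
  qed
  moreover have "(\<Sum>k\<in>K. LINT s|?Q. edge_ratio n k c s * (1 - f s)) \<le> (\<Sum>k\<in>K. e')"
  proof (rule sum_mono)
    fix k assume k: "k \<in> K"
    note er = edge_ratio_measurable[OF Kd[OF k], of n c]
    have "(\<integral>\<^sup>+ s. ennreal (1 - f s) \<partial>iid_samples n (edge_law d k c)) =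
        (\<integral>\<^sup>+ s. ennreal (edge_ratio n k c s) * ennreal (1 - f s) \<partial>?Q)"
      unfolding iid_edge_law[OF Kd[OF k] c] using er fQ by (intro nn_integral_density) auto
    also have "\<dots> = (\<integral>\<^sup>+ s. ennreal (edge_ratio n k c s * (1 - f s)) \<partial>?Q)"
      using f01 edge_ratio_nonneg by (intro nn_integral_cong) (simp add: ennreal_mult)
    finally have le: "(\<integral>\<^sup>+ s. ennreal (edge_ratio n k c s * (1 - f s)) \<partial>?Q) \<le> ennreal e'"
      using alt[OF k] by simp
    have nn: "0 \<le> edge_ratio n k c s * (1 - f s)" for s using f01 edge_ratio_nonneg by simp
    have "integrable ?Q (\<lambda>s. edge_ratio n k c s * (1 - f s))"
      using er fQ nn le_less_trans[OF le ennreal_less_top] by (intro integrableI_nonneg) auto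
    then have "ennreal (LINT s|?Q. edge_ratio n k c s * (1 - f s)) \<le> ennreal e'"
      using le nn by (simp add: nn_integral_eq_integral)
    then show "(LINT s|?Q. edge_ratio n k c s * (1 - f s)) \<le> e'" using e by (simp add: ennreal_le_iff)
  qed
  then have "(\<Sum>k\<in>K. LINT s|?Q. edge_ratio n k c s * (1 - f s)) / real (card K) \<le> e'"
    using K by (simp add: pos_divide_le_eq card_gt_0_iff mult.commute)
  ultimately show ?thesis by linarith
qed

subsection \<open>The testing problem\<close>

lemma gaussian_lawsE:
  assumes "p \<in> gaussian_laws d"
  obtains \<Sigma> where "gaussian_law p d \<Sigma>"
  using assms gaussian_law_if_normal_law by (auto simp: gaussian_laws_def)

lemma (in gaussian_law) sets_iid: "sets (iid_samples n M) = sets (iid_samples n (vec_space d))"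
  unfolding iid_samples_def by (intro sets_PiM_cong sets_M) simp

lemma (in gaussian_law) psi_gauss_measurable_iid:
  assumes "j < d" "k < d" "\<And>h. l = Some h \<Longrightarrow> h < d"
  shows "psi_gauss n c j k l \<in> borel_measurable (iid_samples n M)"
  using psi_gauss_measurable[of j d k l n c] assms by (simp add: measurable_cong_sets[OF sets_iid refl])

lemma (in gaussian_law) nn_integral_psi_gauss:
  assumes "j < d" "k < d" "\<And>h. l = Some h \<Longrightarrow> h < d"
  shows "(\<integral>\<^sup>+ s. ennreal (psi_gauss n c j k l s) \<partial>iid_samples n M) =
      ennreal (measure (iid_samples n M) {s \<in> space (iid_samples n M). psi_gauss n c j k l s = 1})"
    and "(\<integral>\<^sup>+ s. ennreal (1 - psi_gauss n c j k l s) \<partial>iid_samples n M) =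
      ennreal (measure (iid_samples n M) {s \<in> space (iid_samples n M). psi_gauss n c j k l s = 0})"
proof -
  let ?P = "iid_samples n M"
  interpret P: prob_space ?P by (rule prob_space_iid)
  have psi[measurable]: "psi_gauss n c j k l \<in> borel_measurable ?P"
    by (rule psi_gauss_measurable_iid) (use assms in auto)
  have vals: "psi_gauss n c j k l s = 0 \<or> psi_gauss n c j k l s = 1" for s
    using psi_gauss_values[of n c j k l s] by simp
  have "(\<integral>\<^sup>+ s. ennreal (psi_gauss n c j k l s) \<partial>?P) =
      (\<integral>\<^sup>+ s. indicator {s \<in> space ?P. psi_gauss n c j k l s = 1} s \<partial>?P)"
  proof (rule nn_integral_cong)
    fix s assume "s \<in> space ?P"
    then show "ennreal (psi_gauss n c j k l s) = indicator {s \<in> space ?P. psi_gauss n c j k l s = 1} s"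
      using vals[of s] by auto
  qed
  then show "(\<integral>\<^sup>+ s. ennreal (psi_gauss n c j k l s) \<partial>?P) =
      ennreal (measure ?P {s \<in> space ?P. psi_gauss n c j k l s = 1})"
    by (simp add: P.emeasure_eq_measure)
  have "(\<integral>\<^sup>+ s. ennreal (1 - psi_gauss n c j k l s) \<partial>?P) =
      (\<integral>\<^sup>+ s. indicator {s \<in> space ?P. psi_gauss n c j k l s = 0} s \<partial>?P)"
  proof (rule nn_integral_cong)
    fix s assume "s \<in> space ?P"
    then show "ennreal (1 - psi_gauss n c j k l s) = indicator {s \<in> space ?P. psi_gauss n c j k l s = 0} s"
      using vals[of s] by auto
  qed
  then show "(\<integral>\<^sup>+ s. ennreal (1 - psi_gauss n c j k l s) \<partial>?P) =
      ennreal (measure ?P {s \<in> space ?P. psi_gauss n c j k l s = 0})"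
    by (simp add: P.emeasure_eq_measure)
qed

lemma ci_test_risk:
  assumes n: "0 < n" and r: "0 < r" and small: "24 * exp (- (real n * r\<^sup>2 / 6400)) \<le> 1 / 20"
  shows "test_risk (gaussian_laws 3) m_gauss n r (psi_gauss n r 0 1 (Some 2)) \<le> ennreal (1 / 10)"
proof -
  have l: "Some 2 \<in> cond_choices 3 0 1" by (auto simp: cond_choices_def)
  have null: "(\<integral>\<^sup>+ s. ennreal (psi_gauss n r 0 1 (Some 2) s) \<partial>iid_samples n p) \<le> ennreal (1 / 20)"
    if p: "p \<in> ci_null (gaussian_laws 3)" for p
  proof -
    obtain \<Sigma> where "gaussian_law p 3 \<Sigma>" using p by (auto simp: ci_null_def elim: gaussian_lawsE)
    then interpret gaussian_law p 3 \<Sigma> .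
    have "pcov 2 0 1 = 0" using p by (intro cond_indep_pcov) (auto simp: ci_null_def)
    then have m0: "m_gauss p 0 1 (Some 2) = 0" by (simp add: m_gauss_Some del: m_gauss.simps)
    \<comment> \<open>For \<open>r > 2\<close> the threshold \<open>r / 2\<close> exceeds every
      sample partial correlation, so the test always accepts.\<close>
    show ?thesis
    proof (cases "r \<le> 2")
      case True
      have "measure (iid_samples n p) {s \<in> space (iid_samples n p). psi_gauss n r 0 1 (Some 2) s = 1} \<le> 1 / 20"
        by (rule order_trans[OF psi_gauss_null_error[OF _ _ _ l r True n m0] small]) auto
      then show ?thesis by (subst nn_integral_psi_gauss) (auto intro: ennreal_leI)
    next
      case False
      then have "psi_gauss n r 0 1 (Some 2) s = 0" for s
        using m_hat_le_1[of n s 0 1 2] by (simp add: psi_gauss_def del: m_hat.simps)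
      then show ?thesis by simp
    qed
  qed
  have alt: "(\<integral>\<^sup>+ s. ennreal (1 - psi_gauss n r 0 1 (Some 2) s) \<partial>iid_samples n p) \<le> ennreal (1 / 20)"
    if p: "p \<in> ci_alt (gaussian_laws 3) m_gauss r" for p
  proof -
    obtain \<Sigma> where "gaussian_law p 3 \<Sigma>" using p by (auto simp: ci_alt_def elim: gaussian_lawsE)
    then interpret gaussian_law p 3 \<Sigma> .
    have "r \<le> m_gauss p 0 1 (Some 2)" using p by (simp add: ci_alt_def)
    then have "measure (iid_samples n p) {s \<in> space (iid_samples n p). psi_gauss n r 0 1 (Some 2) s = 0} \<le> 1 / 20"
      by (intro order_trans[OF psi_gauss_alt_error[OF _ _ _ l r n] small]) auto
    then show ?thesis by (subst nn_integral_psi_gauss) (auto intro: ennreal_leI)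
  qed
  have "test_risk (gaussian_laws 3) m_gauss n r (psi_gauss n r 0 1 (Some 2)) \<le> ennreal (1 / 20) + ennreal (1 / 20)"
    unfolding test_risk_def by (intro add_mono SUP_least null alt)
  also have "\<dots> = ennreal (1 / 10)" by (simp flip: ennreal_plus)
  finally show ?thesis .
qed

text \<open>All conditional expectations involved are constants. Joint independence is reached in
  two steps: \<open>x j\<close> is independent of the pair of the others, and \<open>x k\<close> is
  independent of \<open>x l\<close>.\<close>

lemma (in gaussian_law) cond_indep_uncorrelated:
  assumes jkl: "j < d" "k < d" "l < d" "k \<noteq> l"
    and 0: "\<Sigma> j k = 0" "\<Sigma> j l = 0" "\<Sigma> k l = 0"
  shows "cond_indep M (\<lambda>x. x j) (\<lambda>x. x k) (\<lambda>x. x l)"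
  unfolding cond_indep_def
proof (intro ballI)
  fix A B :: "real set" assume A[measurable]: "A \<in> sets borel" and B[measurable]: "B \<in> sets borel"
  note [measurable] = coord_measurable[OF jkl(1)] coord_measurable[OF jkl(2)] coord_measurable[OF jkl(3)]
  have iI: "integrable M (\<lambda>x. indicator C (x i) :: real)" if "C \<in> sets borel" "i < d" for C :: "real set" and i
    using that coord_measurable[OF that(2)] by (intro integrable_const_bound[of _ 1]) (auto simp: indicator_def)
  have two: "(LINT x|M. indicator C (x i) * indicator D (x l) :: real) =
      (LINT x|M. indicator C (x i)) * (LINT x|M. indicator D (x l))"
    if CD[measurable]: "C \<in> sets borel" "D \<in> sets borel" and i: "i < d" "\<Sigma> i l = 0" for C D :: "real set" and i
    using integral_indep_mult(1)[OF jkl(3), of "unit i" "indicator C" "indicator D"] i jkl(3) iI[OF CD(1) i(1)] iI[OF CD(2) jkl(3)]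
    by (simp add: bil_unit lin_unit)
  have three: "(LINT x|M. indicator A (x j) * indicator B (x k) * indicator C (x l) :: real) =
      (LINT x|M. indicator A (x j)) * (LINT x|M. indicator B (x k)) * (LINT x|M. indicator C (x l))"
    if C[measurable]: "C \<in> sets borel" for C :: "real set"
  proof -
    have m: "(\<lambda>y. indicator B (y k) * indicator C (y l) :: ennreal) \<in> borel_measurable (\<Pi>\<^sub>M i\<in>{k, l}. borel)"
      by measurable
    have "(\<integral>\<^sup>+ x. indicator A (lin d (unit j) x) * (indicator B (restrict x {k, l} k) * indicator C (restrict x {k, l} l)) \<partial>M) =
        (\<integral>\<^sup>+ x. indicator A (lin d (unit j) x) \<partial>M) * (\<integral>\<^sup>+ x. indicator B (restrict x {k, l} k) * indicator C (restrict x {k, l} l) \<partial>M)"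
      by (rule nn_integral_lin_indep[OF _ _ _ _ m]) (use jkl 0 in \<open>auto simp: bil_unit\<close>)
    then have e: "(\<integral>\<^sup>+ x. ennreal (indicator A (x j) * indicator B (x k) * indicator C (x l)) \<partial>M) =
        (\<integral>\<^sup>+ x. ennreal (indicator A (x j)) \<partial>M) * (\<integral>\<^sup>+ x. ennreal (indicator B (x k) * indicator C (x l)) \<partial>M)"
      by (simp add: lin_unit jkl ennreal_mult ennreal_indicator mult.assoc)
    have "(LINT x|M. indicator A (x j) * indicator B (x k) * indicator C (x l) :: real) =
        (LINT x|M. indicator A (x j)) * (LINT x|M. indicator B (x k) * indicator C (x l))"
      by (simp add: integral_eq_nn_integral e enn2real_mult)
    then show ?thesis using two[OF B C jkl(2) 0(3)] by simp
  qed
  have ce: "AE x in M. real_cond_exp M (generated_alg M (\<lambda>x. x l)) (\<lambda>x. indicator C (x i)) x =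
      (LINT x|M. indicator C (x i))" if C[measurable]: "C \<in> sets borel" and i: "i < d" "\<Sigma> i l = 0" for C :: "real set" and i
    by (rule real_cond_exp_generated[where g = "\<lambda>_. LINT x|M. indicator C (x i)"])
      (use iI[OF C i(1)] two[OF C _ i] in auto)
  have "AE x in M. real_cond_exp M (generated_alg M (\<lambda>x. x l)) (\<lambda>x. indicator A (x j) * indicator B (x k)) x =
      (LINT x|M. indicator A (x j)) * (LINT x|M. indicator B (x k))"
  proof (rule real_cond_exp_generated[where g = "\<lambda>_. (LINT x|M. indicator A (x j)) * (LINT x|M. indicator B (x k))"])
    show "integrable M (\<lambda>x. indicator A (x j) * indicator B (x k) :: real)"
      by (intro integrable_const_bound[of _ 1]) (auto simp: indicator_def)
  qed (use three in auto)
  with ce[OF A jkl(1) 0(2)] ce[OF B jkl(2) 0(3)]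
  show "AE x in M. real_cond_exp M (generated_alg M (\<lambda>x. x l)) (\<lambda>x. indicator A (x j) * indicator B (x k)) x =
      real_cond_exp M (generated_alg M (\<lambda>x. x l)) (\<lambda>x. indicator A (x j)) x *
      real_cond_exp M (generated_alg M (\<lambda>x. x l)) (\<lambda>x. indicator B (x k)) x"
    by eventually_elim simp
qed

lemma std_normal_vec_ci_null: "std_normal_vec 3 \<in> ci_null (gaussian_laws 3)"
proof -
  have "gaussian_law (std_normal_vec 3) 3 (edge_cov 1 0)"
    using gaussian_law_edge_law[of 1 3 0] by (simp add: edge_law_0)
  then interpret gaussian_law "std_normal_vec 3" 3 "edge_cov 1 0" .
  have "cond_indep (std_normal_vec 3) (\<lambda>x. x 0) (\<lambda>x. x 1) (\<lambda>x. x 2)"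
    by (rule cond_indep_uncorrelated) (auto simp: edge_cov_def)
  moreover have "std_normal_vec 3 \<in> gaussian_laws 3"
    using edge_law_gaussian[of 1 3 0] by (simp add: edge_law_0)
  ultimately show ?thesis by (simp add: ci_null_def)
qed

text \<open>The standard normal law is compared with a single alternative of correlation
  \<open>r\<close>. If \<open>n * r^2 < 1 / 4\<close>, Bernoulli's inequality gives
  \<open>(1 - r^2)^n \<ge> 3 / 4\<close>, so the second moment is at most
  \<open>4 / 3\<close>.\<close>

lemma ci_radius_lower:
  assumes n: "0 < n" and r: "0 < r" and risk: "(INF \<psi>\<in>ci_tests n. test_risk (gaussian_laws 3) m_gauss n r \<psi>) \<le> ennreal (1 / 10)"
  shows "1 / (2 * sqrt (real n)) \<le> r"
proof (rule ccontr)
  assume "\<not> 1 / (2 * sqrt (real n)) \<le> r"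
  then have rn: "r < 1 / (2 * sqrt (real n))" by simp
  have "r * (2 * sqrt (real n)) < 1" using rn n by (simp add: pos_less_divide_eq)
  then have "(r * (2 * sqrt (real n)))\<^sup>2 < 1" using r n by (intro power_less_one_iff[THEN iffD2]) auto
  then have nr: "real n * r\<^sup>2 < 1 / 4" by (simp add: power_mult_distrib field_simps)
  have "1 * r\<^sup>2 \<le> real n * r\<^sup>2" using n by (intro mult_right_mono) auto
  then have r2: "r\<^sup>2 < 1 / 4" using nr by simp
  have r1: "r < 1" by (rule power_less_imp_less_base[of r 2 1]) (use r2 in auto)
  \<comment> \<open>The infimum need not be attained; enlarging \<open>1 / 10\<close> to
    \<open>1 / 8\<close> yields an actual test.\<close>
  have "(INF \<psi>\<in>ci_tests n. test_risk (gaussian_laws 3) m_gauss n r \<psi>) < ennreal (1 / 8)"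
    by (rule le_less_trans[OF risk]) (simp add: ennreal_less_iff)
  then obtain \<psi> where \<psi>: "\<psi> \<in> ci_tests n" "test_risk (gaussian_laws 3) m_gauss n r \<psi> < ennreal (1 / 8)"
    by (auto simp: INF_less_iff)
  have psi01: "0 \<le> \<psi> s" "\<psi> s \<le> 1" for s
  proof -
    have "\<psi> s \<in> {0, 1}" using \<psi>(1) unfolding ci_tests_def by blast
    then show "0 \<le> \<psi> s" "\<psi> s \<le> 1" by auto
  qed
  have "edge_law 3 1 r \<in> ci_alt (gaussian_laws 3) m_gauss r"
    using edge_law_gaussian[of 1 3 r] m_gauss_edge_law[of 1 3 r 0 1 "Some 2"] r r1
    by (simp add: ci_alt_def cond_choices_def del: m_gauss.simps)
  then have "(\<integral>\<^sup>+ s. ennreal (1 - \<psi> s) \<partial>iid_samples n (edge_law 3 1 r)) \<le>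
      (SUP p\<in>ci_alt (gaussian_laws 3) m_gauss r. \<integral>\<^sup>+ s. ennreal (1 - \<psi> s) \<partial>iid_samples n p)"
    by (rule SUP_upper)
  also have "\<dots> \<le> test_risk (gaussian_laws 3) m_gauss n r \<psi>" by (simp add: test_risk_def)
  finally have alt: "(\<integral>\<^sup>+ s. ennreal (1 - \<psi> s) \<partial>iid_samples n (edge_law 3 1 r)) \<le> ennreal (1 / 8)"
    using \<psi>(2) by simp
  have "(\<integral>\<^sup>+ s. ennreal (\<psi> s) \<partial>iid_samples n (std_normal_vec 3)) \<le>
      (SUP p\<in>ci_null (gaussian_laws 3). \<integral>\<^sup>+ s. ennreal (\<psi> s) \<partial>iid_samples n p)"
    using std_normal_vec_ci_null by (rule SUP_upper)
  also have "\<dots> \<le> test_risk (gaussian_laws 3) m_gauss n r \<psi>" by (simp add: test_risk_def)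
  finally have null: "(\<integral>\<^sup>+ s. ennreal (\<psi> s) \<partial>iid_samples n (std_normal_vec 3)) \<le> ennreal (1 / 8)"
    using \<psi>(2) by simp
  have "3 / 4 \<le> 1 + real n * (- r\<^sup>2)" using nr by simp
  also have "\<dots> \<le> (1 + - r\<^sup>2) ^ n" using r2 by (intro Bernoulli_inequality) simp
  finally have "(1 / (1 - r\<^sup>2)) ^ n \<le> 4 / 3"
    using r2 by (simp add: power_divide field_simps)
  then have "(1 / (1 - r\<^sup>2)) ^ n - 1 \<le> real (card {1::nat}) / 2" by simp
  then have "1 / 4 < 1 / 8 + (1 / 8 :: real)"
    by (intro testing_lower_bound[where K = "{1}" and d = 3 and c = r and n = n and f = \<psi>])
      (use psi01 null alt r r1 \<psi>(1) in \<open>auto simp: ci_tests_def\<close>)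
  then show False by simp
qed

text \<open>For \<open>r = ci_constant / sqrt n\<close> the error bound
  \<open>24 * exp (- (n * r^2 / 6400))\<close> equals \<open>1 / 20\<close>.\<close>

definition ci_constant :: real where
  "ci_constant = 80 * sqrt (ln 480)"

lemma ci_constant_pos: "0 < ci_constant"
  by (simp add: ci_constant_def)

lemma powr_minus_half: "0 < n \<Longrightarrow> real n powr (- 1 / 2) = 1 / sqrt (real n)"
  using powr_minus_divide[of "real n" "1 / 2"] by (simp add: powr_half_sqrt)

lemma ci_radius_risk:
  assumes n: "0 < n"
  shows "test_risk (gaussian_laws 3) m_gauss n (ci_constant * real n powr (- 1 / 2))
    (psi_gauss n (ci_constant * real n powr (- 1 / 2)) 0 1 (Some 2)) \<le> ennreal (1 / 10)"
proof (rule ci_test_risk[OF n])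
  show "0 < ci_constant * real n powr (- 1 / 2)" using n ci_constant_pos by simp
  have "real n * (ci_constant * real n powr (- 1 / 2))\<^sup>2 = 6400 * ln 480"
    unfolding powr_minus_half[OF n] using n by (simp add: power_mult_distrib power_divide ci_constant_def)
  then show "24 * exp (- (real n * (ci_constant * real n powr (- 1 / 2))\<^sup>2 / 6400)) \<le> 1 / 20"
    by (simp add: exp_minus)
qed

lemma psi_gauss_ci_test: "psi_gauss n r 0 1 (Some 2) \<in> ci_tests n"
  using psi_gauss_measurable[of 0 3 1 "Some 2" n r] psi_gauss_values by (auto simp: ci_tests_def)

lemma optimal_radius_bounds:
  assumes n: "0 < n"
  shows "1 / 2 * real n powr (- 1 / 2) \<le> optimal_radius (gaussian_laws 3) m_gauss n"
    and "optimal_radius (gaussian_laws 3) m_gauss n \<le> ci_constant * real n powr (- 1 / 2)"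
proof -
  let ?R = "{r. r > 0 \<and> (INF \<psi>\<in>ci_tests n. test_risk (gaussian_laws 3) m_gauss n r \<psi>) \<le> ennreal (1 / 10)}"
  have mem: "ci_constant * real n powr (- 1 / 2) \<in> ?R"
  proof (intro CollectI conjI)
    show "ci_constant * real n powr (- 1 / 2) > 0" using n ci_constant_pos by simp
    show "(INF \<psi>\<in>ci_tests n. test_risk (gaussian_laws 3) m_gauss n (ci_constant * real n powr (- 1 / 2)) \<psi>) \<le> ennreal (1 / 10)"
      by (rule INF_lower2[OF psi_gauss_ci_test[of n "ci_constant * real n powr (- 1 / 2)"]]) (rule ci_radius_risk[OF n])
  qed
  have low: "1 / 2 * real n powr (- 1 / 2) \<le> r" if "r \<in> ?R" for r
    unfolding powr_minus_half[OF n] using ci_radius_lower[OF n, of r] that by simp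
  show "1 / 2 * real n powr (- 1 / 2) \<le> optimal_radius (gaussian_laws 3) m_gauss n"
    unfolding optimal_radius_def using mem low by (intro cInf_greatest) auto
  show "optimal_radius (gaussian_laws 3) m_gauss n \<le> ci_constant * real n powr (- 1 / 2)"
    unfolding optimal_radius_def by (intro cInf_lower mem bdd_belowI[of _ 0]) auto
qed

lemma gauss_radius_order:
  "order_equiv_on {1..} (optimal_radius (gaussian_laws 3) m_gauss) (\<lambda>n. real n powr (- 1 / 2))"
  unfolding order_equiv_on_def
  using optimal_radius_bounds ci_constant_pos
  by (intro exI[of _ "1 / 2"] exI[of _ ci_constant] conjI) auto

lemma psi_gauss_optimal:
  "optimal_test (gaussian_laws 3) m_gauss (\<lambda>n r. psi_gauss n r 0 1 (Some 2))"
  unfolding optimal_test_def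
proof (intro exI[of _ "\<lambda>n. ci_constant * real n powr (- 1 / 2)"] conjI allI impI)
  have "ci_constant * real n powr (- 1 / 2) \<le> 2 * ci_constant * optimal_radius (gaussian_laws 3) m_gauss n"
    if "0 < n" for n
    using mult_left_mono[OF optimal_radius_bounds(1)[OF that], of "2 * ci_constant"] ci_constant_pos by simp
  then show "order_equiv_on {1..} (\<lambda>n. ci_constant * real n powr (- 1 / 2)) (optimal_radius (gaussian_laws 3) m_gauss)"
    unfolding order_equiv_on_def using optimal_radius_bounds(2) ci_constant_pos
    by (intro exI[of _ 1] exI[of _ "2 * ci_constant"] conjI) auto
qed (use ci_constant_pos ci_radius_risk psi_gauss_ci_test in auto)

subsection \<open>The learning problem\<close>

definition test_indices :: "nat \<Rightarrow> (nat \<times> nat \<times> nat option) set" where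
  "test_indices d = {(j, k, l). j < k \<and> k < d \<and> l \<in> cond_choices d j k}"

lemma test_indices_subset: "test_indices d \<subseteq> {..<d} \<times> {..<d} \<times> insert None (Some ` {..<d})"
  by (auto simp: test_indices_def cond_choices_def)

lemma finite_test_indices: "finite (test_indices d)"
  by (rule finite_subset[OF test_indices_subset]) simp

lemma card_test_indices: "1 \<le> d \<Longrightarrow> card (test_indices d) \<le> 2 * d ^ 3"
proof -
  assume d: "1 \<le> d"
  have "card (test_indices d) \<le> card ({..<d} \<times> {..<d} \<times> insert None (Some ` {..<d}))"
    by (rule card_mono[OF _ test_indices_subset]) simp
  also have "\<dots> = d * (d * (d + 1))"
    by (simp add: card_cartesian_product card_insert_if card_image)
  also have "\<dots> \<le> d * (d * (2 * d))" using d by (intro mult_left_mono) auto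
  finally show ?thesis by (simp add: power3_eq_cube mult_ac)
qed

lemma cond_choices_commute: "cond_choices d j k = cond_choices d k j"
  by (simp add: cond_choices_def insert_commute)

lemma test_indices_min_max:
  assumes "j < d" "k < d" "j \<noteq> k" "l \<in> cond_choices d j k"
  shows "(min j k, max j k, l) \<in> test_indices d"
  using assms cond_choices_commute[of d j k] by (cases "j < k") (auto simp: test_indices_def min_def max_def)

lemma pc_tree_cong:
  assumes T: "\<And>j k l. (j, k, l) \<in> test_indices d \<Longrightarrow> T j k l = T' j k l"
  shows "pc_tree d T = pc_tree d T'"
proof -
  have TT: "T (min j k) (max j k) l = T' (min j k) (max j k) l"
    if "j < d" "k < d" "j \<noteq> k" "l \<in> cond_choices d j k" for j k l
    using test_indices_min_max[OF that] T by blast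
  have sk: "pc_skeleton d T = pc_skeleton d T'"
    unfolding pc_skeleton_def using TT by auto
  have sep: "pc_sep d T j k = pc_sep d T' j k" if "j < d" "k < d" "j \<noteq> k" for j k
    unfolding pc_sep_def using TT[OF that] by auto
  have less: "j < d" if "(j, l) \<in> pc_skeleton d T'" for j l
    using that by (simp add: pc_skeleton_def)
  have "pc_arrows d T = pc_arrows d T'"
    unfolding pc_arrows_def sk using sep less by blast
  then show ?thesis by (simp add: pc_tree_def pc_pattern_def sk)
qed

lemma pc_tree_subset: "pc_tree d T \<subseteq> {..<d} \<times> {..<d}"
proof -
  have "pc_pattern d T \<subseteq> {..<d} \<times> {..<d}" by (auto simp: pc_pattern_def pc_skeleton_def)
  moreover from this have "finite (pc_pattern d T)" by (rule finite_subset) simp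
  ultimately show ?thesis unfolding pc_tree_def using meek_closure_subset by blast
qed

text \<open>The output is a function of the finite set of rejecting tests, so measurability of the
  single tests suffices. The choice inside \<open>meek_closure\<close> is harmless because it comes
  after this discretization.\<close>

lemma pc_tree_gauss_estimator: "pc_tree_gauss d n c \<in> estimators d n"
proof -
  let ?P = "iid_samples n (vec_space d)"
  let ?I = "test_indices d"
  define R where "R s = {(j, k, l) \<in> ?I. psi_gauss n c j k l s = 1}" for s
  define F where "F W = pc_tree d (\<lambda>j k l. if (j, k, l) \<in> W then 1 else 0)" for W
  have FR: "pc_tree_gauss d n c s = F (R s)" for s
    unfolding pc_tree_gauss_def F_def
    by (rule pc_tree_cong) (auto simp: R_def psi_gauss_def)
  have psi: "psi_gauss n c j k l \<in> borel_measurable ?P" if "(j, k, l) \<in> ?I" for j k l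
    using that by (intro psi_gauss_measurable) (auto simp: test_indices_def cond_choices_def)
  have RW: "{s \<in> space ?P. R s = W} \<in> sets ?P" for W
  proof (cases "W \<subseteq> ?I")
    case True
    have one: "{s \<in> space ?P. (case i of (j, k, l) \<Rightarrow> psi_gauss n c j k l s = 1) = (i \<in> W)} \<in> sets ?P"
      if "i \<in> ?I" for i
    proof (cases i)
      case (fields j k l)
      have [measurable]: "psi_gauss n c j k l \<in> borel_measurable ?P" using psi that fields by simp
      show ?thesis unfolding fields by simp
    qed
    have "{s \<in> space ?P. R s = W} =
        {s \<in> space ?P. \<forall>i\<in>?I. (case i of (j, k, l) \<Rightarrow> psi_gauss n c j k l s = 1) = (i \<in> W)}"
      using True by (auto simp: R_def)
    also have "\<dots> \<in> sets ?P"
      using finite_test_indices one by (intro sets.sets_Collect_finite_All) auto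
    finally show ?thesis .
  next
    case False
    then have "{s \<in> space ?P. R s = W} = {}" by (auto simp: R_def)
    then show ?thesis by (simp only: sets.empty_sets)
  qed
  show ?thesis
    unfolding estimators_def
  proof (subst measurable_count_space_eq2, simp, intro conjI ballI)
    show "pc_tree_gauss d n c \<in> space ?P \<rightarrow> Pow ({..<d} \<times> {..<d})"
      using pc_tree_subset by (auto simp: pc_tree_gauss_def)
    fix G
    have "pc_tree_gauss d n c -` {G} \<inter> space ?P = (\<Union>W\<in>{W \<in> Pow ?I. F W = G}. {s \<in> space ?P. R s = W})"
      by (auto simp: FR R_def)
    also have "\<dots> \<in> sets ?P"
      using finite_test_indices[of d] RW by (intro sets.finite_UN) auto
    finally show "pc_tree_gauss d n c -` {G} \<inter> space ?P \<in> sets ?P" .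
  qed
qed

text \<open>A test counts as wrong only where the population value is 0 or at least
  \<open>c\<close>; for other values the event \<open>wrong\<close> is empty. Outside these events
  the outcomes meet the requirements of PC-tree, which leaves a union bound. For
  \<open>d \<le> 1\<close> there are no tests, so \<open>n = 0\<close> is admissible.\<close>

lemma pc_tree_gauss_error:
  assumes p: "(p, E) \<in> learning_problem d (gaussian_laws d) m_gauss c"
    and c: "0 < c" "c \<le> 1" and n: "0 < n \<or> d \<le> 1"
  shows "emeasure (iid_samples n p) {s \<in> space (iid_samples n p). pc_tree_gauss d n c s \<noteq> cpdag d E}
    \<le> ennreal (real (card (test_indices d)) * (24 * exp (- (real n * c\<^sup>2 / 6400))))"
proof -
  let ?P = "iid_samples n p" and ?I = "test_indices d"
  have E: "E \<in> poly_forests d" and mk: "markov_to d p E" and tf: "strong_tree_faithful d m_gauss c p E"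
    and pg: "p \<in> gaussian_laws d"
    using p by (auto simp: learning_problem_def)
  obtain \<Sigma> where "gaussian_law p d \<Sigma>" using pg by (rule gaussian_lawsE)
  then interpret gaussian_law p d \<Sigma> .
  interpret P: prob_space ?P by (rule prob_space_iid)
  note less = dag_adj_less[OF poly_forest_dag[OF E]] and neq = dag_adj_neq[OF poly_forest_dag[OF E]]
  define wrong where "wrong = (\<lambda>(j, k, l). {s \<in> space ?P.
      (m_gauss p j k l = 0 \<and> psi_gauss n c j k l s = 1) \<or> (c \<le> m_gauss p j k l \<and> psi_gauss n c j k l s = 0)})"
  have wrong_meas: "wrong i \<in> sets ?P"
    and wrong_le: "measure ?P (wrong i) \<le> 24 * exp (- (real n * c\<^sup>2 / 6400))" if i: "i \<in> ?I" for i
  proof -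
    obtain j k l where i': "i = (j, k, l)" by (cases i)
    have jk: "j < d" "k < d" "j \<noteq> k" "l \<in> cond_choices d j k"
      using i by (auto simp: i' test_indices_def)
    then have n0: "0 < n" using n i by (auto simp: i' test_indices_def)
    have [measurable]: "psi_gauss n c j k l \<in> borel_measurable ?P"
      using jk by (intro psi_gauss_measurable_iid) (auto simp: cond_choices_def)
    show "wrong i \<in> sets ?P" unfolding wrong_def i' by simp
    consider "m_gauss p j k l = 0" | "c \<le> m_gauss p j k l" | "m_gauss p j k l \<noteq> 0" "\<not> c \<le> m_gauss p j k l"
      by blast
    then show "measure ?P (wrong i) \<le> 24 * exp (- (real n * c\<^sup>2 / 6400))"
    proof cases
      case 1
      then show ?thesis
        using psi_gauss_null_error[OF jk c(1) _ n0 1] c by (simp add: wrong_def i' del: m_gauss.simps)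
    next
      case 2
      then show ?thesis
        using psi_gauss_alt_error[OF jk c(1) n0 2] c by (auto simp: wrong_def i' simp del: m_gauss.simps)
    next
      case 3
      then show ?thesis by (simp add: wrong_def i' del: m_gauss.simps)
    qed
  qed
  have "{s \<in> space ?P. pc_tree_gauss d n c s \<noteq> cpdag d E} \<subseteq> (\<Union>i\<in>?I. wrong i)"
  proof (rule subsetI, rule ccontr)
    fix s assume s: "s \<in> {s \<in> space ?P. pc_tree_gauss d n c s \<noteq> cpdag d E}" and ok: "s \<notin> (\<Union>i\<in>?I. wrong i)"
    let ?T = "\<lambda>j k l. psi_gauss n c j k l s"
    have right: "(m_gauss p (min j k) (max j k) l = 0 \<longrightarrow> ?T (min j k) (max j k) l = 0) \<and>
        (c \<le> m_gauss p (min j k) (max j k) l \<longrightarrow> ?T (min j k) (max j k) l = 1)"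
      if "j < d" "k < d" "j \<noteq> k" "l \<in> cond_choices d j k" for j k l
    proof -
      have "s \<notin> wrong (min j k, max j k, l)" using ok test_indices_min_max[OF that] by blast
      then show ?thesis
        using s psi_gauss_values[of n c "min j k" "max j k" l s] by (auto simp: wrong_def simp del: m_gauss.simps)
    qed
    have mm: "min j k = j \<and> max j k = k \<or> min j k = k \<and> max j k = j" for j k :: nat
      by (auto simp: min_def max_def)
    have Some_choice: "Some l \<in> cond_choices d j k" if "adj E j l" "adj E k l" for j k l
      using less[OF that(1)] neq[OF that(1)] neq[OF that(2)] by (auto simp: cond_choices_def)
    have "pc_tree d ?T = cpdag d E"
    proof (rule pc_tree_correct[OF E])
      fix j k assume a: "adj E j k"
      have "c \<le> m_gauss p (min j k) (max j k) l" if "l \<in> cond_choices d j k" for l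
        using tf a that adj_sym[of E j k] mm[of j k] cond_choices_commute[of d j k]
        unfolding strong_tree_faithful_def by metis
      then show "\<forall>l\<in>cond_choices d j k. ?T (min j k) (max j k) l = 1"
        using right less[OF a] neq[OF a] by blast
    next
      fix j k assume jk: "j < d" "k < d" "j \<noteq> k" "\<not> adj E j k"
      have "\<exists>l\<in>cond_choices d j k. m_gauss p (min j k) (max j k) l = 0"
        using nonadjacent_uncorrelated[OF E mk jk] nonadjacent_uncorrelated[OF E mk jk(2,1)] jk(3,4)
          adj_sym[of E j k] mm[of j k] cond_choices_commute[of d j k] by metis
      then show "\<exists>l\<in>cond_choices d j k. ?T (min j k) (max j k) l = 0"
        using right[OF jk(1-3)] by blast
    next
      fix j k l assume v: "v_structure E j l k"
      then have a: "adj E j l" "adj E k l" "j \<noteq> k" by (auto simp: v_structure_def adj_def)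
      have "c \<le> m_gauss p (min j k) (max j k) (Some l)"
        using tf v v_structure_commute[of E j l k] mm[of j k] unfolding strong_tree_faithful_def by metis
      then show "?T (min j k) (max j k) (Some l) = 1"
        using right[OF _ _ a(3) Some_choice[OF a(1,2)]] less[OF a(1)] less[OF a(2)] by blast
    next
      fix j k l assume a: "adj E j l" "adj E k l" "j \<noteq> k" and nv: "\<not> v_structure E j l k"
      have "m_gauss p (min j k) (max j k) (Some l) = 0"
        using noncollider_uncorrelated[OF E mk a nv] noncollider_uncorrelated[OF E mk a(2,1)] a(3) nv
          v_structure_commute[of E j l k] mm[of j k] by metis
      then show "?T (min j k) (max j k) (Some l) = 0"
        using right[OF _ _ a(3) Some_choice[OF a(1,2)]] less[OF a(1)] less[OF a(2)] by blast
    qed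
    then show False using s by (simp add: pc_tree_gauss_def)
  qed
  then have "emeasure ?P {s \<in> space ?P. pc_tree_gauss d n c s \<noteq> cpdag d E} \<le> emeasure ?P (\<Union>i\<in>?I. wrong i)"
    using wrong_meas finite_test_indices by (intro emeasure_mono sets.finite_UN) auto
  also have "\<dots> \<le> ennreal (\<Sum>i\<in>?I. measure ?P (wrong i))"
    using wrong_meas finite_test_indices
    by (simp add: P.emeasure_eq_measure ennreal_leI measure_UNION_le)
  also have "\<dots> \<le> ennreal (real (card ?I) * (24 * exp (- (real n * c\<^sup>2 / 6400))))"
    using sum_bounded_above[of ?I "\<lambda>i. measure ?P (wrong i)", OF wrong_le] by (intro ennreal_leI) simp
  finally show ?thesis .
qed

text \<open>\<open>83200 = 13 * 6400\<close> makes the error of a single test at most \<open>24 / d ^ 13\<close>.\<close>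

definition pc_samples :: "nat \<Rightarrow> real \<Rightarrow> nat" where
  "pc_samples d c = nat \<lceil>83200 * ln (real d) / c\<^sup>2\<rceil>"

lemma pc_tree_gauss_learns:
  assumes d: "1 \<le> d" and c: "0 < c" "c \<le> 1"
  shows "learns d (pc_samples d c) (learning_problem d (gaussian_laws d) m_gauss c)
    (pc_tree_gauss d (pc_samples d c) c)"
  unfolding learns_def
proof (intro conjI pc_tree_gauss_estimator SUP_least, clarify)
  fix p E assume p: "(p, E) \<in> learning_problem d (gaussian_laws d) m_gauss c"
  let ?n = "pc_samples d c"
  have n: "83200 * ln (real d) / c\<^sup>2 \<le> real ?n" unfolding pc_samples_def by linarith
  have bound: "real (card (test_indices d)) * (24 * exp (- (real ?n * c\<^sup>2 / 6400))) \<le> 1 / 10"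
  proof (cases "d = 1")
    case True
    then have "test_indices d = {}" by (auto simp: test_indices_def)
    then show ?thesis by simp
  next
    case False
    then have d2: "2 \<le> real d" using d by simp
    have "83200 * ln (real d) \<le> real ?n * c\<^sup>2" using n c by (simp add: pos_divide_le_eq)
    then have "exp (- (real ?n * c\<^sup>2 / 6400)) \<le> exp (- (13 * ln (real d)))" by simp
    also have "\<dots> = 1 / real d ^ 13"
      using d2 exp_of_nat_mult[of 13 "ln (real d)"] by (simp add: exp_minus field_simps)
    finally have "real (card (test_indices d)) * (24 * exp (- (real ?n * c\<^sup>2 / 6400))) \<le>
        real (2 * d ^ 3) * (24 * (1 / real d ^ 13))"
      using card_test_indices[OF d] by (intro mult_mono) (auto simp: of_nat_mono simp del: of_nat_mult of_nat_power)
    \<comment> \<open>The union over at most \<open>2 * d^3\<close> tests leaves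
      \<open>48 / d^10\<close>, which for \<open>d \<ge> 2\<close> is at most
      \<open>48 / 1024\<close>.\<close>
    also have "\<dots> = 48 / real d ^ 10" using d2 by (simp add: field_simps flip: power_add)
    also have "\<dots> \<le> 48 / 2 ^ 10" using d2 by (intro divide_left_mono power_mono) auto
    finally show ?thesis by simp
  qed
  have "0 < ?n \<or> d \<le> 1"
  proof (cases "d \<le> 1")
    case False
    then have "0 < 83200 * ln (real d) / c\<^sup>2" using c by simp
    then show ?thesis using n by linarith
  qed simp
  then have "emeasure (iid_samples ?n p) {s \<in> space (iid_samples ?n p). pc_tree_gauss d ?n c s \<noteq> cpdag d E}
    \<le> ennreal (real (card (test_indices d)) * (24 * exp (- (real ?n * c\<^sup>2 / 6400))))"
    by (rule pc_tree_gauss_error[OF p c])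
  also have "\<dots> \<le> ennreal (1 / 10)" by (rule ennreal_leI[OF bound])
  finally show "emeasure (iid_samples ?n p) {s \<in> space (iid_samples ?n p). pc_tree_gauss d ?n c s \<noteq> cpdag d E}
    \<le> ennreal (1 / 10)" .
qed

text \<open>Rounding up adds at most 1, which is absorbed by \<open>ln d / c^2 \<ge> ln 2\<close>
  for \<open>d \<ge> 2\<close>. For \<open>d = 1\<close> both sides are 0.\<close>

lemma pc_samples_le:
  assumes d: "1 \<le> d" and c: "0 < c" "c \<le> 1"
  shows "real (pc_samples d c) \<le> (83200 + 1 / ln 2) * (ln (real d) / c\<^sup>2)"
proof (cases "d = 1")
  case True
  then show ?thesis by (simp add: pc_samples_def)
next
  case False
  then have d2: "2 \<le> real d" using d by simp
  have "c\<^sup>2 \<le> 1" using c by (simp add: power_le_one)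
  have "ln 2 * c\<^sup>2 \<le> ln (real d) * 1" using d2 \<open>c\<^sup>2 \<le> 1\<close> by (intro mult_mono) auto
  then have "1 \<le> 1 / ln 2 * (ln (real d) / c\<^sup>2)" using c by (simp add: field_simps)
  moreover have "0 \<le> 83200 * ln (real d) / c\<^sup>2" using d2 by simp
  then have "real (pc_samples d c) \<le> 83200 * ln (real d) / c\<^sup>2 + 1" unfolding pc_samples_def by linarith
  then have "real (pc_samples d c) \<le> 83200 * (ln (real d) / c\<^sup>2) + 1" by simp
  ultimately show ?thesis unfolding distrib_right by linarith
qed

lemma cpdag_empty: "cpdag d {} = {}"
proof -
  have "F = {}" if "same_pattern {} F" for F
  proof -
    have "\<not> adj F a b" for a b using that by (auto simp: same_pattern_def adj_def)
    then show ?thesis by (auto simp: adj_def)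
  qed
  then show ?thesis unfolding cpdag_eq[OF empty_poly_forest] by blast
qed

lemma cpdag_single_edge: "0 < k \<Longrightarrow> k < d \<Longrightarrow> cpdag d {(0, k)} \<noteq> {}"
  using cpdag_eq[OF single_edge_poly_forest] self_in_class[OF single_edge_poly_forest] by blast

lemma edge_law_learning_problem:
  assumes k: "0 < k" "k < d" and c: "0 < c" "c < 1"
  shows "(edge_law d k c, {(0, k)}) \<in> learning_problem d (gaussian_laws d) m_gauss c"
proof -
  have "strong_tree_faithful d m_gauss c (edge_law d k c) {(0, k)}"
    unfolding strong_tree_faithful_def
  proof (intro conjI allI impI ballI)
    fix j h l assume "adj {(0, k)} j h" and l: "l \<in> cond_choices d j h"
    then have "{h, j} = {0, k}" by (auto simp: adj_def)
    then show "c \<le> m_gauss (edge_law d k c) h j l"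
      using m_gauss_edge_law[OF k _ c(2), of h j l] c l cond_choices_commute[of d h j] by simp
  next
    fix a l j assume "v_structure {(0, k)} a l j"
    then show "c \<le> m_gauss (edge_law d k c) a j (Some l)" by (simp add: v_structure_def)
  qed
  then show ?thesis
    using edge_law_gaussian[OF k] edge_law_markov[OF k] single_edge_poly_forest[OF k] c
    by (simp add: learning_problem_def)
qed

lemma std_normal_vec_learning_problem:
  assumes k: "0 < k" "k < d"
  shows "(std_normal_vec d, {}) \<in> learning_problem d (gaussian_laws d) m_gauss c"
  using edge_law_gaussian[OF k, of 0] std_normal_vec_markov[OF k] empty_poly_forest
  by (simp add: learning_problem_def edge_law_0 strong_tree_faithful_def adj_def v_structure_def)

text \<open>An estimator becomes a test that rejects when its output is not the empty graph, the
  CPDAG of the independent law. The mixture ranges over the \<open>d - 1\<close> partners of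
  coordinate 0, so a second moment of \<open>sqrt d\<close> is still harmless. The factor
  \<open>1 - c0^2\<close> stems from bounding \<open>- ln (1 - c^2)\<close> by
  \<open>c^2 / (1 - c0^2)\<close>; it degenerates as \<open>c0\<close> tends to 1.\<close>

lemma learning_lower_bound:
  assumes d: "1 \<le> d" and c: "0 < c" "c \<le> c0" "c0 < 1"
    and learns: "learns d n (learning_problem d (gaussian_laws d) m_gauss c) G_hat"
  shows "(1 - c0\<^sup>2) / 2 * (ln (real d) / c\<^sup>2) \<le> real n"
proof (rule ccontr)
  assume "\<not> (1 - c0\<^sup>2) / 2 * (ln (real d) / c\<^sup>2) \<le> real n"
  then have less: "real n < (1 - c0\<^sup>2) / 2 * (ln (real d) / c\<^sup>2)" by simp
  have d1: "d \<noteq> 1" using less by auto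
  then have d2: "2 \<le> d" using d by simp
  have c1: "c < 1" using c by simp
  have p0: "0 < 1 - c0\<^sup>2" using c by (intro one_minus_square_pos) auto
  have cc: "c\<^sup>2 \<le> c0\<^sup>2" using c by (intro power_mono) auto
  have pc: "0 < 1 - c\<^sup>2" using p0 cc by simp
  have "ln (1 / (1 - c\<^sup>2)) \<le> 1 / (1 - c\<^sup>2) - 1" using pc by (intro ln_le_minus_one) simp
  also have "\<dots> = c\<^sup>2 / (1 - c\<^sup>2)" using pc by (simp add: field_simps)
  also have "\<dots> \<le> c\<^sup>2 / (1 - c0\<^sup>2)" using p0 pc cc by (intro divide_left_mono) auto
  finally have "real n * ln (1 / (1 - c\<^sup>2)) \<le> real n * (c\<^sup>2 / (1 - c0\<^sup>2))" by (intro mult_left_mono) auto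
  also have "\<dots> \<le> ln (real d) / 2"
  proof -
    have "real n * c\<^sup>2 \<le> (1 - c0\<^sup>2) / 2 * ln (real d)"
      using less c by (simp add: pos_less_divide_eq)
    then show ?thesis using p0 by (simp add: field_simps)
  qed
  also have "\<dots> = ln (sqrt (real d))" using d2 by (simp add: ln_sqrt)
  finally have "ln ((1 / (1 - c\<^sup>2)) ^ n) \<le> ln (sqrt (real d))" using pc by (simp add: ln_realpow)
  then have "(1 / (1 - c\<^sup>2)) ^ n \<le> sqrt (real d)" using pc d2 by (subst (asm) ln_le_cancel_iff) auto
  \<comment> \<open>\<open>(1 + d) / 2 - 1 = (d - 1) / 2\<close> is exactly half the number of
    alternatives.\<close>
  also have "sqrt (real d) \<le> (1 + real d) / 2" using arith_geo_mean_sqrt[of 1 "real d"] by simp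
  finally have V: "(1 / (1 - c\<^sup>2)) ^ n - 1 \<le> real (card {0<..<d}) / 2"
    using d by (simp add: of_nat_diff field_simps)
  let ?Q = "iid_samples n (vec_space d)"
  define f :: "(nat \<Rightarrow> nat \<Rightarrow> real) \<Rightarrow> real" where "f s = (if G_hat s = {} then 0 else 1)" for s
  have Gm: "G_hat \<in> ?Q \<rightarrow>\<^sub>M count_space (Pow ({..<d} \<times> {..<d}))"
    using learns by (simp add: learns_def estimators_def)
  have setG: "{s \<in> space ?Q. G_hat s \<in> U} \<in> sets ?Q" for U
  proof -
    have "{s \<in> space ?Q. G_hat s \<in> U} = G_hat -` (U \<inter> Pow ({..<d} \<times> {..<d})) \<inter> space ?Q"
      using measurable_space[OF Gm] by auto
    also have "\<dots> \<in> sets ?Q" by (rule measurable_sets[OF Gm]) auto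
    finally show ?thesis .
  qed
  have f: "f \<in> borel_measurable ?Q"
    unfolding f_def[abs_def] using setG[of "{{}}"] by (intro measurable_If) auto
  have err: "(\<integral>\<^sup>+ s. ennreal (g s) \<partial>iid_samples n p) \<le> ennreal (1 / 10)"
    if p: "(p, E) \<in> learning_problem d (gaussian_laws d) m_gauss c"
      and g: "\<And>s. g s = 0 \<or> g s = 1 \<and> G_hat s \<noteq> cpdag d E" for p E and g :: "(nat \<Rightarrow> nat \<Rightarrow> real) \<Rightarrow> real"
  proof -
    obtain \<Sigma> where "gaussian_law p d \<Sigma>" using p by (auto simp: learning_problem_def elim: gaussian_lawsE)
    then interpret gaussian_law p d \<Sigma> .
    let ?A = "{s \<in> space (iid_samples n p). G_hat s \<noteq> cpdag d E}"
    have sp: "space (iid_samples n p) = space ?Q" using sets_iid by (rule sets_eq_imp_space_eq)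
    have "?A \<in> sets (iid_samples n p)"
      using setG[of "- {cpdag d E}"] by (simp add: sp sets_iid)
    then have "(\<integral>\<^sup>+ s. indicator ?A s \<partial>iid_samples n p) = emeasure (iid_samples n p) ?A" by simp
    moreover have "(\<integral>\<^sup>+ s. ennreal (g s) \<partial>iid_samples n p) \<le> (\<integral>\<^sup>+ s. indicator ?A s \<partial>iid_samples n p)"
    proof (rule nn_integral_mono)
      fix s assume "s \<in> space (iid_samples n p)"
      then show "ennreal (g s) \<le> indicator ?A s" using g[of s] by (auto simp: indicator_def)
    qed
    moreover have "emeasure (iid_samples n p) ?A \<le> ennreal (1 / 10)"
      using learns SUP_upper[OF p, of "\<lambda>(p, E). emeasure (iid_samples n p) {s \<in> space (iid_samples n p). G_hat s \<noteq> cpdag d E}"]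
      by (auto simp: learns_def intro: order_trans)
    ultimately show ?thesis by simp
  qed
  have "1 / 4 < 1 / 10 + (1 / 10 :: real)"
  proof (rule testing_lower_bound[OF _ _ _ _ c1 V f])
    have "1 \<in> {0<..<d}" using d2 by simp
    then show "{0<..<d} \<noteq> {}" by blast
    show "(\<integral>\<^sup>+ s. ennreal (f s) \<partial>iid_samples n (std_normal_vec d)) \<le> ennreal (1 / 10)"
      using d2 by (intro err[OF std_normal_vec_learning_problem[of 1]]) (auto simp: f_def cpdag_empty)
    show "(\<integral>\<^sup>+ s. ennreal (1 - f s) \<partial>iid_samples n (edge_law d k c)) \<le> ennreal (1 / 10)" if "k \<in> {0<..<d}" for k
      using that cpdag_single_edge[of k d] c c1
      by (intro err[OF edge_law_learning_problem[of k]]) (auto simp: f_def)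
  qed (use d2 c in \<open>auto simp: f_def\<close>)
  then show False by simp
qed

lemma sample_complexity_bounds:
  assumes d: "1 \<le> d" and c: "0 < c" "c \<le> c0" "c0 < 1"
  defines "m \<equiv> sample_complexity d (learning_problem d (gaussian_laws d) m_gauss c)"
  shows "(1 - c0\<^sup>2) / 2 * (ln (real d) / c\<^sup>2) \<le> real m" "m \<le> pc_samples d c"
proof -
  let ?N = "{n. \<exists>G_hat. learns d n (learning_problem d (gaussian_laws d) m_gauss c) G_hat}"
  have mem: "pc_samples d c \<in> ?N" using pc_tree_gauss_learns[OF d c(1)] c by auto
  then have "m \<in> ?N" unfolding m_def sample_complexity_def by (intro Inf_nat_def1) auto
  then show "(1 - c0\<^sup>2) / 2 * (ln (real d) / c\<^sup>2) \<le> real m" using learning_lower_bound[OF d c] by blast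
  show "m \<le> pc_samples d c"
    unfolding m_def sample_complexity_def by (rule cInf_lower[OF mem]) simp
qed

theorem theorem4p2:
  shows "order_equiv_on {1..} (optimal_radius (gaussian_laws 3) m_gauss)
           (\<lambda>n. real n powr (- 1 / 2)) \<and>
         optimal_test (gaussian_laws 3) m_gauss (\<lambda>n r. psi_gauss n r 0 1 (Some 2)) \<and>
         (\<forall>c0. 0 < c0 \<and> c0 < 1 \<longrightarrow>
           order_equiv_on {(d, c). 1 \<le> d \<and> 0 < c \<and> c \<le> c0}
             (\<lambda>(d, c). real (sample_complexity d (learning_problem d (gaussian_laws d) m_gauss c)))
             (\<lambda>(d, c). ln (real d) / c\<^sup>2) \<and>
           (\<exists>N :: nat \<Rightarrow> real \<Rightarrow> nat.
             order_equiv_on {(d, c). 1 \<le> d \<and> 0 < c \<and> c \<le> c0}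
               (\<lambda>(d, c). real (N d c))
               (\<lambda>(d, c). real (sample_complexity d (learning_problem d (gaussian_laws d) m_gauss c))) \<and>
             (\<forall>d c. 1 \<le> d \<and> 0 < c \<and> c \<le> c0 \<longrightarrow>
               learns d (N d c) (learning_problem d (gaussian_laws d) m_gauss c)
                 (pc_tree_gauss d (N d c) c))))"
proof (intro conjI allI impI gauss_radius_order psi_gauss_optimal)
  fix c0 :: real assume c0: "0 < c0 \<and> c0 < 1"
  let ?m = "\<lambda>d c. sample_complexity d (learning_problem d (gaussian_laws d) m_gauss c)"
  define a where "a = (1 - c0\<^sup>2) / 2"
  define b where "b = 83200 + 1 / ln (2 :: real)"
  have a: "0 < a" using c0 one_minus_square_pos[of c0] by (simp add: a_def)
  have b: "0 < b" by (simp add: b_def add_pos_pos)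
  have lower: "a * (ln (real d) / c\<^sup>2) \<le> real (?m d c)"
    and mid: "real (?m d c) \<le> real (pc_samples d c)"
    and upper: "real (pc_samples d c) \<le> b * (ln (real d) / c\<^sup>2)"
    if "1 \<le> d" "0 < c" "c \<le> c0" for d c
    using sample_complexity_bounds[of d c c0] pc_samples_le[of d c] that c0 by (simp_all add: a_def b_def)
  show "order_equiv_on {(d, c). 1 \<le> d \<and> 0 < c \<and> c \<le> c0} (\<lambda>(d, c). real (?m d c)) (\<lambda>(d, c). ln (real d) / c\<^sup>2)"
    unfolding order_equiv_on_def using a b lower order_trans[OF mid upper]
    by (intro exI[of _ a] exI[of _ b] conjI) auto
  \<comment> \<open>The sample size of PC-tree is compared with the optimal one through
    \<open>ln d / c^2\<close>. For \<open>d = 1\<close> all three quantities vanish, so the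
    constants need no exception there.\<close>
  have up': "real (pc_samples d c) \<le> b / a * real (?m d c)" if "1 \<le> d" "0 < c" "c \<le> c0" for d c
  proof -
    have "b / a * (a * (ln (real d) / c\<^sup>2)) \<le> b / a * real (?m d c)"
      using lower[OF that] a b by (intro mult_left_mono) auto
    then show ?thesis using upper[OF that] a by simp
  qed
  show "\<exists>N :: nat \<Rightarrow> real \<Rightarrow> nat.
      order_equiv_on {(d, c). 1 \<le> d \<and> 0 < c \<and> c \<le> c0} (\<lambda>(d, c). real (N d c)) (\<lambda>(d, c). real (?m d c)) \<and>
      (\<forall>d c. 1 \<le> d \<and> 0 < c \<and> c \<le> c0 \<longrightarrow>
        learns d (N d c) (learning_problem d (gaussian_laws d) m_gauss c) (pc_tree_gauss d (N d c) c))"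
  proof (intro exI[of _ pc_samples] conjI allI impI)
    show "order_equiv_on {(d, c). 1 \<le> d \<and> 0 < c \<and> c \<le> c0} (\<lambda>(d, c). real (pc_samples d c)) (\<lambda>(d, c). real (?m d c))"
      unfolding order_equiv_on_def using a b mid up'
      by (intro exI[of _ 1] exI[of _ "b / a"] conjI) auto
    fix d :: nat and c :: real assume "1 \<le> d \<and> 0 < c \<and> c \<le> c0"
    then show "learns d (pc_samples d c) (learning_problem d (gaussian_laws d) m_gauss c)
        (pc_tree_gauss d (pc_samples d c) c)"
      using c0 by (intro pc_tree_gauss_learns) auto
  qed
qed

end
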